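(* Let $X_1,\dots,X_n$ be independent zero-mean (integrable) real random variables, and let $U_1,\dots,U_n$ be independent random variables uniformly distributed on $[0,1]$ which are also independent of $X_1,\dots,X_n$. Let $\mathsf r_i:=\mathsf r_{X_i}$ be the reciprocating function of $X_i$, let $Y_i:=|X_i\,\mathsf r_i(X_i,U_i)|$, and for $\lambda>0$ let $$S_{Y,\lambda}:=\frac{X_1+\dots+X_n}{(Y_1^\lambda+\dots+Y_n^\lambda)^{\frac1{2\lambda}}},\qquad\tfrac00:=0.$$ Suppose that for some $p\in(0,1)$ and all $i\in\{1,\dots,n\}$ $$\frac{X_i}{|\mathsf r_i(X_i,U_i)|}\,\mathrm I\{X_i>0\}\le\frac{1-p}p\quad\text{a.s.}$$ (the left-hand side being understood as $0$ when $X_i\le0$). Let $$\lambda_*(p):=\begin{cases}\dfrac{1+p+2p^2}{2\big(\sqrt{p-p^2}+2p^2\big)}&\text{if }0<p\le\frac12,\\[2mm]1&\text{if }\frac12\le p<1.\end{cases}$$ Then for all $\lambda\ge\lambda_*(p)$ one has $$\mathsf E f(S_{Y,\lambda})\le\mathsf E f(T_n)\quad\text{for all }f\in\mathcal H_+^3$$ and $$\mathsf P(S_{Y,\lambda}\ge x)\le c_{3,0}\,\mathsf P^{\mathsf{LC}}(T_n\ge x)\quad\text{for all }x\in\mathbb R,$$ where $T_n:=(Z_1+\dots+Z_n)/n^{1/(2\lambda)}$; $Z_1,\dots,Z_n$ are independent random variables each having the standardized Bernoulli distribution with parameter $p$; the function $x\mapsto\mathsf P^{\mathsf{LC}}(T_n\ge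 x)$ is the least log-concave majorant of the function $x\mapsto\mathsf P(T_n\ge x)$ on $\mathbb R$; and $c_{3,0}=2e^3/9=4.4634\dots$. Moreover, for each $p\in(0,1)$ the lower bound $\lambda_*(p)$ on $\lambda$ is the best possible one: for no positive $\lambda_0<\lambda_*(p)$ does the inequality $\mathsf E f(S_{Y,\lambda})\le\mathsf E f(T_n)$ hold for all $\lambda\ge\lambda_0$, all $n$, all $f\in\mathcal H_+^3$, and all independent zero-mean (integrable) real random variables $X_1,\dots,X_n$ such that, with $U_1,\dots,U_n$ independent, uniformly distributed on $[0,1]$, and independent of $X_1,\dots,X_n$, and with $\mathsf r_i=\mathsf r_{X_i}$, one has $\frac{X_i}{|\mathsf r_i(X_i,U_i)|}\,\mathrm I\{X_i>0\}\le\frac{1-p}p$ a.s. for all $i\in\{1,\dots,n\}$.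
   Context: Function class. For a natural number $\alpha$, $\mathcal H_+^\alpha$ is the class of all functions $f\colon\mathbb R\to\mathbb R$ having finite derivatives $f^{(0)}:=f,f^{(1)},\dots,f^{(\alpha-1)}$ on $\mathbb R$, with $f^{(\alpha-1)}$ convex on $\mathbb R$ and $\lim_{x\to-\infty}f^{(j)}(x)=0$ for $j=0,1,\dots,\alpha-1$. The standardized Bernoulli distribution with parameter $p$ is the distribution of $(B-p)/\sqrt{p(1-p)}$ with $\mathsf P(B=1)=p=1-\mathsf P(B=0)$. $\mathrm I\{\cdot\}$ is the indicator. Reciprocating function. For a finite nonnegative Borel measure $\nu$ on $\mathbb R$ (extended to $[-\infty,\infty]$ by $\nu(\{\pm\infty\})=0$) define $G=G_\nu\colon[-\infty,\infty]\to[0,\infty]$ by $G(x)=\int_{(0,x]}z\,\nu(dz)$ for $x\in[0,\infty]$ and $G(x)=\int_{[x,0)}(-z)\,\nu(dz)$ for $x\in[-\infty,0]$. For $h\in[-\infty,\infty]$ let $x_+(h)=\inf\{x\in[0,\infty]\colon G(x)\ge h\}$ and $x_-(h)=\sup\{x\in[-\infty,0]\colon G(x)\ge h\}$ (with $\inf\emptyset=\infty$, $\sup\emptyset=-\infty$). For $u\in[0,1]$ let $\tilde G(x,u)=G(x-)+(G(x)-G(x-))u$ if $x\in[0,\infty]$ and $\tilde G(x,u)=G(x+)+(G(x)-G(x+))u$ if $x\in[-\infty,0]$ (one-sided limits; note $G$ is continuous at $0$, $G(0)=0$). The reciprocating function of $\nu$ is $\mathsf r_\nu(x,u)=x_-(\tilde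 G(x,u))$ if $x\in[0,\infty]$ and $\mathsf r_\nu(x,u)=x_+(\tilde G(x,u))$ if $x\in[-\infty,0]$, $u\in[0,1]$. For a random variable $X$, $\mathsf r_X:=\mathsf r_\nu$ with $\nu$ the distribution of $X$. (For zero-mean $X$ and independent uniform $U$, $\mathsf r_X(X,U)$ is a.s. finite, and a.s. nonzero on $\{X\ne0\}$.) *)

theory Defs
  imports "HOL-Probability.Probability"
begin

definition H_plus :: "nat \<Rightarrow> (real \<Rightarrow> real) set" where
  "H_plus \<alpha> = {f.
     (\<forall>j<\<alpha> - 1. \<forall>x. (deriv ^^ j) f field_differentiable at x) \<and>
     convex_on UNIV ((deriv ^^ (\<alpha> - 1)) f) \<and>
     (\<forall>j<\<alpha>. ((deriv ^^ j) f \<longlongrightarrow> 0) at_bot)}"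

lemma nonneg_of_mono_at_bot:
  fixes g :: "real \<Rightarrow> real"
  assumes "mono g" and "(g \<longlongrightarrow> 0) at_bot"
  shows "0 \<le> g x"
proof -
  have "eventually (\<lambda>y. g y \<le> g x) at_bot"
    using eventually_le_at_bot[of x] by eventually_elim (rule monoD[OF assms(1)])
  then show ?thesis
    using assms(2) by (intro tendsto_upperbound[of g 0 at_bot "g x"]) auto
qed

lemma convex_tendsto_at_bot_mono:
  fixes g :: "real \<Rightarrow> real"
  assumes cvx: "convex_on UNIV g" and lim: "(g \<longlongrightarrow> 0) at_bot"
  shows "mono g"
proof (rule monoI, rule ccontr)
  fix x z :: real
  assume "x \<le> z" and "\<not> g x \<le> g z"
  then have xz: "x < z" and gxz: "g z < g x" by (auto simp: less_le)
  define c where "c = (g x - g z) / (z - x)"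
  have c: "c > 0" using xz gxz by (simp add: c_def)
  have lower: "g x + c * (x - y) \<le> g y" if "y < x" for y
  proof -
    have "(g y - g x) / (y - x) \<le> (g x - g z) / (x - z)"
      using convex_on_slope_le[OF cvx, of x y z] that xz
      by (smt (verit) UNIV_I convex_on_slope_le cvx greaterThanLessThan_iff
            minus_diff_eq minus_divide_divide)
    also have "\<dots> = - c" by (simp add: c_def divide_simps) (use xz in \<open>simp add: algebra_simps\<close>)
    finally show ?thesis using that by (simp add: divide_simps algebra_simps split: if_splits)
  qed
  have "eventually (\<lambda>y. g y < 1) at_bot"
    using lim by (rule order_tendstoD) simp
  moreover have "eventually (\<lambda>y. y < x) at_bot" by (rule eventually_gt_at_bot)
  moreover have "eventually (\<lambda>y. y \<le> x - (1 + \<bar>g x\<bar>) / c) at_bot"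
    by (rule eventually_le_at_bot)
  ultimately have "eventually (\<lambda>y::real. False) at_bot"
  proof eventually_elim
    case (elim y)
    have "(1 + \<bar>g x\<bar>) / c \<le> x - y" using elim by simp
    then have "1 + \<bar>g x\<bar> \<le> c * (x - y)" using c by (simp add: field_simps)
    then show False using lower[of y] elim by linarith
  qed
  then show False by simp
qed

text \<open>Members of the class are nonnegative, so their expectations are meaningful as
  nonnegative integrals with values in \<open>[0, \<infinity>]\<close>.\<close>

lemma H_plus_nonneg:
  assumes f: "f \<in> H_plus \<alpha>" and "\<alpha> \<ge> 1"
  shows "0 \<le> f x"
proof -
  have "\<forall>x. 0 \<le> (deriv ^^ (\<alpha> - 1 - k)) f x" for k
  proof (induction k)
    case 0
    have "mono ((deriv ^^ (\<alpha> - 1)) f)" and "((deriv ^^ (\<alpha> - 1)) f \<longlongrightarrow> 0) at_bot"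
      using f \<open>\<alpha> \<ge> 1\<close> convex_tendsto_at_bot_mono by (auto simp: H_plus_def)
    then show ?case using nonneg_of_mono_at_bot by simp
  next
    case (Suc k)
    show ?case
    proof (cases "k < \<alpha> - 1")
      case False
      then show ?thesis using Suc by simp
    next
      case True
      define j where "j = \<alpha> - 1 - Suc k"
      have j: "\<alpha> - 1 - k = Suc j" "j < \<alpha> - 1" using True by (auto simp: j_def)
      let ?g = "(deriv ^^ j) f"
      have "(?g has_real_derivative (deriv ^^ Suc j) f x) (at x)" for x
        using f j by (simp add: H_plus_def field_differentiable_derivI)
      moreover have "0 \<le> (deriv ^^ Suc j) f x" for x using Suc j by metis
      ultimately have "mono ?g"
        by (intro monoI) (rule DERIV_nonneg_imp_nondecreasing, auto)
      moreover have "(?g \<longlongrightarrow> 0) at_bot" using f j by (simp add: H_plus_def)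
      ultimately show ?thesis using nonneg_of_mono_at_bot j_def by blast
    qed
  qed
  from this[of "\<alpha> - 1"] show ?thesis by simp
qed

definition G_fun :: "real measure \<Rightarrow> ereal \<Rightarrow> ereal" where
  "G_fun \<nu> x =
     (if 0 \<le> x then enn2ereal (\<integral>\<^sup>+z\<in>{z. 0 < z \<and> ereal z \<le> x}. ennreal z \<partial>\<nu>)
      else enn2ereal (\<integral>\<^sup>+z\<in>{z. x \<le> ereal z \<and> z < 0}. ennreal (- z) \<partial>\<nu>))"

definition x_plus :: "real measure \<Rightarrow> ereal \<Rightarrow> ereal" where
  "x_plus \<nu> h = Inf {x. 0 \<le> x \<and> h \<le> G_fun \<nu> x}"

definition x_minus :: "real measure \<Rightarrow> ereal \<Rightarrow> ereal" where
  "x_minus \<nu> h = Sup {x. x \<le> 0 \<and> h \<le> G_fun \<nu> x}"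

definition G_tilde :: "real measure \<Rightarrow> ereal \<Rightarrow> real \<Rightarrow> ereal" where
  "G_tilde \<nu> x u =
     (if 0 \<le> x then
        Lim (at_left x) (G_fun \<nu>) + (G_fun \<nu> x - Lim (at_left x) (G_fun \<nu>)) * ereal u
      else
        Lim (at_right x) (G_fun \<nu>) + (G_fun \<nu> x - Lim (at_right x) (G_fun \<nu>)) * ereal u)"

text \<open>For finite \<open>\<nu>\<close> the two branches agree at \<open>x = 0\<close>, both giving \<open>0\<close>.\<close>

definition recip :: "real measure \<Rightarrow> ereal \<Rightarrow> real \<Rightarrow> ereal" where
  "recip \<nu> x u =
     (if 0 \<le> x then x_minus \<nu> (G_tilde \<nu> x u) else x_plus \<nu> (G_tilde \<nu> x u))"

definition recip_rv ::
  "'a measure \<Rightarrow> (nat \<Rightarrow> 'a \<Rightarrow> real) \<Rightarrow> (nat \<Rightarrow> 'a \<Rightarrow> real) \<Rightarrow> nat \<Rightarrow> 'a \<Rightarrow> ereal" where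
  "recip_rv M X U i \<omega> = recip (distr M borel (X i)) (ereal (X i \<omega>)) (U i \<omega>)"

text \<open>For the families considered below \<open>recip_rv M X U i\<close> is almost surely finite, so
  \<^const>\<open>real_of_ereal\<close> discards nothing but a null set.\<close>

definition Y_rv ::
  "'a measure \<Rightarrow> (nat \<Rightarrow> 'a \<Rightarrow> real) \<Rightarrow> (nat \<Rightarrow> 'a \<Rightarrow> real) \<Rightarrow> nat \<Rightarrow> 'a \<Rightarrow> real" where
  "Y_rv M X U i \<omega> = real_of_ereal \<bar>ereal (X i \<omega>) * recip_rv M X U i \<omega>\<bar>"

text \<open>The convention \<open>0/0 = 0\<close> is that of the division on \<^typ>\<open>real\<close>.\<close>

definition S_Y ::
  "'a measure \<Rightarrow> nat \<Rightarrow> (nat \<Rightarrow> 'a \<Rightarrow> real) \<Rightarrow> (nat \<Rightarrow> 'a \<Rightarrow> real) \<Rightarrow> real \<Rightarrow> 'a \<Rightarrow> real" where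
  "S_Y M n X U l \<omega> =
     (\<Sum>i\<in>{1..n}. X i \<omega>) / (\<Sum>i\<in>{1..n}. Y_rv M X U i \<omega> powr l) powr (1 / (2 * l))"

definition zero_mean_unif_family ::
  "'a measure \<Rightarrow> nat \<Rightarrow> (nat \<Rightarrow> 'a \<Rightarrow> real) \<Rightarrow> (nat \<Rightarrow> 'a \<Rightarrow> real) \<Rightarrow> bool" where
  "zero_mean_unif_family M n X U \<longleftrightarrow>
     prob_space M \<and>
     prob_space.indep_vars M (\<lambda>_. borel) X {1..n} \<and>
     (\<forall>i\<in>{1..n}. integrable M (X i) \<and> integral\<^sup>L M (X i) = 0) \<and>
     prob_space.indep_vars M (\<lambda>_. borel) U {1..n} \<and>
     (\<forall>i\<in>{1..n}. distr M borel (U i) = uniform_measure lborel {0..1}) \<and>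
     prob_space.indep_var M
       (PiM {1..n} (\<lambda>_. borel)) (\<lambda>\<omega>. \<lambda>i\<in>{1..n}. X i \<omega>)
       (PiM {1..n} (\<lambda>_. borel)) (\<lambda>\<omega>. \<lambda>i\<in>{1..n}. U i \<omega>)"

definition recip_ratio_bound ::
  "'a measure \<Rightarrow> nat \<Rightarrow> (nat \<Rightarrow> 'a \<Rightarrow> real) \<Rightarrow> (nat \<Rightarrow> 'a \<Rightarrow> real) \<Rightarrow> real \<Rightarrow> bool" where
  "recip_ratio_bound M n X U p \<longleftrightarrow>
     (\<forall>i\<in>{1..n}. AE \<omega> in M.
        (if X i \<omega> > 0 then ereal (X i \<omega>) / \<bar>recip_rv M X U i \<omega>\<bar> else 0)
          \<le> ereal ((1 - p) / p))"

definition std_bernoulli :: "real \<Rightarrow> real measure" where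
  "std_bernoulli p =
     distr (measure_pmf (bernoulli_pmf p)) borel (\<lambda>b. (of_bool b - p) / sqrt (p * (1 - p)))"

definition std_bernoulli_family ::
  "'b measure \<Rightarrow> nat \<Rightarrow> real \<Rightarrow> (nat \<Rightarrow> 'b \<Rightarrow> real) \<Rightarrow> bool" where
  "std_bernoulli_family N n p Z \<longleftrightarrow>
     prob_space N \<and>
     prob_space.indep_vars N (\<lambda>_. borel) Z {1..n} \<and>
     (\<forall>i\<in>{1..n}. distr N borel (Z i) = std_bernoulli p)"

definition T_sum :: "nat \<Rightarrow> (nat \<Rightarrow> 'b \<Rightarrow> real) \<Rightarrow> real \<Rightarrow> 'b \<Rightarrow> real" where
  "T_sum n Z l \<omega> = (\<Sum>i\<in>{1..n}. Z i \<omega>) / real n powr (1 / (2 * l))"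

definition lambda_star :: "real \<Rightarrow> real" where
  "lambda_star p =
     (if p \<le> 1 / 2 then (1 + p + 2 * p\<^sup>2) / (2 * (sqrt (p - p\<^sup>2) + 2 * p\<^sup>2)) else 1)"

text \<open>\<open>ln g\<close> is to be concave as a function with values in \<open>[-\<infinity>, \<infinity>)\<close>, where
  \<open>ln 0 = -\<infinity>\<close>; note that \<^const>\<open>concave_on\<close> requires its domain to be convex.\<close>

definition logconcave_fun :: "(real \<Rightarrow> real) \<Rightarrow> bool" where
  "logconcave_fun g \<longleftrightarrow> (\<forall>x. 0 \<le> g x) \<and> concave_on {x. 0 < g x} (\<lambda>x. ln (g x))"

definition lc_majorant :: "(real \<Rightarrow> real) \<Rightarrow> real \<Rightarrow> real" where
  "lc_majorant g = (LEAST h. logconcave_fun h \<and> g \<le> h)"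

lemma logconcave_fun_iff:
  "logconcave_fun g \<longleftrightarrow>
     (\<forall>x. 0 \<le> g x) \<and>
     (\<forall>x y t. 0 < t \<and> t < 1 \<longrightarrow> g x powr (1 - t) * g y powr t \<le> g ((1 - t) * x + t * y))"
proof (cases "\<forall>x. 0 \<le> g x")
  case False
  then show ?thesis by (auto simp: logconcave_fun_def)
next
  case True
  show ?thesis
  proof
    assume "logconcave_fun g"
    then have conc: "concave_on {x. 0 < g x} (\<lambda>x. ln (g x))" by (simp add: logconcave_fun_def)
    then have cvx: "convex {x. 0 < g x}" by (simp add: concave_on_def convex_on_def)
    have "g x powr (1 - t) * g y powr t \<le> g ((1 - t) * x + t * y)" if t: "0 < t" "t < 1" for x y t
    proof (cases "g x = 0 \<or> g y = 0")
      case True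
      then show ?thesis using \<open>\<forall>x. 0 \<le> g x\<close> by auto
    next
      case False
      then have pos: "0 < g x" "0 < g y" using True by (auto simp: less_le)
      let ?z = "(1 - t) * x + t * y"
      have z: "0 < g ?z"
        using convexD[OF cvx, of x y "1 - t" t] pos t by simp
      have "(1 - t) * ln (g x) + t * ln (g y) \<le> ln (g ?z)"
        using concave_onD[OF conc, of t x y] pos t by simp
      then have "exp ((1 - t) * ln (g x) + t * ln (g y)) \<le> g ?z"
        using z by (simp add: ln_ge_iff)
      then show ?thesis using pos by (simp add: powr_def exp_add)
    qed
    then show "(\<forall>x. 0 \<le> g x) \<and>
     (\<forall>x y t. 0 < t \<and> t < 1 \<longrightarrow> g x powr (1 - t) * g y powr t \<le> g ((1 - t) * x + t * y))"
      using True by blast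
  next
    assume *: "(\<forall>x. 0 \<le> g x) \<and>
     (\<forall>x y t. 0 < t \<and> t < 1 \<longrightarrow> g x powr (1 - t) * g y powr t \<le> g ((1 - t) * x + t * y))"
    have exp_le: "exp ((1 - t) * ln (g x) + t * ln (g y)) \<le> g ((1 - t) * x + t * y)"
      if "0 < g x" "0 < g y" "0 < t" "t < 1" for x y t
    proof -
      have "exp ((1 - t) * ln (g x) + t * ln (g y)) = g x powr (1 - t) * g y powr t"
        using that by (simp add: powr_def exp_add)
      then show ?thesis using * that by simp
    qed
    have z: "0 < g ((1 - t) * x + t * y)" if "0 < g x" "0 < g y" "0 < t" "t < 1" for x y t
      using exp_le[OF that] exp_gt_zero less_le_trans by blast
    have "convex {x. 0 < g x}"
      unfolding convex_alt
    proof safe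
      fix x y u :: real
      assume "0 < g x" "0 < g y" "0 \<le> u" "u \<le> 1"
      then show "0 < g ((1 - u) *\<^sub>R x + u *\<^sub>R y)"
        using z[of x y u] by (cases "u = 0 \<or> u = 1") auto
    qed
    then have "concave_on {x. 0 < g x} (\<lambda>x. ln (g x))"
      using exp_le z by (intro concave_on_linorderI) (auto simp: ln_ge_iff)
    then show "logconcave_fun g" using True by (simp add: logconcave_fun_def)
  qed
qed

text \<open>The least log-concave majorant exists as soon as there is any log-concave majorant.
  The tail functions \<open>x \<mapsto> P(T \<ge> x)\<close> have the constant \<open>1\<close> as one.\<close>

lemma lc_majorant:
  assumes ex: "logconcave_fun h\<^sub>0" "g \<le> h\<^sub>0"
  shows "logconcave_fun (lc_majorant g)" and "g \<le> lc_majorant g"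
    and "logconcave_fun h \<Longrightarrow> g \<le> h \<Longrightarrow> lc_majorant g \<le> h"
proof -
  define H where "H = {h. logconcave_fun h \<and> g \<le> h}"
  define m where "m = (\<lambda>x. INF h\<in>H. h x)"
  have ne: "H \<noteq> {}" using ex by (auto simp: H_def)
  have nonneg: "0 \<le> h x" if "h \<in> H" for h x using that by (auto simp: H_def logconcave_fun_def)
  have bdd: "bdd_below ((\<lambda>h. h x) ` H)" for x by (intro bdd_belowI2[of _ 0] nonneg)
  have m_le: "m x \<le> h x" if "h \<in> H" for h x
    unfolding m_def by (rule cINF_lower[OF bdd that])
  have m_nonneg: "0 \<le> m x" for x unfolding m_def by (rule cINF_greatest[OF ne nonneg])
  have m_ge: "g \<le> m"
    unfolding m_def le_fun_def by (intro allI cINF_greatest[OF ne]) (auto simp: H_def le_fun_def)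
  have "m x powr (1 - t) * m y powr t \<le> m ((1 - t) * x + t * y)" if t: "0 < t" "t < 1" for x y t
    unfolding m_def
  proof (rule cINF_greatest[OF ne])
    fix h assume h: "h \<in> H"
    have "(INF h\<in>H. h x) powr (1 - t) * (INF h\<in>H. h y) powr t \<le> h x powr (1 - t) * h y powr t"
      using t m_le[OF h] m_nonneg nonneg[OF h]
      by (intro mult_mono powr_mono2) (auto simp: m_def)
    also have "\<dots> \<le> h ((1 - t) * x + t * y)"
      using h t by (simp add: H_def logconcave_fun_iff)
    finally show "(INF h\<in>H. h x) powr (1 - t) * (INF h\<in>H. h y) powr t \<le> h ((1 - t) * x + t * y)" .
  qed
  then have m_lc: "logconcave_fun m" using m_nonneg by (simp add: logconcave_fun_iff)
  have "lc_majorant g = m"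
    unfolding lc_majorant_def
    by (rule Least_equality) (use m_lc m_ge m_le in \<open>auto simp: H_def le_fun_def\<close>)
  then show "logconcave_fun (lc_majorant g)" and "g \<le> lc_majorant g"
    and "logconcave_fun h \<Longrightarrow> g \<le> h \<Longrightarrow> lc_majorant g \<le> h"
    using m_lc m_ge m_le[of h] by (auto simp: H_def le_fun_def)
qed

end

theory Submission
  imports Defs
begin

text \<open>
  Weighting the law of \<open>(X, R)\<close>, \<open>R\<close> the reciprocal of \<open>X\<close>, by \<open>\<bar>X\<bar>\<close> makes it exchangeable: both halves of
  the weighted law are images of Lebesgue measure under the two quantile functions of the truncated
  means. Hence, conditionally on the unordered pairs \<open>{X\<^sub>i, R\<^sub>i}\<close>, the \<open>X\<^sub>i\<close> are independent zero-mean
  two-point variables, \<open>Y\<^sub>i\<close> is the conditional variance of \<open>X\<^sub>i\<close>, and the sum becomes \<open>\<Sum> a\<^sub>i Z\<^sub>i\<close> with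
  standardized two-point \<open>Z\<^sub>i\<close> and \<open>\<Sum> a\<^sub>i\<^bsup>2\<lambda>\<^esup> = 1\<close>. On the positive parts \<open>(x - t)\<^sub>+\<^sup>3\<close>, which together with
  polynomials of degree at most two generate the class, increasing the skewness of a
  \<open>Z\<^sub>i\<close> increases the mean by the Hermite--Hadamard inequality, and moving two of the \<open>a\<^sub>i\<^bsup>2\<lambda>\<^esup>\<close> towards each other
  increases it as well; the latter is where \<open>\<lambda> \<ge> \<lambda>\<^sub>*(p)\<close> enters, and it fails infinitesimally at equal
  weights for smaller \<open>\<lambda>\<close>. The tail bound follows by Markov's inequality for \<open>(x - t)\<^sub>+\<^sup>3\<close> and a tangent
  exponential to the log-concave majorant.
\<close>

subsection \<open>The inequality behind the exponent\<close>

text \<open>Origin of \<open>lambda_star\<close>: let two summands have coefficients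
  \<open>a >= b > 0\<close>, with \<open>a^(2l) + b^(2l)\<close> held fixed. For a truncated cube,
  and after scaling to \<open>b = 1\<close>, \<open>a = 1 + d\<close>, moving weight towards
  equality does not decrease the mean if \<open>d (2c + d) <= ((1 + d)^(2l - 1) - 1) (p (2c + 1 +
  2d) + (1 - p) c^2)\<close>, where \<open>c\<close> in [0,1] locates the truncation point. For
  \<open>p < 1/2\<close> put \<open>\<rho> = sqrt (p / (1 - p))\<close>. Given \<open>d\<close>, the
  most demanding \<open>c\<close> is the positive root of
  \<open>c^2 + d c = \<rho>^2 (1 + d)\<close>; the most demanding \<open>d\<close> is the limit 0,
  where \<open>c\<close> tends to \<open>\<rho>\<close>. This yields
  \<open>2l - 1 >= (1 + \<rho>^2) / (\<rho> + \<rho>^2)\<close>, which is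
  \<open>l >= lambda_star p\<close>. For \<open>p >= 1/2\<close> the binding constraint comes from
  truncation points far to the left, where the cubes act like quadratics, and it is
  \<open>2l - 1 >= 1\<close>.

  The uniform variables are there because the laws may have atoms. Spreading each jump uniformly
  makes the transformed variable exactly uniform, so both halves of the weighted law are
  parametrized by one interval of length \<open>E X^+ = E X^-\<close>.\<close>

lemma log_ratio_deriv_bound:
  fixes \<rho> x :: real
  assumes \<rho>: "0 < \<rho>" "\<rho> < 1" and x: "\<rho>\<^sup>2 < x" "x < 1"
  shows "(1 + \<rho>\<^sup>2) / (\<rho> + \<rho>\<^sup>2) * (1 / x - 1 / (1 - x) - 1 / (x - \<rho>\<^sup>2))
           + (2 * x / (1 - x\<^sup>2) + 2 * x / (x\<^sup>2 - \<rho>^4)) \<le> 0"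
proof -
  have x0: "0 < x" using x(1) zero_le_power2[of \<rho>] by linarith
  \<comment> \<open>\<open>A\<close> and \<open>B\<close> are both
    \<open>(x - \<rho>)^2 >= 0\<close> rearranged. Over the common denominator \<open>D\<close> the
    left side of the claim is \<open>1 + \<rho>^2\<close> times the difference of the two products
    in \<open>AB\<close>, so multiplying the two bounds decides its sign. Equality holds at
    \<open>x = \<rho>\<close>.\<close>
  have A: "2 * x * \<rho> * (1 - \<rho>) \<le> x\<^sup>2 - 2 * \<rho>\<^sup>2 * x + \<rho>\<^sup>2"
    using zero_le_power2[of "x - \<rho>"] by (simp add: power2_eq_square algebra_simps)
  have B: "x * (1 + \<rho>)\<^sup>2 \<le> (1 + x) * (x + \<rho>\<^sup>2)"
    using zero_le_power2[of "x - \<rho>"] by (simp add: power2_eq_square algebra_simps)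
  have AB: "(2 * x * \<rho> * (1 - \<rho>)) * (x * (1 + \<rho>)\<^sup>2)
      \<le> (x\<^sup>2 - 2 * \<rho>\<^sup>2 * x + \<rho>\<^sup>2) * ((1 + x) * (x + \<rho>\<^sup>2))"
    by (rule mult_mono[OF A B]) (use A x0 \<rho> in \<open>auto intro: order_trans[rotated]\<close>)
  define D where "D = x * (1 - x) * (1 + x) * (x - \<rho>\<^sup>2) * (x + \<rho>\<^sup>2) * (\<rho> + \<rho>\<^sup>2)"
  have xr: "x + \<rho>\<^sup>2 > 0" "\<rho> + \<rho>\<^sup>2 > 0" using x0 \<rho> by (auto simp: add_pos_pos)
  have D: "D > 0" unfolding D_def using x x0 \<rho> xr by (intro mult_pos_pos) auto
  have fac: "1 - x\<^sup>2 = (1 - x) * (1 + x)" "x\<^sup>2 - \<rho>^4 = (x - \<rho>\<^sup>2) * (x + \<rho>\<^sup>2)"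
    by (auto simp: power2_eq_square power4_eq_xxxx algebra_simps)
  have "(1 + \<rho>\<^sup>2) / (\<rho> + \<rho>\<^sup>2) * (1 / x - 1 / (1 - x) - 1 / (x - \<rho>\<^sup>2))
      = - ((1 + \<rho>\<^sup>2) * ((x\<^sup>2 - 2 * \<rho>\<^sup>2 * x + \<rho>\<^sup>2) * ((1 + x) * (x + \<rho>\<^sup>2)))) / D"
    unfolding D_def using x x0 xr by (simp add: divide_simps) (simp add: power2_eq_square algebra_simps)
  moreover have "2 * x / (1 - x\<^sup>2) + 2 * x / (x\<^sup>2 - \<rho>^4)
      = (1 + \<rho>\<^sup>2) * ((2 * x * \<rho> * (1 - \<rho>)) * (x * (1 + \<rho>)\<^sup>2)) / D"
    unfolding D_def fac using x x0 xr by (simp add: divide_simps) (simp add: power2_eq_square algebra_simps)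
  ultimately have "(1 + \<rho>\<^sup>2) / (\<rho> + \<rho>\<^sup>2) * (1 / x - 1 / (1 - x) - 1 / (x - \<rho>\<^sup>2))
           + (2 * x / (1 - x\<^sup>2) + 2 * x / (x\<^sup>2 - \<rho>^4)) = 
     (1 + \<rho>\<^sup>2) * ((2 * x * \<rho> * (1 - \<rho>)) * (x * (1 + \<rho>)\<^sup>2) - 
        (x\<^sup>2 - 2 * \<rho>\<^sup>2 * x + \<rho>\<^sup>2) * ((1 + x) * (x + \<rho>\<^sup>2))) / D"
    by (simp add: diff_divide_distrib right_diff_distrib)
  also have "\<dots> \<le> 0"
    using AB D \<rho> by (intro divide_nonpos_pos mult_nonneg_nonpos) auto
  finally show ?thesis .
qed

text \<open>At \<open>c = \<rho>\<close> the arguments of both logarithms equal 1. The difference of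
  the two sides, the function \<open>H\<close>, is nonincreasing up to \<open>\<rho>\<close> and
  vanishes there, hence is nonnegative before.\<close>

lemma log_ratio_ineq:
  fixes \<rho> c :: real
  assumes \<rho>: "0 < \<rho>" "\<rho> < 1" and c: "\<rho>\<^sup>2 < c" "c \<le> \<rho>"
  shows "ln (\<rho>\<^sup>2 * (1 - c\<^sup>2) / (c\<^sup>2 - \<rho>^4))
    \<le> (1 + \<rho>\<^sup>2) / (\<rho> + \<rho>\<^sup>2) * ln (c * (1 - c) / (c - \<rho>\<^sup>2))"
proof -
  define m where "m = (1 + \<rho>\<^sup>2) / (\<rho> + \<rho>\<^sup>2)"
  define H where "H = (\<lambda>x. m * (ln x + ln (1 - x) - ln (x - \<rho>\<^sup>2))
                  - (ln (\<rho>\<^sup>2) + ln (1 - x\<^sup>2) - ln (x\<^sup>2 - \<rho>^4)))"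
  have pos: "0 < x" "x < 1" "0 < 1 - x\<^sup>2" "0 < x\<^sup>2 - \<rho>^4" "0 < x - \<rho>\<^sup>2" if "c \<le> x" "x \<le> \<rho>" for x
  proof -
    show x: "0 < x" "x < 1" "0 < x - \<rho>\<^sup>2" using that c \<rho> zero_le_power2[of \<rho>] by linarith+
    show "0 < 1 - x\<^sup>2" using x by (simp add: power_less_one_iff)
    have "(\<rho>\<^sup>2)\<^sup>2 < x\<^sup>2" using x \<rho> by (intro power_strict_mono) auto
    then show "0 < x\<^sup>2 - \<rho>^4" by simp
  qed
  have "H \<rho> \<le> H c"
  proof (rule DERIV_nonpos_imp_nonincreasing[OF c(2)])
    fix x assume x: "c \<le> x" "x \<le> \<rho>"
    note P = pos[OF this]
    have "(H has_real_derivative (m * (1 / x - 1 / (1 - x) - 1 / (x - \<rho>\<^sup>2))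
           + (2 * x / (1 - x\<^sup>2) + 2 * x / (x\<^sup>2 - \<rho>^4)))) (at x)"
      unfolding H_def using P
      by (auto intro!: derivative_eq_intros simp: divide_simps) (simp add: algebra_simps)
    moreover have "m * (1 / x - 1 / (1 - x) - 1 / (x - \<rho>\<^sup>2))
           + (2 * x / (1 - x\<^sup>2) + 2 * x / (x\<^sup>2 - \<rho>^4)) \<le> 0"
      unfolding m_def using log_ratio_deriv_bound[OF \<rho>, of x] P by simp
    ultimately show "\<exists>y. DERIV H x :> y \<and> y \<le> 0" by blast
  qed
  moreover have "H \<rho> = 0"
  proof -
    have "\<rho>\<^sup>2 < 1" using \<rho> by (simp add: power_less_one_iff)
    have e: "ln (\<rho> - \<rho>\<^sup>2) = ln \<rho> + ln (1 - \<rho>)" "ln (\<rho>\<^sup>2 - \<rho>^4) = ln (\<rho>\<^sup>2) + ln (1 - \<rho>\<^sup>2)"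
      using \<rho> \<open>\<rho>\<^sup>2 < 1\<close> by (subst ln_mult_pos[symmetric]; simp add: power2_eq_square power4_eq_xxxx algebra_simps)+
    show ?thesis unfolding H_def e by simp
  qed
  moreover have "H c = m * ln (c * (1 - c) / (c - \<rho>\<^sup>2)) - ln (\<rho>\<^sup>2 * (1 - c\<^sup>2) / (c\<^sup>2 - \<rho>^4))"
    using pos[OF order_refl c(2)] \<rho> unfolding H_def by (simp add: ln_mult_pos ln_div)
  ultimately show ?thesis unfolding m_def by linarith
qed


text \<open>\<open>log_ratio_ineq\<close> exponentiated. The variable \<open>c\<close> serves as a
  rational parameter for \<open>d\<close>, which is 0 at \<open>c = \<rho>\<close> and grows without
  bound as \<open>c\<close> decreases to \<open>\<rho>^2\<close>; solving for \<open>c\<close>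
  instead would bring in a square root.\<close>

lemma powr_lower_bound:
  fixes \<rho> c d :: real
  assumes \<rho>: "0 < \<rho>" "\<rho> < 1" and c: "\<rho>\<^sup>2 < c" "c \<le> \<rho>" and d: "d = (\<rho>\<^sup>2 - c\<^sup>2) / (c - \<rho>\<^sup>2)"
  shows "1 + d * (1 + \<rho>\<^sup>2) / (\<rho>\<^sup>2 + c) \<le> (1 + d) powr ((1 + \<rho>\<^sup>2) / (\<rho> + \<rho>\<^sup>2))"
proof -
  have c0: "0 < c" "c < 1" using c \<rho> zero_le_power2[of \<rho>] by linarith+
  have sq: "c\<^sup>2 - \<rho>^4 = (c - \<rho>\<^sup>2) * (c + \<rho>\<^sup>2)" by (simp add: power2_eq_square power4_eq_xxxx algebra_simps)
  have pos: "0 < c - \<rho>\<^sup>2" "0 < c + \<rho>\<^sup>2" "0 < 1 - c\<^sup>2" using c c0 \<rho> by (auto simp: power_less_one_iff add_pos_pos)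
  have e1: "1 + d = c * (1 - c) / (c - \<rho>\<^sup>2)"
    unfolding d using pos by (simp add: field_simps power2_eq_square)
  have e2: "1 + d * (1 + \<rho>\<^sup>2) / (\<rho>\<^sup>2 + c) = \<rho>\<^sup>2 * (1 - c\<^sup>2) / (c\<^sup>2 - \<rho>^4)"
    unfolding d sq using pos by (simp add: divide_simps) (simp add: power2_eq_square algebra_simps)
  have p1: "0 < c * (1 - c) / (c - \<rho>\<^sup>2)" using c0 pos by simp
  have p2: "0 < \<rho>\<^sup>2 * (1 - c\<^sup>2) / (c\<^sup>2 - \<rho>^4)" unfolding sq using \<rho> pos by simp
  show ?thesis
    unfolding e1 e2 using log_ratio_ineq[OF \<rho> c] p1 p2 c c0
    by (simp add: powr_def ln_ge_iff flip: ln_le_cancel_iff)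
qed

text \<open>For fixed \<open>d\<close> the quotient of \<open>2c + d\<close> by
  \<open>p (2c + 1 + 2d) + q c^2\<close> is largest at the positive root \<open>c0\<close> of
  \<open>c^2 + d c = \<rho>^2 (1 + d)\<close>, with value \<open>1 / W\<close>. Every
  \<open>c\<close> is thereby reduced to this single one, for which \<open>powr_lower_bound\<close>
  applies because \<open>\<rho>^2 < c0 <= \<rho>\<close>.\<close>

lemma central_ineq_small:
  fixes \<rho> c d :: real
  defines "q \<equiv> 1 / (1 + \<rho>\<^sup>2)" and "p \<equiv> \<rho>\<^sup>2 / (1 + \<rho>\<^sup>2)"
  assumes \<rho>: "0 < \<rho>" "\<rho> < 1" and d: "0 \<le> d" and c: "0 \<le> c"
  shows "d * (2 * c + d) \<le> ((1 + d) powr ((1 + \<rho>\<^sup>2) / (\<rho> + \<rho>\<^sup>2)) - 1) * (p * (2 * c + 1 + 2 * d) + q * c\<^sup>2)"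
proof -
  define c0 where "c0 = (- d + sqrt (d\<^sup>2 + 4 * \<rho>\<^sup>2 * (1 + d))) / 2"
  define W where "W = p + q * c0"
  have r1: "0 < \<rho>\<^sup>2" "\<rho>\<^sup>2 < 1" using \<rho> by (auto simp: power_less_one_iff)
  have "(sqrt (d\<^sup>2 + 4 * \<rho>\<^sup>2 * (1 + d)))\<^sup>2 = d\<^sup>2 + 4 * \<rho>\<^sup>2 * (1 + d)"
    using d by (intro real_sqrt_pow2) auto
  moreover have c0_sqrt: "2 * c0 + d = sqrt (d\<^sup>2 + 4 * \<rho>\<^sup>2 * (1 + d))" unfolding c0_def by (simp add: field_simps)
  ultimately have "(2 * c0 + d)\<^sup>2 = d\<^sup>2 + 4 * \<rho>\<^sup>2 * (1 + d)" by simp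
  then have root: "c0\<^sup>2 + d * c0 = \<rho>\<^sup>2 * (1 + d)" by (simp add: power2_eq_square algebra_simps)
  have c00: "0 \<le> 2 * c0 + d" unfolding c0_sqrt using d by simp
  have lo: "\<rho>\<^sup>2 < c0"
  proof (rule ccontr)
    assume "\<not> \<rho>\<^sup>2 < c0"
    then have "(2 * c0 + d)\<^sup>2 \<le> (2 * \<rho>\<^sup>2 + d)\<^sup>2" using c00 by (intro power_mono) auto
    then have "c0\<^sup>2 + d * c0 \<le> \<rho>\<^sup>2 * \<rho>\<^sup>2 + d * \<rho>\<^sup>2" by (simp add: power2_eq_square algebra_simps)
    moreover have "\<rho>\<^sup>2 * \<rho>\<^sup>2 < \<rho>\<^sup>2 * 1" using r1 by (intro mult_strict_left_mono) auto
    ultimately show False using root by (simp add: algebra_simps)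
  qed
  have hi: "c0 \<le> \<rho>"
  proof (rule ccontr)
    assume "\<not> c0 \<le> \<rho>"
    then have "(2 * \<rho> + d)\<^sup>2 < (2 * c0 + d)\<^sup>2" using \<rho> d by (intro power_strict_mono) auto
    then have "\<rho>\<^sup>2 + d * \<rho> < c0\<^sup>2 + d * c0" by (simp add: power2_eq_square algebra_simps)
    moreover have "\<rho>\<^sup>2 * d \<le> \<rho> * d" using \<rho> d by (intro mult_right_mono) (auto simp: power2_eq_square)
    ultimately show False using root by (simp add: algebra_simps)
  qed
  have deq: "d = (\<rho>\<^sup>2 - c0\<^sup>2) / (c0 - \<rho>\<^sup>2)" using root lo by (simp add: field_simps)
  have c0p: "0 < c0" using lo r1 by linarith
  have q: "0 < q" "p = \<rho>\<^sup>2 * q" "p + q = 1" 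
  proof -
    have "1 + \<rho>\<^sup>2 > 0" using r1 by linarith
    then show "0 < q" "p = \<rho>\<^sup>2 * q" "p + q = 1" unfolding p_def q_def by (auto simp: field_simps)
  qed
  have W: "0 < W" unfolding W_def using q c0p r1 by (simp add: add_pos_pos)
  have dW: "d * (1 + \<rho>\<^sup>2) / (\<rho>\<^sup>2 + c0) = d / W"
  proof -
    have "W = (\<rho>\<^sup>2 + c0) / (1 + \<rho>\<^sup>2)" unfolding W_def p_def q_def by (simp add: add_divide_distrib)
    then show ?thesis by simp
  qed
  have main: "1 + d / W \<le> (1 + d) powr ((1 + \<rho>\<^sup>2) / (\<rho> + \<rho>\<^sup>2))"
    using powr_lower_bound[OF \<rho> lo hi deq] dW by simp
  \<comment> \<open>Completing the square at the critical point: the residual term is the defining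
    equation of \<open>c0\<close> and vanishes.\<close>
  have "p * (2 * c + 1 + 2 * d) + q * c\<^sup>2 - (2 * c + d) * W = q * (c - c0)\<^sup>2 + q * (\<rho>\<^sup>2 * (1 + d) - c0\<^sup>2 - d * c0)"
    unfolding W_def q(2) by (simp add: power2_eq_square algebra_simps)
  also have "\<dots> \<ge> 0" using root q by simp
  finally have R: "(2 * c + d) * W \<le> p * (2 * c + 1 + 2 * d) + q * c\<^sup>2" by simp
  have "d * (2 * c + d) = d / W * ((2 * c + d) * W)" using W by simp
  also have "\<dots> \<le> d / W * (p * (2 * c + 1 + 2 * d) + q * c\<^sup>2)"
    using R d W by (intro mult_left_mono) auto
  also have "\<dots> \<le> ((1 + d) powr ((1 + \<rho>\<^sup>2) / (\<rho> + \<rho>\<^sup>2)) - 1) * (p * (2 * c + 1 + 2 * d) + q * c\<^sup>2)"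
    using main q c d r1 by (intro mult_right_mono add_nonneg_nonneg mult_nonneg_nonneg) auto
  finally show ?thesis .
qed

text \<open>The substitution \<open>p = \<rho>^2 / (1 + \<rho>^2)\<close> makes
  \<open>sqrt (p - p^2)\<close> rational. After subtracting 1 from \<open>2 * lambda_star p\<close>,
  numerator and denominator share the factor \<open>1 - \<rho> + 2 \<rho>^2\<close>, and cancelling
  it leaves the exponent used in the inequalities above.\<close>

lemma lambda_star_small:
  fixes p :: real
  assumes p: "0 < p" "p < 1 / 2"
  defines "\<rho> \<equiv> sqrt (p / (1 - p))"
  shows "0 < \<rho>" "\<rho> < 1" "p = \<rho>\<^sup>2 / (1 + \<rho>\<^sup>2)" "1 - p = 1 / (1 + \<rho>\<^sup>2)"
    "2 * lambda_star p - 1 = (1 + \<rho>\<^sup>2) / (\<rho> + \<rho>\<^sup>2)"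
proof -
  have r2: "\<rho>\<^sup>2 = p / (1 - p)" unfolding \<rho>_def using p by simp
  show \<rho>: "0 < \<rho>" "\<rho> < 1" unfolding \<rho>_def using p by auto
  have k0: "1 + \<rho>\<^sup>2 > 0" by (simp add: add_pos_nonneg)
  show e: "p = \<rho>\<^sup>2 / (1 + \<rho>\<^sup>2)" "1 - p = 1 / (1 + \<rho>\<^sup>2)"
    unfolding r2 using p by (auto simp: field_simps)
  have "p - p\<^sup>2 = (\<rho> / (1 + \<rho>\<^sup>2))\<^sup>2"
  proof -
    have "p - p\<^sup>2 = p * (1 - p)" by (simp add: power2_eq_square algebra_simps)
    also have "\<dots> = (\<rho>\<^sup>2 / (1 + \<rho>\<^sup>2)) * (1 / (1 + \<rho>\<^sup>2))" by (metis e)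
    finally show ?thesis by (simp add: power2_eq_square)
  qed
  then have sg: "sqrt (p - p\<^sup>2) = \<rho> / (1 + \<rho>\<^sup>2)" using \<rho> k0 by simp
  have nz: "\<rho> * (1 + \<rho>\<^sup>2) + 2 * \<rho>^4 > 0" "\<rho> + \<rho>\<^sup>2 > 0" using \<rho> k0 by (auto intro!: add_pos_pos mult_pos_pos)
  have a: "sqrt (p - p\<^sup>2) + 2 * p\<^sup>2 = (\<rho> * (1 + \<rho>\<^sup>2) + 2 * \<rho>^4) / (1 + \<rho>\<^sup>2)\<^sup>2"
  proof -
    have "\<rho> / k + 2 * (\<rho>\<^sup>2 / k)\<^sup>2 = (\<rho> * k + 2 * \<rho>^4) / k\<^sup>2" if "k > 0" for k
      using that by (simp add: field_simps power2_eq_square power4_eq_xxxx)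
    then show ?thesis unfolding sg using k0 e(1) by metis
  qed
  have b: "1 + p + 2 * p\<^sup>2 = ((1 + \<rho>\<^sup>2) * (1 + 2 * \<rho>\<^sup>2) + 2 * \<rho>^4) / (1 + \<rho>\<^sup>2)\<^sup>2"
  proof -
    have "1 + \<rho>\<^sup>2 / k + 2 * (\<rho>\<^sup>2 / k)\<^sup>2 = (k * (k + \<rho>\<^sup>2) + 2 * \<rho>^4) / k\<^sup>2" if "k > 0" for k
      using that by (simp add: field_simps power2_eq_square power4_eq_xxxx)
    from this[OF k0] show ?thesis unfolding e(1)[symmetric] by simp
  qed
  have L: "2 * lambda_star p = ((1 + \<rho>\<^sup>2) * (1 + 2 * \<rho>\<^sup>2) + 2 * \<rho>^4) / (\<rho> * (1 + \<rho>\<^sup>2) + 2 * \<rho>^4)"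
  proof -
    have "lambda_star p = (1 + p + 2 * p\<^sup>2) / (2 * (sqrt (p - p\<^sup>2) + 2 * p\<^sup>2))"
      using p by (simp add: lambda_star_def)
    moreover have "2 * ((X / K) / (2 * (Y / K))) = X / Y" if "K \<noteq> 0" for X Y K :: real
      using that by simp
    ultimately show ?thesis unfolding a b using k0 by (metis less_irrefl zero_less_power2)
  qed
  have "X / D - 1 = Y / E" if "D > 0" "E > 0" "(X - D) * E = Y * D" for X D Y E :: real
    using that by (simp add: field_simps)
  note frac = this
  show "2 * lambda_star p - 1 = (1 + \<rho>\<^sup>2) / (\<rho> + \<rho>\<^sup>2)"
    unfolding L by (rule frac[OF nz]) (auto simp: power2_eq_square power4_eq_xxxx algebra_simps)
qed

lemma lambda_star_ge_1: "0 < p \<Longrightarrow> p < 1 \<Longrightarrow> 1 \<le> lambda_star p"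
proof -
  assume p: "0 < p" "p < 1"
  show ?thesis
  proof (cases "p < 1 / 2")
    case True
    note L = lambda_star_small[OF p(1) True]
    have "1 \<le> (1 + (sqrt (p / (1 - p)))\<^sup>2) / (sqrt (p / (1 - p)) + (sqrt (p / (1 - p)))\<^sup>2)"
      using L(1,2) by (simp add: field_simps add_pos_pos)
    then show ?thesis using L(5) by linarith
  next
    case False
    show ?thesis
    proof (cases "p = 1 / 2")
      \<comment> \<open>At \<open>p = 1/2\<close> the first branch of \<open>lambda_star\<close>
        applies; its value is 1 too, so the two branches agree there.\<close>
      case True
      have "sqrt (1/2 - (1/2)\<^sup>2) = (1/2::real)" by (rule real_sqrt_unique) (auto simp: power2_eq_square)
      then show ?thesis unfolding lambda_star_def True by (simp add: power2_eq_square)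
    qed (use False in \<open>auto simp: lambda_star_def\<close>)
  qed
qed

text \<open>For \<open>p < 1/2\<close> the exponent may be lowered to its threshold value. For
  \<open>p >= 1/2\<close> the exponent is at least 1, so the first factor on the right is at least
  \<open>d\<close>, and what remains is \<open>2c + d <= p (2c + 1 + 2d) + (1 - p) c^2\<close>; this
  is where \<open>c <= 1\<close> enters.\<close>

lemma central_ineq:
  fixes p c d l :: real
  assumes p: "0 < p" "p < 1" and l: "lambda_star p \<le> l" and d: "0 \<le> d" and c: "0 \<le> c" "c \<le> 1"
  shows "d * (2 * c + d) \<le> ((1 + d) powr (2 * l - 1) - 1) * (p * (2 * c + 1 + 2 * d) + (1 - p) * c\<^sup>2)"
proof -
  have R: "0 \<le> p * (2 * c + 1 + 2 * d) + (1 - p) * c\<^sup>2" using p d c by simp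
  show ?thesis
  proof (cases "p < 1 / 2")
    case True
    note L = lambda_star_small[OF p(1) True]
    define \<rho> where "\<rho> = sqrt (p / (1 - p))"
    note L = L[folded \<rho>_def]
    have "d * (2 * c + d) \<le> ((1 + d) powr ((1 + \<rho>\<^sup>2) / (\<rho> + \<rho>\<^sup>2)) - 1) * (p * (2 * c + 1 + 2 * d) + (1 - p) * c\<^sup>2)"
      using central_ineq_small[OF L(1,2) d c(1)] L(3,4) by simp
    also have "\<dots> \<le> ((1 + d) powr (2 * l - 1) - 1) * (p * (2 * c + 1 + 2 * d) + (1 - p) * c\<^sup>2)"
      using R L(5) l d by (intro mult_right_mono diff_right_mono powr_mono) auto
    finally show ?thesis .
  next
    case False
    have "(1 + d) powr 1 \<le> (1 + d) powr (2 * l - 1)"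
      using lambda_star_ge_1[OF p] l d by (intro powr_mono) auto
    then have dd: "d \<le> (1 + d) powr (2 * l - 1) - 1" using d by simp
    have "(1 - c)\<^sup>2 \<le> d + 1" using power_le_one[of "1 - c" 2] c d by linarith
    then have "0 \<le> (2 * p - 1) * (d + 1 - (1 - c)\<^sup>2) + p * (1 - c)\<^sup>2 "
      using False d c p by (intro add_nonneg_nonneg mult_nonneg_nonneg) auto
    moreover have "(2 * p - 1) * (d + 1 - (1 - c)\<^sup>2) + p * (1 - c)\<^sup>2 =
       p * (2 * c + 1 + 2 * d) + (1 - p) * c\<^sup>2 - (2 * c + d)"
      by (simp add: power2_eq_square algebra_simps)
    ultimately have "d * (2 * c + d) \<le> d * (p * (2 * c + 1 + 2 * d) + (1 - p) * c\<^sup>2)"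
      using d by (intro mult_left_mono) auto
    also have "\<dots> \<le> ((1 + d) powr (2 * l - 1) - 1) * (p * (2 * c + 1 + 2 * d) + (1 - p) * c\<^sup>2)"
      by (rule mult_right_mono[OF dd R])
    finally show ?thesis .
  qed
qed


text \<open>If \<open>E\<close> denotes the bracket multiplied by \<open>B\<close>, the left side is
  \<open>E + P (1 + d) - P 1\<close>, so the claim is \<open>P (1 + d) - P 1 <= (B - 1) * E\<close>.
  The cases are the positions of the truncation point \<open>T\<close> among 0, 1,
  \<open>1 + d\<close> and \<open>2 + d\<close>. For \<open>T\<close> in [0,1] the claim is
  \<open>central_ineq\<close> with \<open>c = 1 - T\<close>.\<close>

lemma key_ineq_normalized:
  fixes p d l T :: real
  assumes p: "0 < p" "p < 1" and l: "lambda_star p \<le> l" and d: "0 \<le> d"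
  defines "P \<equiv> \<lambda>z. (max 0 (z - T))\<^sup>2" and "B \<equiv> (1 + d) powr (2 * l - 1)"
  shows "p * P (2 + d) + (1 - p) * P (1 + d) - p * P 1 - (1 - p) * P 0
     \<le> B * (p * P (2 + d) + (1 - p) * P 1 - p * P (1 + d) - (1 - p) * P 0)"
proof -
  have "(1 + d) powr 1 \<le> B"
    unfolding B_def using lambda_star_ge_1[OF p] l d by (intro powr_mono) auto
  then have B: "1 + d \<le> B" using d by simp
  note F = central_ineq[OF p l]
  consider "2 + d \<le> T" | "1 + d \<le> T" "T \<le> 2 + d" | "1 \<le> T" "T \<le> 1 + d" | "0 \<le> T" "T \<le> 1" | "T < 0"
    by linarith
  then show ?thesis
  proof cases
    case 1
    then show ?thesis using d unfolding P_def by (simp add: max_def)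
  next
    case 2
    then have [simp]: "P 0 = 0" "P 1 = 0" "P (1 + d) = 0" using d unfolding P_def by (auto simp: max_def)
    have "p * P (2 + d) * 1 \<le> p * P (2 + d) * B" using B d p unfolding P_def by (intro mult_left_mono) auto
    then show ?thesis by (simp add: algebra_simps)
  next
    case 3
    define y where "y = 1 + d - T"
    have y: "0 \<le> y" "y \<le> d" unfolding y_def using 3 by auto
    have e: "P 0 = 0" "P 1 = 0" "P (1 + d) = y\<^sup>2" "P (2 + d) = (1 + y)\<^sup>2"
      using d 3 unfolding P_def y_def by (auto simp: max_def algebra_simps)
    \<comment> \<open>Only the part \<open>y\<close> of the gap lies above the truncation point:
      \<open>central_ineq\<close> is used with \<open>c = 0\<close> and \<open>y\<close> in place of
      \<open>d\<close>, and the resulting power of \<open>1 + y\<close> is at most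
      \<open>B\<close>.\<close>
    have "y * (2 * 0 + y) \<le> ((1 + y) powr (2 * l - 1) - 1) * (p * (2 * 0 + 1 + 2 * y) + (1 - p) * 0\<^sup>2)"
      by (rule central_ineq[OF p l y(1)]) auto
    also have "\<dots> \<le> (B - 1) * (p * (2 * 0 + 1 + 2 * y) + (1 - p) * 0\<^sup>2)"
      unfolding B_def using y p d lambda_star_ge_1[OF p] l
      by (intro mult_right_mono diff_right_mono powr_mono2) auto
    finally show ?thesis unfolding e by (simp add: power2_eq_square algebra_simps)
  next
    case 4
    define c where "c = 1 - T"
    have c: "0 \<le> c" "c \<le> 1" using 4 unfolding c_def by auto
    have e: "P 0 = 0" "P 1 = c\<^sup>2" "P (1 + d) = (c + d)\<^sup>2" "P (2 + d) = (1 + c + d)\<^sup>2"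
      using d 4 unfolding P_def c_def by (auto simp: max_def algebra_simps)
    show ?thesis unfolding e using F[OF d c, folded B_def] by (simp add: power2_eq_square algebra_simps)
  next
    case 5
    define c where "c = 1 - T"
    have c: "1 \<le> c" using 5 unfolding c_def by auto
    have e: "P 0 = (c - 1)\<^sup>2" "P 1 = c\<^sup>2" "P (1 + d) = (c + d)\<^sup>2" "P (2 + d) = (1 + c + d)\<^sup>2"
      using d 5 unfolding P_def c_def by (auto simp: max_def algebra_simps)
    \<comment> \<open>With no truncation left, both sides of
      \<open>P (1 + d) - P 1 <= (B - 1) * E\<close> are affine in \<open>c\<close>, with slopes
      \<open>2d\<close> and \<open>2 (B - 1)\<close>. The case \<open>c = 1\<close> together with
      \<open>1 + d <= B\<close> therefore covers all larger \<open>c\<close>.\<close>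
    have "d * (c - 1) \<le> (B - 1) * (c - 1)" using B c by (intro mult_right_mono) auto
    then show ?thesis unfolding e using F[OF d, of 1, folded B_def] by (simp add: power2_eq_square algebra_simps)
  qed
qed

text \<open>Both sides are homogeneous, so translating by \<open>y\<close> and scaling by
  \<open>b\<close> leads to \<open>key_ineq_normalized\<close>; \<open>T\<close> is the truncation
  point in the new coordinate. Up to the factor 3, \<open>g\<close> is the derivative of a truncated
  cube.\<close>

lemma key_ineq_truncated_square:
  fixes p a b l t y :: real
  assumes p: "0 < p" "p < 1" and l: "lambda_star p \<le> l" and ab: "0 < b" "b \<le> a"
  defines "g \<equiv> \<lambda>z. (max 0 (z - t))\<^sup>2"
  shows "p * g (y + a + b) + (1 - p) * g (y + a) - p * g (y + b) - (1 - p) * g y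
     \<le> (a / b) powr (2 * l - 1) * (p * g (y + a + b) + (1 - p) * g (y + b) - p * g (y + a) - (1 - p) * g y)"
proof -
  define T d where "T = (t - y) / b" and "d = a / b - 1"
  define P where "P = (\<lambda>z. (max 0 (z - T))\<^sup>2)"
  have d: "0 \<le> d" "1 + d = a / b" unfolding d_def using ab by (auto simp: field_simps)
  have scale: "g (y + b * z) = b\<^sup>2 * P z" for z
  proof -
    have "y + b * z - t = b * (z - T)" unfolding T_def using ab by (simp add: field_simps)
    then have "max 0 (y + b * z - t) = b * max 0 (z - T)" using ab by (auto simp: max_def mult_le_0_iff zero_le_mult_iff)
    then show ?thesis unfolding g_def P_def by (simp add: power_mult_distrib)
  qed
  have "y + a + b = y + b * (2 + d)" "y + a = y + b * (1 + d)" unfolding d_def using ab by (auto simp: field_simps)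
  then have "g (y + a + b) = g (y + b * (2 + d))" "g (y + a) = g (y + b * (1 + d))" by (simp_all only:)
  with scale[of 1] scale[of 0] scale[of "1 + d"] scale[of "2 + d"]
  have e: "g (y + a + b) = b\<^sup>2 * P (2 + d)" "g (y + a) = b\<^sup>2 * P (1 + d)" "g (y + b) = b\<^sup>2 * P 1" "g y = b\<^sup>2 * P 0"
    by simp_all
  have "b\<^sup>2 * (p * P (2 + d) + (1 - p) * P (1 + d) - p * P 1 - (1 - p) * P 0)
     \<le> b\<^sup>2 * ((a / b) powr (2 * l - 1) * (p * P (2 + d) + (1 - p) * P 1 - p * P (1 + d) - (1 - p) * P 0))"
    using key_ineq_normalized[OF p l d(1), of T] unfolding P_def d by (intro mult_left_mono) auto
  then show ?thesis unfolding e by (simp add: algebra_simps)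
qed

text \<open>For linear \<open>g\<close> the two brackets reduce to \<open>a\<close> and
  \<open>b\<close>, so the exponent \<open>2l - 1 >= 1\<close> is all that matters. This case serves
  quadratic test functions, whose derivatives are linear.\<close>

lemma key_ineq_linear:
  fixes p a b l y t :: real
  assumes p: "0 < p" "p < 1" and l: "lambda_star p \<le> l" and ab: "0 < b" "b \<le> a"
  defines "g \<equiv> \<lambda>z. z - t"
  shows "p * g (y + a + b) + (1 - p) * g (y + a) - p * g (y + b) - (1 - p) * g y
     \<le> (a / b) powr (2 * l - 1) * (p * g (y + a + b) + (1 - p) * g (y + b) - p * g (y + a) - (1 - p) * g y)"
proof -
  have "(a / b) powr 1 \<le> (a / b) powr (2 * l - 1)"
    using lambda_star_ge_1[OF p] l ab by (intro powr_mono) auto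
  then have "a \<le> (a / b) powr (2 * l - 1) * b" using ab by (simp add: field_simps)
  then show ?thesis unfolding g_def by (simp add: algebra_simps)
qed

subsection \<open>Independent two-point variables\<close>

text \<open>The mean of \<open>\<phi>\<close> at a sum of independent variables, the
  \<open>i\<close>-th equal to \<open>x i\<close> with probability \<open>\<alpha> i\<close> and to
  \<open>y i\<close> otherwise; \<open>A\<close> is the set of indices where \<open>x i\<close> is
  taken. As a finite sum it needs no probability space, so the whole comparison can be made
  pointwise in the unordered pairs.\<close>

definition two_point_expectation ::
  "'i set \<Rightarrow> ('i \<Rightarrow> real) \<Rightarrow> ('i \<Rightarrow> real) \<Rightarrow> ('i \<Rightarrow> real) \<Rightarrow> (real \<Rightarrow> real) \<Rightarrow> real" where
  "two_point_expectation I \<alpha> x y \<phi> =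
     (\<Sum>A\<in>Pow I. (\<Prod>i\<in>I. if i \<in> A then \<alpha> i else 1 - \<alpha> i) * \<phi> (\<Sum>i\<in>I. if i \<in> A then x i else y i))"

lemma two_point_expectation_empty [simp]: "two_point_expectation {} \<alpha> x y \<phi> = \<phi> 0"
  by (simp add: two_point_expectation_def)

lemma two_point_expectation_insert:
  assumes I: "finite I" "j \<notin> I"
  shows "two_point_expectation (insert j I) \<alpha> x y \<phi> =
      \<alpha> j * two_point_expectation I \<alpha> x y (\<lambda>s. \<phi> (x j + s))
    + (1 - \<alpha> j) * two_point_expectation I \<alpha> x y (\<lambda>s. \<phi> (y j + s))"
proof -
  let ?w = "\<lambda>I A. \<Prod>i\<in>I. if i \<in> A then \<alpha> i else 1 - \<alpha> i"
  let ?s = "\<lambda>I A. \<Sum>i\<in>I. if i \<in> A then x i else y i"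
  have disj: "Pow I \<inter> insert j ` Pow I = {}" using I by auto
  have inj: "inj_on (insert j) (Pow I)" 
  proof (rule inj_onI)
    fix A B assume *: "A \<in> Pow I" "B \<in> Pow I" "insert j A = insert j B"
    then have "A = insert j A - {j}" "B = insert j B - {j}" using I by auto
    then show "A = B" using * by metis
  qed
  have a: "?w (insert j I) A = (1 - \<alpha> j) * ?w I A" "?s (insert j I) A = y j + ?s I A" if "A \<in> Pow I" for A
    using that I by auto
  have b: "?w (insert j I) (insert j A) = \<alpha> j * ?w I A" "?s (insert j I) (insert j A) = x j + ?s I A"
    if "A \<in> Pow I" for A
  proof -
    have "?w I (insert j A) = ?w I A" "?s I (insert j A) = ?s I A"
      using I by (auto intro!: prod.cong sum.cong)
    then show "?w (insert j I) (insert j A) = \<alpha> j * ?w I A" "?s (insert j I) (insert j A) = x j + ?s I A"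
      using I by auto
  qed
  have "two_point_expectation (insert j I) \<alpha> x y \<phi> =
     (\<Sum>A\<in>Pow I. ?w (insert j I) A * \<phi> (?s (insert j I) A))
   + (\<Sum>A\<in>Pow I. ?w (insert j I) (insert j A) * \<phi> (?s (insert j I) (insert j A)))"
    unfolding two_point_expectation_def Pow_insert
    using I disj inj by (simp add: sum.union_disjoint sum.reindex)
  also have "\<dots> = (\<Sum>A\<in>Pow I. (1 - \<alpha> j) * (?w I A * \<phi> (y j + ?s I A)))
      + (\<Sum>A\<in>Pow I. \<alpha> j * (?w I A * \<phi> (x j + ?s I A)))"
    by (intro arg_cong2[where f = "(+)"] sum.cong refl) (simp_all only: a b mult.assoc)
  finally show ?thesis unfolding two_point_expectation_def by (simp add: sum_distrib_left)
qed

lemma two_point_expectation_mono: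
  assumes "\<And>i. i \<in> I \<Longrightarrow> 0 \<le> \<alpha> i" "\<And>i. i \<in> I \<Longrightarrow> \<alpha> i \<le> 1" "\<And>s. \<phi> s \<le> \<psi> s"
  shows "two_point_expectation I \<alpha> x y \<phi> \<le> two_point_expectation I \<alpha> x y \<psi>"
  unfolding two_point_expectation_def
  by (intro sum_mono mult_left_mono prod_nonneg assms) (auto simp: assms)

lemma two_point_expectation_nonneg:
  assumes "\<And>i. i \<in> I \<Longrightarrow> 0 \<le> \<alpha> i" "\<And>i. i \<in> I \<Longrightarrow> \<alpha> i \<le> 1" "\<And>s. 0 \<le> f s"
  shows "0 \<le> two_point_expectation I \<alpha> x y f"
  unfolding two_point_expectation_def by (intro sum_nonneg mult_nonneg_nonneg prod_nonneg) (auto simp: assms)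

lemma two_point_expectation_add:
  "two_point_expectation I \<alpha> x y (\<lambda>s. \<phi> s + \<psi> s) = two_point_expectation I \<alpha> x y \<phi> + two_point_expectation I \<alpha> x y \<psi>"
  unfolding two_point_expectation_def by (simp add: algebra_simps sum.distrib)

lemma two_point_expectation_cmult:
  "two_point_expectation I \<alpha> x y (\<lambda>s. c * \<phi> s) = c * two_point_expectation I \<alpha> x y \<phi>"
  unfolding two_point_expectation_def by (simp add: sum_distrib_left mult_ac)

lemma two_point_expectation_cong:
  assumes "\<And>i. i \<in> I \<Longrightarrow> \<alpha> i = \<alpha>' i" "\<And>i. i \<in> I \<Longrightarrow> x i = x' i" "\<And>i. i \<in> I \<Longrightarrow> y i = y' i"
  shows "two_point_expectation I \<alpha> x y \<phi> = two_point_expectation I \<alpha>' x' y' \<phi>"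
proof -
  have "(\<Prod>i\<in>I. if i \<in> A then \<alpha> i else 1 - \<alpha> i) = (\<Prod>i\<in>I. if i \<in> A then \<alpha>' i else 1 - \<alpha>' i)"
    "(\<Sum>i\<in>I. if i \<in> A then x i else y i) = (\<Sum>i\<in>I. if i \<in> A then x' i else y' i)" for A
    by (auto intro!: prod.cong sum.cong simp: assms)
  then show ?thesis unfolding two_point_expectation_def by simp
qed

lemma two_point_expectation_const:
  assumes "finite I" shows "two_point_expectation I \<alpha> x y (\<lambda>_. c) = c"
  using assms by (induction I) (auto simp: two_point_expectation_insert algebra_simps)

lemma two_point_expectation_linear:
  assumes "finite I" and "\<And>i. i \<in> I \<Longrightarrow> \<alpha> i * x i + (1 - \<alpha> i) * y i = 0"
  shows "two_point_expectation I \<alpha> x y (\<lambda>s. b + s) = b"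
  using assms
proof (induction I arbitrary: b)
  case (insert j I)
  have "two_point_expectation (insert j I) \<alpha> x y (\<lambda>s. b + s) = \<alpha> j * (b + x j) + (1 - \<alpha> j) * (b + y j)"
    using insert by (simp add: two_point_expectation_insert add.assoc[symmetric])
  also have "\<dots> = b + (\<alpha> j * x j + (1 - \<alpha> j) * y j)" by (simp add: algebra_simps)
  finally show ?case using insert by simp
qed auto

lemma two_point_expectation_pair:
  assumes "j \<noteq> k"
  shows "two_point_expectation {j, k} \<alpha> x y \<phi> =
      \<alpha> j * (\<alpha> k * \<phi> (x j + x k) + (1 - \<alpha> k) * \<phi> (x j + y k))
    + (1 - \<alpha> j) * (\<alpha> k * \<phi> (y j + x k) + (1 - \<alpha> k) * \<phi> (y j + y k))"
  using assms by (simp add: two_point_expectation_insert)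

text \<open>Replacement of one independent summand at a time. The hypothesis compares single
  summands under every shift \<open>s\<close>, that is, with all the others frozen. The induction
  generalizes \<open>\<phi>\<close>, since fixing one summand turns \<open>\<phi>\<close> into a
  translate of itself.\<close>

lemma two_point_expectation_replace_all:
  assumes "finite I" and "\<And>i. i \<in> I \<Longrightarrow> 0 \<le> \<alpha> i" "\<And>i. i \<in> I \<Longrightarrow> \<alpha> i \<le> 1"
    and "\<And>i. i \<in> I \<Longrightarrow> 0 \<le> \<alpha>' i" "\<And>i. i \<in> I \<Longrightarrow> \<alpha>' i \<le> 1"
    and "\<And>i s. i \<in> I \<Longrightarrow> \<alpha> i * \<phi> (x i + s) + (1 - \<alpha> i) * \<phi> (y i + s)
                   \<le> \<alpha>' i * \<phi> (x' i + s) + (1 - \<alpha>' i) * \<phi> (y' i + s)"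
  shows "two_point_expectation I \<alpha> x y \<phi> \<le> two_point_expectation I \<alpha>' x' y' \<phi>"
  using assms
proof (induction I arbitrary: \<phi> rule: finite_induct)
  case (insert j I)
  let ?\<psi> = "\<lambda>s. \<alpha>' j * \<phi> (x' j + s) + (1 - \<alpha>' j) * \<phi> (y' j + s)"
  have IH: "two_point_expectation I \<alpha> x y (\<lambda>s. \<phi> (b + s)) \<le> two_point_expectation I \<alpha>' x' y' (\<lambda>s. \<phi> (b + s))" for b
  proof (rule insert.IH)
    fix i s assume "i \<in> I"
    then show "\<alpha> i * \<phi> (b + (x i + s)) + (1 - \<alpha> i) * \<phi> (b + (y i + s))
        \<le> \<alpha>' i * \<phi> (b + (x' i + s)) + (1 - \<alpha>' i) * \<phi> (b + (y' i + s))"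
      using insert.prems(5)[of i "b + s"] by (simp add: algebra_simps)
  qed (use insert.prems in auto)
  have "two_point_expectation (insert j I) \<alpha> x y \<phi> \<le>
      \<alpha> j * two_point_expectation I \<alpha>' x' y' (\<lambda>s. \<phi> (x j + s))
    + (1 - \<alpha> j) * two_point_expectation I \<alpha>' x' y' (\<lambda>s. \<phi> (y j + s))"
    unfolding two_point_expectation_insert[OF insert(1,2)]
    using insert.prems(1,2)[of j] IH by (intro add_mono mult_left_mono) auto
  also have "\<dots> = two_point_expectation I \<alpha>' x' y' (\<lambda>s. \<alpha> j * \<phi> (x j + s) + (1 - \<alpha> j) * \<phi> (y j + s))"
    by (simp add: two_point_expectation_add two_point_expectation_cmult)
  also have "\<dots> \<le> two_point_expectation I \<alpha>' x' y' ?\<psi>"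
    by (rule two_point_expectation_mono) (use insert.prems in auto)
  also have "\<dots> = two_point_expectation (insert j I) \<alpha>' x' y' \<phi>"
    unfolding two_point_expectation_insert[OF insert(1,2)]
    by (simp add: two_point_expectation_add two_point_expectation_cmult)
  finally show ?case .
qed simp

text \<open>Conditioning on the summands outside \<open>{j, k}\<close>: their sum is the shift
  \<open>s\<close> of the hypothesis. Two summands have to be changed together because they exchange
  weight.\<close>

lemma two_point_expectation_replace2:
  assumes I: "finite I" "j \<in> I" "k \<in> I" "j \<noteq> k" and \<alpha>: "\<And>i. i \<in> I \<Longrightarrow> 0 \<le> \<alpha> i" "\<And>i. i \<in> I \<Longrightarrow> \<alpha> i \<le> 1"
    and eq: "\<And>i. i \<in> I \<Longrightarrow> i \<noteq> j \<Longrightarrow> i \<noteq> k \<Longrightarrow> x i = x' i \<and> y i = y' i"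
    and le: "\<And>s. two_point_expectation {j, k} \<alpha> x y (\<lambda>z. \<phi> (z + s)) \<le> two_point_expectation {j, k} \<alpha> x' y' (\<lambda>z. \<phi> (z + s))"
  shows "two_point_expectation I \<alpha> x y \<phi> \<le> two_point_expectation I \<alpha> x' y' \<phi>"
proof -
  define J where "J = I - {j, k}"
  have J: "finite J" "j \<notin> J" "k \<notin> J" "I = insert j (insert k J)" unfolding J_def using I by auto
  have E: "two_point_expectation I \<alpha> x y \<phi> =
     two_point_expectation J \<alpha> x y (\<lambda>s. two_point_expectation {j, k} \<alpha> x y (\<lambda>z. \<phi> (z + s)))" for x y
    unfolding J(4) using J I(4)
    by (simp add: two_point_expectation_pair two_point_expectation_insert two_point_expectation_add
        two_point_expectation_cmult add.assoc)
  have "two_point_expectation I \<alpha> x y \<phi> \<le>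
     two_point_expectation J \<alpha> x y (\<lambda>s. two_point_expectation {j, k} \<alpha> x' y' (\<lambda>z. \<phi> (z + s)))"
    unfolding E by (rule two_point_expectation_mono) (use \<alpha> le J in auto)
  also have "\<dots> = two_point_expectation J \<alpha> x' y' (\<lambda>s. two_point_expectation {j, k} \<alpha> x' y' (\<lambda>z. \<phi> (z + s)))"
    by (rule two_point_expectation_cong) (use eq J in auto)
  finally show ?thesis unfolding E[symmetric] .
qed

subsection \<open>Averaging the weights\<close>

locale bernoulli_pair =
  fixes p l :: real and f g :: "real \<Rightarrow> real"
  assumes p: "0 < p" "p < 1" and l: "1 / 2 < l"
    and deriv: "\<And>x. (f has_real_derivative g x) (at x)"
begin

text \<open>\<open>V\<close> and \<open>- 1 / V\<close> are the two values of the standardized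
  Bernoulli variable, with probabilities \<open>p\<close> and \<open>1 - p\<close>. The exponent
  \<open>\<kappa>\<close> turns a weight \<open>u = a^(2l)\<close> back into the coefficient
  \<open>a\<close>; the normalization is linear in the weights.\<close>

definition "V = sqrt ((1 - p) / p)"
definition "\<kappa> = 1 / (2 * l)"

lemma V_pos: "0 < V" using p by (simp add: V_def)

lemma V_sq: "V\<^sup>2 = (1 - p) / p" using p by (simp add: V_def)

lemma p_V: "p = 1 / (1 + V\<^sup>2)" unfolding V_sq using p by (simp add: field_simps)

lemma pV: "p * V = (1 - p) / V"
proof -
  have "V * V = (1 - p) / p" using V_sq by (simp add: power2_eq_square)
  then show ?thesis using p V_pos by (simp add: field_simps)
qed

lemma kappa: "0 < \<kappa>" "\<kappa> < 1" using l by (auto simp: \<kappa>_def)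

text \<open>The mean of \<open>f (a Z1 + b Z2 + s)\<close> for independent standardized Bernoulli
  \<open>Z1\<close> and \<open>Z2\<close>; \<open>s\<close> stands for the rest of the sum.\<close>

definition pair_mean :: "real \<Rightarrow> real \<Rightarrow> real \<Rightarrow> real" where
  "pair_mean s a b = p * (p * f (a * V + b * V + s) + (1 - p) * f (a * V - b / V + s))
        + (1 - p) * (p * f (- a / V + b * V + s) + (1 - p) * f (- a / V - b / V + s))"

lemma pair_mean_commute: "pair_mean s a b = pair_mean s b a"
  unfolding pair_mean_def by (simp add: algebra_simps)

text \<open>The parameter \<open>u\<close> moves weight between the two summands while the total
  \<open>S\<close> is kept. The lowest argument is \<open>y\<close>, and \<open>w\<close> is the
  distance between the two Bernoulli values, so the four arguments are \<open>y\<close> with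
  \<open>w a\<close>, \<open>w b\<close>, both or neither added. Because
  \<open>p V = (1 - p) / V\<close>, the factor \<open>p V\<close> comes out of every term;
  \<open>A\<close> and \<open>B\<close> are what remains of the derivatives in \<open>a\<close> and
  in \<open>b\<close>.\<close>

lemma pair_mean_deriv:
  fixes u S s :: real
  assumes u: "0 < u" "u < S"
  defines "a \<equiv> u powr \<kappa>" and "b \<equiv> (S - u) powr \<kappa>"
  defines "y \<equiv> - a / V - b / V + s" and "w \<equiv> V + 1 / V"
  defines "A \<equiv> p * g (y + w * a + w * b) + (1 - p) * g (y + w * a) - p * g (y + w * b) - (1 - p) * g y"
    and "B \<equiv> p * g (y + w * a + w * b) + (1 - p) * g (y + w * b) - p * g (y + w * a) - (1 - p) * g y"
  shows "((\<lambda>u. pair_mean s (u powr \<kappa>) ((S - u) powr \<kappa>)) has_real_derivative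
          \<kappa> * (p * V) * (u powr (\<kappa> - 1) * A - (S - u) powr (\<kappa> - 1) * B)) (at u)"
proof -
  have da: "((\<lambda>u. u powr \<kappa>) has_real_derivative \<kappa> * u powr (\<kappa> - 1)) (at u)"
    using u by (intro has_real_derivative_powr)
  have db: "((\<lambda>u. (S - u) powr \<kappa>) has_real_derivative - (\<kappa> * (S - u) powr (\<kappa> - 1))) (at u)"
  proof -
    have "((\<lambda>u. (S - u) powr \<kappa>) has_real_derivative (\<kappa> * (S - u) powr (\<kappa> - 1)) * (- 1)) (at u)"
      using u by (intro DERIV_chain2[where f = "\<lambda>z. z powr \<kappa>"] has_real_derivative_powr) (auto intro!: derivative_eq_intros)
    then show ?thesis by simp
  qed
  define a' where "a' = \<kappa> * u powr (\<kappa> - 1)"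
  define b' where "b' = - (\<kappa> * (S - u) powr (\<kappa> - 1))"
  note da = da[folded a'_def] and db = db[folded b'_def]
  have comp: "((\<lambda>u. f (c * u powr \<kappa> + d * (S - u) powr \<kappa> + s)) has_real_derivative
        g (c * a + d * b + s) * (c * a' + d * b')) (at u)" for c d
    unfolding a_def b_def
    by (rule DERIV_chain2[OF deriv],
        rule DERIV_cong[OF DERIV_add[OF DERIV_add[OF DERIV_cmult[OF da] DERIV_cmult[OF db]] DERIV_const]]) simp
  define r where "r = - 1 / V"
  have pr: "(1 - p) * r = - (p * V)" unfolding r_def pV by simp
  have pts': "V * a + V * b + s = y + w * a + w * b" "V * a + r * b + s = y + w * a"
    "r * a + V * b + s = y + w * b" "r * a + r * b + s = y"
    unfolding y_def w_def r_def by (simp_all add: algebra_simps add_divide_distrib)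
  have "((\<lambda>u. p * (p * f (V * u powr \<kappa> + V * (S - u) powr \<kappa> + s) + (1 - p) * f (V * u powr \<kappa> + r * (S - u) powr \<kappa> + s))
        + (1 - p) * (p * f (r * u powr \<kappa> + V * (S - u) powr \<kappa> + s)
             + (1 - p) * f (r * u powr \<kappa> + r * (S - u) powr \<kappa> + s))) has_real_derivative
       p * (p * (g (V * a + V * b + s) * (V * a' + V * b')) + (1 - p) * (g (V * a + r * b + s) * (V * a' + r * b')))
        + (1 - p) * (p * (g (r * a + V * b + s) * (r * a' + V * b'))
             + (1 - p) * (g (r * a + r * b + s) * (r * a' + r * b')))) (at u)"
    by (intro DERIV_add DERIV_cmult comp)
  also have "(\<lambda>u. p * (p * f (V * u powr \<kappa> + V * (S - u) powr \<kappa> + s) + (1 - p) * f (V * u powr \<kappa> + r * (S - u) powr \<kappa> + s))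
        + (1 - p) * (p * f (r * u powr \<kappa> + V * (S - u) powr \<kappa> + s)
             + (1 - p) * f (r * u powr \<kappa> + r * (S - u) powr \<kappa> + s)))
      = (\<lambda>u. pair_mean s (u powr \<kappa>) ((S - u) powr \<kappa>))"
    unfolding pair_mean_def r_def by (simp add: mult.commute)
  also have "p * (p * (g (V * a + V * b + s) * (V * a' + V * b')) + (1 - p) * (g (V * a + r * b + s) * (V * a' + r * b')))
        + (1 - p) * (p * (g (r * a + V * b + s) * (r * a' + V * b'))
             + (1 - p) * (g (r * a + r * b + s) * (r * a' + r * b')))
     = a' * (p * (p * V) * g (y + w * a + w * b) + (1 - p) * (p * V) * g (y + w * a)
                + p * ((1 - p) * r) * g (y + w * b) + (1 - p) * ((1 - p) * r) * g y)
     + b' * (p * (p * V) * g (y + w * a + w * b) + (1 - p) * (p * V) * g (y + w * b)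
                + p * ((1 - p) * r) * g (y + w * a) + (1 - p) * ((1 - p) * r) * g y)"
    unfolding pts' by (simp add: algebra_simps)
  also have "\<dots> = a' * ((p * V) * A) + b' * ((p * V) * B)"
    unfolding pr A_def B_def by (simp add: algebra_simps)
  also have "\<dots> = \<kappa> * (p * V) * (u powr (\<kappa> - 1) * A - (S - u) powr (\<kappa> - 1) * B)"
    unfolding a'_def b'_def by (simp add: algebra_simps)
  finally show ?thesis .
qed

text \<open>The identity \<open>\<kappa> (2l - 1) = 1 - \<kappa>\<close> is the source of the
  exponent \<open>2l - 1\<close>: it converts the factors of the two terms of
  \<open>pair_mean_deriv\<close> into each other through the ratio of the coefficients.\<close>

lemma powr_weight:
  assumes x: "0 < x" "x < S"
  shows "x powr (\<kappa> - 1) * (x powr \<kappa> / (S - x) powr \<kappa>) powr (2 * l - 1) = (S - x) powr (\<kappa> - 1)"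
proof -
  have e: "\<kappa> * (2 * l - 1) = 1 - \<kappa>" unfolding \<kappa>_def using l by (simp add: field_simps)
  have "(x powr \<kappa> / (S - x) powr \<kappa>) powr (2 * l - 1) = x powr (1 - \<kappa>) / (S - x) powr (1 - \<kappa>)"
    using x by (simp add: powr_divide powr_powr e)
  moreover have "x powr (\<kappa> - 1) * x powr (1 - \<kappa>) = 1" using x by (simp flip: powr_add)
  moreover have "(S - x) powr (\<kappa> - 1) = 1 / (S - x) powr (1 - \<kappa>)"
    using powr_minus_divide[of "S - x" "1 - \<kappa>"] by simp
  ultimately show ?thesis by simp
qed

end

text \<open>The three requirements on a test function have separate uses: \<open>g_mono\<close>
  makes \<open>f\<close> convex, for the case where the normalized sum is 0;
  \<open>trapezoid\<close> allows the skewness of a summand to be increased; \<open>key\<close>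
  allows weights to be averaged.\<close>

locale comparison_function = bernoulli_pair +
  assumes g_mono: "mono g"
    and trapezoid: "\<And>u v. u \<le> v \<Longrightarrow> 2 * (f v - f u) \<le> (v - u) * (g u + g v)"
    and key: "\<And>y a b. 0 < b \<Longrightarrow> b \<le> a \<Longrightarrow>
       p * g (y + a + b) + (1 - p) * g (y + a) - p * g (y + b) - (1 - p) * g y
     \<le> (a / b) powr (2 * l - 1) * (p * g (y + a + b) + (1 - p) * g (y + b) - p * g (y + a) - (1 - p) * g y)"
begin

lemma pair_mean_antimono:
  assumes u: "S / 2 \<le> u" "u \<le> v" "v \<le> S" and S: "0 < S"
  shows "pair_mean s (v powr \<kappa>) ((S - v) powr \<kappa>) \<le> pair_mean s (u powr \<kappa>) ((S - u) powr \<kappa>)"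
proof (cases "u = v")
  case False
  then have uv: "u < v" using u by simp
  have "isCont f x" for x using deriv DERIV_isCont by blast
  then have cf: "continuous_on A f" for A by (simp add: continuous_at_imp_continuous_on)
  have ca: "continuous_on {u..v} (\<lambda>x. x powr \<kappa>)"
    using u S kappa by (intro continuous_on_powr' continuous_on_id continuous_on_const) auto
  have cb: "continuous_on {u..v} (\<lambda>x. (S - x) powr \<kappa>)"
    using u S kappa by (intro continuous_on_powr' continuous_on_id continuous_on_const continuous_on_diff) auto
  have cc: "continuous_on {u..v} (\<lambda>x. f (c x))" if "continuous_on {u..v} c" for c
    using continuous_on_compose2[OF cf[of UNIV] that] by simp
  have cont: "continuous_on {u..v} (\<lambda>u. pair_mean s (u powr \<kappa>) ((S - u) powr \<kappa>))"
    unfolding pair_mean_def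
    by (intro continuous_on_add continuous_on_mult continuous_on_const cc ca cb continuous_on_diff
        continuous_on_minus continuous_on_divide) (use V_pos in auto)
  show ?thesis
  \<comment> \<open>Differentiability is needed only inside the interval: since
    \<open>\<kappa> < 1\<close>, the power \<open>(S - x) powr \<kappa>\<close> has no finite
    derivative at \<open>x = S\<close>, and the endpoint \<open>v = S\<close> is reached by
    continuity.\<close>
  proof (rule DERIV_nonpos_imp_decreasing_open[OF \<open>u \<le> v\<close> _ cont])
    fix x assume x: "u < x" "x < v"
    define a b where "a = x powr \<kappa>" and "b = (S - x) powr \<kappa>"
    have xS: "0 < x" "x < S" "S - x \<le> x" using x u S by auto
    have ab: "0 < b" "b \<le> a" unfolding a_def b_def using xS kappa by (auto intro!: powr_mono2)
    define w where "w = V + 1 / V"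
    have w: "0 < w" unfolding w_def using V_pos by (simp add: add_pos_pos)
    define y where "y = - a / V - b / V + s"
    define A where "A = p * g (y + w * a + w * b) + (1 - p) * g (y + w * a) - p * g (y + w * b) - (1 - p) * g y"
    define B where "B = p * g (y + w * a + w * b) + (1 - p) * g (y + w * b) - p * g (y + w * a) - (1 - p) * g y"
    have "A \<le> (a / b) powr (2 * l - 1) * B"
      using key[of "w * b" "w * a" y] ab w unfolding A_def B_def by simp
    then have "x powr (\<kappa> - 1) * A \<le> x powr (\<kappa> - 1) * ((a / b) powr (2 * l - 1) * B)"
      by (intro mult_left_mono) auto
    also have "\<dots> = (x powr (\<kappa> - 1) * (a / b) powr (2 * l - 1)) * B" by simp
    also have "x powr (\<kappa> - 1) * (a / b) powr (2 * l - 1) = (S - x) powr (\<kappa> - 1)"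
      unfolding a_def b_def by (rule powr_weight[OF xS(1,2)])
    finally have "x powr (\<kappa> - 1) * A - (S - x) powr (\<kappa> - 1) * B \<le> 0" by simp
    then have "\<kappa> * (p * V) * (x powr (\<kappa> - 1) * A - (S - x) powr (\<kappa> - 1) * B) \<le> 0"
      using kappa p V_pos by (intro mult_nonneg_nonpos) auto
    then show "\<exists>D. ((\<lambda>u. pair_mean s (u powr \<kappa>) ((S - u) powr \<kappa>)) has_real_derivative D) (at x) \<and> D \<le> 0"
      using pair_mean_deriv[OF xS(1,2), of s] unfolding A_def B_def y_def w_def a_def b_def by blast
  qed
qed simp

text \<open>By symmetry in the two coefficients a weight \<open>u\<close> may be exchanged with
  \<open>S - u\<close>, so only its distance from \<open>S / 2\<close> counts and
  \<open>pair_mean_antimono\<close> applies on the right half.\<close>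

lemma pair_mean_closer:
  assumes S: "0 < S" and u: "0 \<le> u" "u \<le> S" and v: "0 \<le> v" "v \<le> S" and le: "\<bar>v - S / 2\<bar> \<le> \<bar>u - S / 2\<bar>"
  shows "pair_mean s (u powr \<kappa>) ((S - u) powr \<kappa>) \<le> pair_mean s (v powr \<kappa>) ((S - v) powr \<kappa>)"
proof -
  have fold: "pair_mean s (x powr \<kappa>) ((S - x) powr \<kappa>)
      = pair_mean s ((S / 2 + \<bar>x - S / 2\<bar>) powr \<kappa>) ((S - (S / 2 + \<bar>x - S / 2\<bar>)) powr \<kappa>)" for x
  proof (cases "S / 2 \<le> x")
    case False
    then have "S / 2 + \<bar>x - S / 2\<bar> = S - x" by (simp add: abs_if)
    then show ?thesis by (simp add: pair_mean_commute)
  qed simp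
  show ?thesis
    unfolding fold[of u] fold[of v] by (rule pair_mean_antimono) (use assms in \<open>auto simp: abs_if\<close>)
qed

definition bernoulli_mean :: "'i set \<Rightarrow> ('i \<Rightarrow> real) \<Rightarrow> real" where
  "bernoulli_mean I a = two_point_expectation I (\<lambda>_. p) (\<lambda>i. a i * V) (\<lambda>i. - a i / V) f"

text \<open>The heavier index \<open>j\<close> passes weight to the lighter \<open>k\<close> until
  it reaches \<open>m\<close>. As \<open>m\<close> lies between the two weights, the new pair is no
  farther from equality than the old one.\<close>

lemma bernoulli_mean_transfer:
  assumes I: "finite I" "j \<in> I" "k \<in> I" "j \<noteq> k" and u: "\<And>i. i \<in> I \<Longrightarrow> 0 \<le> u i"
    and m: "m \<le> u j" "u k \<le> m"
  shows "bernoulli_mean I (\<lambda>i. u i powr \<kappa>) \<le> bernoulli_mean I (\<lambda>i. (u(j := m, k := u j + u k - m)) i powr \<kappa>)"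
proof (cases "u j + u k = 0")
  case True
  then have "u j = 0" "u k = 0" using u[of j] u[of k] I by auto
  then have "m = 0" using m by simp
  then have "u(j := m, k := u j + u k - m) = u" using \<open>u j = 0\<close> \<open>u k = 0\<close> by (auto simp: fun_eq_iff)
  then show ?thesis by simp
next
  case False
  then have S: "0 < u j + u k" using u[of j] u[of k] I by simp
  have closer: "pair_mean s (u j powr \<kappa>) (u k powr \<kappa>) \<le> pair_mean s (m powr \<kappa>) ((u j + u k - m) powr \<kappa>)" for s
    using pair_mean_closer[OF S, of "u j" m s] u[of j] u[of k] I m by (simp add: abs_if field_simps split: if_splits)
  show ?thesis
    unfolding bernoulli_mean_def
  proof (rule two_point_expectation_replace2[OF I])
    fix s
    show "two_point_expectation {j, k} (\<lambda>_. p) (\<lambda>i. u i powr \<kappa> * V) (\<lambda>i. - (u i powr \<kappa>) / V) (\<lambda>z. f (z + s))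
       \<le> two_point_expectation {j, k} (\<lambda>_. p) (\<lambda>i. (u(j := m, k := u j + u k - m)) i powr \<kappa> * V)
          (\<lambda>i. - ((u(j := m, k := u j + u k - m)) i powr \<kappa>) / V) (\<lambda>z. f (z + s))"
      using closer[of s] I(4) unfolding pair_mean_def by (simp add: two_point_expectation_pair)
  qed (use p in auto)
qed

text \<open>As long as some weight differs from the mean \<open>m\<close>, there is one above and
  one below it. A transfer between these sets the larger one exactly to \<open>m\<close>, so the
  number of weights different from \<open>m\<close> decreases; this makes the averaging finite, with
  no limit argument.\<close>

lemma bernoulli_mean_equal_weights:
  assumes I: "finite I" and u: "\<And>i. i \<in> I \<Longrightarrow> 0 \<le> u i" and sum: "(\<Sum>i\<in>I. u i) = of_nat (card I) * m"
  shows "bernoulli_mean I (\<lambda>i. u i powr \<kappa>) \<le> bernoulli_mean I (\<lambda>_. m powr \<kappa>)"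
  using u sum
proof (induction "card {i \<in> I. u i \<noteq> m}" arbitrary: u rule: less_induct)
  case less
  show ?case
  proof (cases "\<forall>i\<in>I. u i = m")
    case True
    then have "bernoulli_mean I (\<lambda>i. u i powr \<kappa>) = bernoulli_mean I (\<lambda>_. m powr \<kappa>)"
      unfolding bernoulli_mean_def by (intro two_point_expectation_cong) auto
    then show ?thesis by simp
  next
    case False
    then obtain i0 where i0: "i0 \<in> I" "u i0 \<noteq> m" by blast
    have "\<exists>j\<in>I. m < u j"
    proof (rule ccontr)
      assume "\<not> ?thesis"
      then have "sum u I < (\<Sum>i\<in>I. m)" using i0 by (intro sum_strict_mono_ex1[OF I]) (auto intro!: bexI[of _ i0])
      then show False using less.prems(2) by simp
    qed
    then obtain j where j: "j \<in> I" "m < u j" by blast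
    have "\<exists>k\<in>I. u k < m"
    proof (rule ccontr)
      assume "\<not> ?thesis"
      then have "(\<Sum>i\<in>I. m) < sum u I" using i0 by (intro sum_strict_mono_ex1[OF I]) (auto intro!: bexI[of _ i0])
      then show False using less.prems(2) by simp
    qed
    then obtain k where k: "k \<in> I" "u k < m" by blast
    have jk: "j \<noteq> k" using j k by auto
    let ?u = "u(j := m, k := u j + u k - m)"
    have m0: "0 \<le> m" using less.prems(1)[OF k(1)] k(2) by simp
    have sum': "sum ?u I = sum u I"
    proof -
      have "sum h I = h j + (h k + sum h (I - {j} - {k}))" for h :: "'a \<Rightarrow> real"
        using I j k jk by (subst sum.remove[of I j], simp, simp, subst sum.remove[of "I - {j}" k]) auto
      note R = this
      have "sum ?u (I - {j} - {k}) = sum u (I - {j} - {k})" by (intro sum.cong) auto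
      then show ?thesis using R[of u] R[of ?u] jk by simp
    qed
    have "bernoulli_mean I (\<lambda>i. u i powr \<kappa>) \<le> bernoulli_mean I (\<lambda>i. ?u i powr \<kappa>)"
      by (rule bernoulli_mean_transfer) (use I j k jk less.prems in auto)
    also have "\<dots> \<le> bernoulli_mean I (\<lambda>_. m powr \<kappa>)"
    proof (rule less.hyps)
      \<comment> \<open>Index \<open>j\<close> leaves the set, while no index already at
        \<open>m\<close> was touched; whether \<open>k\<close> also reaches \<open>m\<close> does
        not matter.\<close>
      have "{i \<in> I. ?u i \<noteq> m} \<subset> {i \<in> I. u i \<noteq> m}" using j k jk by (auto split: if_splits)
      then show "card {i \<in> I. ?u i \<noteq> m} < card {i \<in> I. u i \<noteq> m}"
        using I by (intro psubset_card_mono) auto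
      show "0 \<le> ?u i" if "i \<in> I" for i
        using that less.prems(1)[OF that] less.prems(1)[OF k(1)] j m0 by auto
      show "sum ?u I = of_nat (card I) * m" using sum' less.prems(2) by simp
    qed
    finally show ?thesis .
  qed
qed

end

section \<open>Skewness of two-point variables and the comparison for given pairs\<close>

context comparison_function
begin

text \<open>The expressions are means of \<open>f (s + \<xi>)\<close>, where \<open>\<xi>\<close>
  takes the values \<open>a x\<close> and \<open>- a / x\<close>, has mean 0 and variance
  \<open>a^2\<close>, and \<open>x\<close> measures its skewness. The numerator of the derivative in
  \<open>x\<close> is \<open>a (F' + G') (1 + x^2) - 2 x (F - G)\<close>. Since
  \<open>(1 + x^2) a / x\<close> is the distance between the two points, its nonnegativity is the
  trapezoid bound for \<open>g\<close> between them.\<close>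

lemma asymmetric_pair_mono:
  assumes v: "0 < v" "v \<le> w" and a: "0 \<le> a"
  shows "(f (s + a * v) + v\<^sup>2 * f (s - a / v)) / (1 + v\<^sup>2) \<le> (f (s + a * w) + w\<^sup>2 * f (s - a / w)) / (1 + w\<^sup>2)"
proof (rule DERIV_nonneg_imp_nondecreasing[OF v(2)])
  fix x assume "v \<le> x" "x \<le> w"
  then have x: "0 < x" using v by simp
  have nz: "1 + x\<^sup>2 > 0" by (simp add: add_pos_nonneg)
  have d1: "((\<lambda>x. f (s + a * x)) has_real_derivative g (s + a * x) * a) (at x)"
    by (rule DERIV_chain2[OF deriv]) (auto intro!: derivative_eq_intros)
  have d2: "((\<lambda>x. f (s - a / x)) has_real_derivative g (s - a / x) * (a / x\<^sup>2)) (at x)"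
    by (rule DERIV_chain2[OF deriv]) (use x in \<open>auto intro!: derivative_eq_intros simp: power2_eq_square\<close>)
  define F G F' G' where "F = f (s + a * x)" and "G = f (s - a / x)" and "F' = g (s + a * x)" and "G' = g (s - a / x)"
  have "((\<lambda>x. (f (s + a * x) + x\<^sup>2 * f (s - a / x)) / (1 + x\<^sup>2)) has_real_derivative
      ((F' * a + (2 * x * G + x\<^sup>2 * (G' * (a / x\<^sup>2)))) * (1 + x\<^sup>2) - (F + x\<^sup>2 * G) * (2 * x)) / ((1 + x\<^sup>2) * (1 + x\<^sup>2))) (at x)"
    unfolding F_def G_def F'_def G'_def using nz x
    by (auto intro!: derivative_eq_intros d1 d2)
  moreover have "(F' * a + (2 * x * G + x\<^sup>2 * (G' * (a / x\<^sup>2)))) * (1 + x\<^sup>2) - (F + x\<^sup>2 * G) * (2 * x)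
      = a * (F' + G') * (1 + x\<^sup>2) - x * (2 * (F - G))"
    using x by (simp add: algebra_simps)
  moreover have "0 \<le> a * (F' + G') * (1 + x\<^sup>2) - x * (2 * (F - G))"
  proof -
    have "0 \<le> a * x" "0 \<le> a / x" using a x by auto
    then have "s - a / x \<le> s + a * x" by linarith
    then have "2 * (F - G) \<le> (a * x + a / x) * (G' + F')"
      using trapezoid[of "s - a / x" "s + a * x"] unfolding F_def G_def F'_def G'_def by simp
    then have "x * (2 * (F - G)) \<le> x * ((a * x + a / x) * (G' + F'))" using x by (intro mult_left_mono) auto
    also have "\<dots> = a * (F' + G') * (1 + x\<^sup>2)" using x by (simp add: field_simps power2_eq_square)
    finally show ?thesis by simp
  qed
  ultimately show "\<exists>y. ((\<lambda>x. (f (s + a * x) + x\<^sup>2 * f (s - a / x)) / (1 + x\<^sup>2)) has_real_derivative y) (at x) \<and> 0 \<le> y"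
    by (metis (no_types, lifting) divide_nonneg_nonneg zero_le_square)
qed

lemma f_convex: "convex_on UNIV f"
  by (rule convex_on_realI[where f' = g]) (use deriv g_mono in \<open>auto simp: monoD\<close>)

text \<open>Needed where all pairs degenerate: by the convention on \<open>0 / 0\<close> the
  normalized sum is then 0 and has to be compared with a genuine Bernoulli sum.\<close>

lemma bernoulli_jensen: "f s \<le> p * f (s + a * V) + (1 - p) * f (s - a / V)"
proof -
  have "f ((1 - p) *\<^sub>R (s - a / V) + p *\<^sub>R (s + a * V)) \<le> (1 - p) * f (s - a / V) + p * f (s + a * V)"
    by (rule convex_onD[OF f_convex]) (use p in auto)
  also have "(1 - p) *\<^sub>R (s - a / V) + p *\<^sub>R (s + a * V) = s + a * (p * V - (1 - p) / V)"
    by (simp add: algebra_simps)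
  also have "\<dots> = s" using pV by simp
  finally show ?thesis by simp
qed

text \<open>Writing \<open>x = a v\<close> and \<open>- y = a / v\<close>, the centred variable on
  \<open>x\<close> and \<open>y\<close> has standard deviation \<open>a\<close> and skewness
  parameter \<open>v\<close>. The ratio hypothesis says exactly \<open>v <= V\<close>, and
  \<open>asymmetric_pair_mono\<close> raises \<open>v\<close> to \<open>V\<close> without changing
  \<open>a\<close>.\<close>

lemma two_point_le_bernoulli:
  assumes x: "0 < x" "y < 0" and ratio: "x / (- y) \<le> (1 - p) / p"
  defines "a \<equiv> sqrt (x * (- y))"
  shows "(- y) / (x - y) * f (x + s) + (1 - (- y) / (x - y)) * f (y + s)
     \<le> p * f (a * V + s) + (1 - p) * f (- a / V + s)"
proof -
  define v where "v = sqrt (x / (- y))"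
  have v: "0 < v" unfolding v_def using x by (simp add: divide_pos_neg)
  have v2: "v\<^sup>2 = x / (- y)" unfolding v_def using x by (simp add: divide_pos_neg less_imp_le)
  have a0: "0 < a" unfolding a_def using x by (simp add: mult_pos_neg)
  have vV: "v \<le> V" unfolding v_def V_def using ratio by (rule real_sqrt_le_mono)
  have "a * v = sqrt (x * (- y) * (x / (- y)))" unfolding a_def v_def by (rule real_sqrt_mult[symmetric])
  also have "x * (- y) * (x / (- y)) = x\<^sup>2" using x by (simp add: power2_eq_square)
  finally have av: "a * v = x" using x by simp
  then have "a / v = x / v\<^sup>2" using v by (simp add: power2_eq_square field_simps)
  then have av': "a / v = - y" unfolding v2 using x by simp
  have al: "(- y) / (x - y) = 1 / (1 + v\<^sup>2)" "1 - (- y) / (x - y) = v\<^sup>2 / (1 + v\<^sup>2)"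
    unfolding v2 using x by (auto simp: field_simps)
  have alV: "p = 1 / (1 + V\<^sup>2)" "1 - p = V\<^sup>2 / (1 + V\<^sup>2)"
    using p_V by (auto simp: field_simps add_pos_nonneg add_nonneg_eq_0_iff)
  have "(- y) / (x - y) * f (x + s) + (1 - (- y) / (x - y)) * f (y + s)
     = (f (s + a * v) + v\<^sup>2 * f (s - a / v)) / (1 + v\<^sup>2)"
    unfolding al(2) unfolding al(1) av av' by (simp add: add_divide_distrib add.commute)
  also have "\<dots> \<le> (f (s + a * V) + V\<^sup>2 * f (s - a / V)) / (1 + V\<^sup>2)"
    by (rule asymmetric_pair_mono) (use v vV a0 in auto)
  also have "\<dots> = 1 / (1 + V\<^sup>2) * f (a * V + s) + V\<^sup>2 / (1 + V\<^sup>2) * f (- a / V + s)"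
    by (simp add: add_divide_distrib add.commute)
  finally show ?thesis unfolding alV[symmetric] .
qed

theorem self_normalized_two_point_le:
  assumes I: "finite I" "I \<noteq> {}"
    and xy: "\<And>i. i \<in> I \<Longrightarrow> (x i = 0 \<and> y i = 0) \<or> (0 < x i \<and> y i < 0 \<and> x i / (- y i) \<le> (1 - p) / p)"
  defines "D \<equiv> (\<Sum>i\<in>I. (x i * - y i) powr l) powr \<kappa>"
  shows "two_point_expectation I (\<lambda>i. - y i / (x i - y i)) (\<lambda>i. x i / D) (\<lambda>i. y i / D) f
     \<le> bernoulli_mean I (\<lambda>_. (1 / card I) powr \<kappa>)"
proof -
  have al: "0 \<le> - y i / (x i - y i)" "- y i / (x i - y i) \<le> 1" if "i \<in> I" for i
    using xy[OF that] by (auto simp: field_simps)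
  have xy0: "0 \<le> x i * - y i" if "i \<in> I" for i using xy[OF that] by (auto simp: mult_nonneg_nonpos)
  define Q where "Q = (\<Sum>i\<in>I. (x i * - y i) powr l)"
  have Q0: "0 \<le> Q" unfolding Q_def by (intro sum_nonneg) auto
  show ?thesis
  proof (cases "Q = 0")
    case True
    \<comment> \<open>Division by 0 gives 0, so every summand on the left is 0 and a summandwise
      Jensen inequality suffices.\<close>
    then have D: "D = 0" unfolding D_def Q_def by simp
    show ?thesis
      unfolding bernoulli_mean_def D
    proof (rule two_point_expectation_replace_all[OF I(1) al])
      fix i s
      show "- y i / (x i - y i) * f (x i / 0 + s) + (1 - (- y i) / (x i - y i)) * f (y i / 0 + s)
        \<le> p * f ((1 / real (card I)) powr \<kappa> * V + s) + (1 - p) * f (- ((1 / real (card I)) powr \<kappa>) / V + s)"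
        using bernoulli_jensen[of s "(1 / real (card I)) powr \<kappa>"] by (simp add: algebra_simps)
    qed (use p in auto)
  next
    case False
    then have Q: "0 < Q" using Q0 by simp
    \<comment> \<open>These weights sum to 1, and since \<open>l * \<kappa> = 1/2\<close> their
      powers \<open>u i powr \<kappa>\<close> are the standard deviations of the normalized
      summands. The averaging of weights thus applies with total weight 1 and mean
      \<open>1 / card I\<close>.\<close>
    define u where "u = (\<lambda>i. (x i * - y i) powr l / Q)"
    have D: "0 < D" "D = Q powr \<kappa>" using Q unfolding D_def Q_def by auto
    have u0: "0 \<le> u i" for i unfolding u_def using Q by simp
    have usum: "(\<Sum>i\<in>I. u i) = of_nat (card I) * (1 / card I)"
      unfolding u_def using Q I by (simp add: Q_def flip: sum_divide_distrib)
    have l\<kappa>: "l * \<kappa> = 1 / 2" unfolding \<kappa>_def using l by simp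
    have uk: "u i powr \<kappa> = sqrt (x i / D * (- (y i / D)))" if "i \<in> I" for i
    proof -
      have "u i powr \<kappa> = ((x i * - y i) powr l) powr \<kappa> / Q powr \<kappa>"
        unfolding u_def using Q by (simp add: powr_divide)
      also have "((x i * - y i) powr l) powr \<kappa> = (x i * - y i) powr (1 / 2)"
        by (simp add: powr_powr l\<kappa>)
      also have "\<dots> = sqrt (x i * - y i)" using xy0[OF that] by (simp add: powr_half_sqrt)
      also have "\<dots> / Q powr \<kappa> = sqrt (x i * - y i) / sqrt (D\<^sup>2)" using D by simp
      also have "\<dots> = sqrt (x i / D * (- (y i / D)))"
        unfolding real_sqrt_divide[symmetric] by (simp add: power2_eq_square)
      finally show ?thesis .
    qed
    have "two_point_expectation I (\<lambda>i. - y i / (x i - y i)) (\<lambda>i. x i / D) (\<lambda>i. y i / D) f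
        \<le> bernoulli_mean I (\<lambda>i. u i powr \<kappa>)"
      unfolding bernoulli_mean_def
    proof (rule two_point_expectation_replace_all[OF I(1) al])
      fix i s assume i: "i \<in> I"
      show "- y i / (x i - y i) * f (x i / D + s) + (1 - (- y i) / (x i - y i)) * f (y i / D + s)
        \<le> p * f (u i powr \<kappa> * V + s) + (1 - p) * f (- (u i powr \<kappa>) / V + s)"
      proof (cases "x i = 0")
        case True
        then have "y i = 0" using xy[OF i] by simp
        then show ?thesis using True uk[OF i] p by (simp add: algebra_simps)
      next
        case False
        then have xi: "0 < x i" "y i < 0" "x i / (- y i) \<le> (1 - p) / p" using xy[OF i] by auto
        have e: "- y i / (x i - y i) = - (y i / D) / (x i / D - y i / D)"
          using D by (simp flip: diff_divide_distrib)
        show ?thesis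
          unfolding e uk[OF i] by (rule two_point_le_bernoulli) (use xi D in \<open>auto simp: divide_neg_pos\<close>)
      qed
    qed (use p in auto)
    also have "\<dots> \<le> bernoulli_mean I (\<lambda>_. (1 / card I) powr \<kappa>)"
      by (rule bernoulli_mean_equal_weights) (use I u0 usum in auto)
    finally show ?thesis .
  qed
qed

end

section \<open>Truncated cubes and quadratics as test functions\<close>

lemma pos_part_power_deriv:
  "((\<lambda>x. (max 0 (x - t)) ^ Suc (Suc k)) has_real_derivative real (Suc (Suc k)) * (max 0 (x - t)) ^ Suc k) (at x)"
proof -
  consider "x < t" | "x = t" | "t < x" by linarith
  then show ?thesis
  proof cases
    case 1
    have "((\<lambda>x::real. 0) has_real_derivative 0) (at x)" by simp
    then have "((\<lambda>x. (max 0 (x - t)) ^ Suc (Suc k)) has_real_derivative 0) (at x)"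
      by (rule has_field_derivative_transform_within_open[where S = "{..<t}"]) (use 1 in \<open>auto simp: max_def\<close>)
    then show ?thesis using 1 by (simp add: max_def)
  next
    case 2
    \<comment> \<open>At the kink the difference quotient is bounded by a positive power of the
      increment, as the exponent is at least 2.\<close>
    have "((\<lambda>h::real. (max 0 h) ^ Suc (Suc k) / h) \<longlongrightarrow> 0) (at 0)"
    proof (rule Lim_null_comparison)
      show "\<forall>\<^sub>F h in at 0. norm ((max 0 h) ^ Suc (Suc k) / h) \<le> \<bar>h\<bar> ^ Suc k"
      proof (rule always_eventually, rule allI)
        fix h :: real
        have "(max 0 h) ^ Suc (Suc k) / h = (max 0 h) ^ Suc k" by (cases "0 < h") (auto simp: max_def)
        moreover have "(max 0 h) ^ Suc k \<le> \<bar>h\<bar> ^ Suc k" by (intro power_mono) auto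
        moreover have "0 \<le> (max 0 h) ^ Suc k" by (intro zero_le_power) auto
        ultimately show "norm ((max 0 h) ^ Suc (Suc k) / h) \<le> \<bar>h\<bar> ^ Suc k" by (simp only: real_norm_def abs_of_nonneg)
      qed
      show "((\<lambda>h::real. \<bar>h\<bar> ^ Suc k) \<longlongrightarrow> 0) (at 0)"
        by (rule tendsto_eq_rhs) (rule tendsto_intros | simp)+
    qed
    then show ?thesis unfolding DERIV_def 2 by simp
  next
    case 3
    have "((\<lambda>x. (x - t) ^ Suc (Suc k)) has_real_derivative real (Suc (Suc k)) * (x - t) ^ Suc k) (at x)"
      by (rule DERIV_cong[OF DERIV_power[where f = "\<lambda>x. x - t" and D = 1]]) (auto intro!: derivative_eq_intros)
    then have "((\<lambda>x. (max 0 (x - t)) ^ Suc (Suc k)) has_real_derivative real (Suc (Suc k)) * (x - t) ^ Suc k) (at x)"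
      by (rule has_field_derivative_transform_within_open[where S = "{t<..}"]) (use 3 in \<open>auto simp: max_def\<close>)
    then show ?thesis using 3 by (simp add: max_def)
  qed
qed

lemma pos_part_square_deriv: "((\<lambda>x. (max 0 (x - t))\<^sup>2) has_real_derivative 2 * max 0 (x - t)) (at x)"
  using pos_part_power_deriv[of t 0 x] by (simp add: numeral_2_eq_2)

lemma pos_part_cube_deriv: "((\<lambda>x. (max 0 (x - t)) ^ 3) has_real_derivative 3 * (max 0 (x - t))\<^sup>2) (at x)"
  using pos_part_power_deriv[of t 1 x] by (simp add: numeral_3_eq_3 numeral_2_eq_2)

lemma comparison_function_cube:
  assumes p: "0 < p" "p < 1" and l: "lambda_star p \<le> l"
  shows "comparison_function p l (\<lambda>x. (max 0 (x - t)) ^ 3) (\<lambda>x. 3 * (max 0 (x - t))\<^sup>2)"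
proof
  show "1 / 2 < l" using lambda_star_ge_1[OF p] l by simp
  show "mono (\<lambda>x. 3 * (max 0 (x - t))\<^sup>2)" by (intro monoI mult_left_mono power_mono) auto
  show "2 * ((max 0 (v - t)) ^ 3 - (max 0 (u - t)) ^ 3) \<le> (v - u) * (3 * (max 0 (u - t))\<^sup>2 + 3 * (max 0 (v - t))\<^sup>2)"
    if uv: "u \<le> v" for u v
  proof (cases "u \<le> t")
    case True
    have "2 * (max 0 (v - t)) ^ 3 \<le> (3 * (max 0 (v - t))\<^sup>2) * max 0 (v - t)"
      by (simp add: power3_eq_cube power2_eq_square)
    also have "\<dots> \<le> (3 * (max 0 (v - t))\<^sup>2) * (v - u)" using True uv by (intro mult_left_mono) auto
    finally have "2 * (max 0 (v - t)) ^ 3 \<le> (3 * (max 0 (v - t))\<^sup>2) * (v - u)" .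
    moreover have "max 0 (u - t) = 0" using True by simp
    ultimately show ?thesis by (simp add: mult.commute)
  next
    case False
    \<comment> \<open>To the right of the kink the defect of the trapezoid inequality for a cubic is
      exactly \<open>(v - u)^3\<close>.\<close>
    have "0 \<le> (v - u) * (v - u)\<^sup>2" using uv by simp
    also have "\<dots> = (v - u) * (3 * (u - t)\<^sup>2 + 3 * (v - t)\<^sup>2) - 2 * ((v - t) ^ 3 - (u - t) ^ 3)"
      by (simp add: power3_eq_cube power2_eq_square algebra_simps)
    finally show ?thesis using False uv by (simp add: max_def)
  qed
  show "p * (3 * (max 0 (y + a + b - t))\<^sup>2) + (1 - p) * (3 * (max 0 (y + a - t))\<^sup>2)
         - p * (3 * (max 0 (y + b - t))\<^sup>2) - (1 - p) * (3 * (max 0 (y - t))\<^sup>2)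
    \<le> (a / b) powr (2 * l - 1) * (p * (3 * (max 0 (y + a + b - t))\<^sup>2) + (1 - p) * (3 * (max 0 (y + b - t))\<^sup>2)
         - p * (3 * (max 0 (y + a - t))\<^sup>2) - (1 - p) * (3 * (max 0 (y - t))\<^sup>2))"
    if "0 < b" "b \<le> a" for y a b
  proof -
    have "p * (3 * A) + (1 - p) * (3 * B) - p * (3 * C) - (1 - p) * (3 * D) \<le> \<beta> * (p * (3 * A) + (1 - p) * (3 * C) - p * (3 * B) - (1 - p) * (3 * D))"
      if "p * A + (1 - p) * B - p * C - (1 - p) * D \<le> \<beta> * (p * A + (1 - p) * C - p * B - (1 - p) * D)" for A B C D \<beta>
      using mult_left_mono[OF that, of 3] by (simp add: algebra_simps)
    then show ?thesis using key_ineq_truncated_square[OF p l that, where y = y and t = t] by blast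
  qed
qed (use p pos_part_cube_deriv in auto)

text \<open>Quadratics are required separately because the approximation of the class leaves a
  Taylor polynomial of degree two at the left end of the interval. Here the trapezoid rule is
  exact.\<close>

lemma comparison_function_square:
  assumes p: "0 < p" "p < 1" and l: "lambda_star p \<le> l"
  shows "comparison_function p l (\<lambda>x. (x - t)\<^sup>2) (\<lambda>x. 2 * (x - t))"
proof
  show "1 / 2 < l" using lambda_star_ge_1[OF p] l by simp
  show "mono (\<lambda>x. 2 * (x - t))" by (intro monoI) auto
  show "((\<lambda>x. (x - t)\<^sup>2) has_real_derivative 2 * (x - t)) (at x)" for x
    by (auto intro!: derivative_eq_intros)
  show "2 * ((v - t)\<^sup>2 - (u - t)\<^sup>2) \<le> (v - u) * (2 * (u - t) + 2 * (v - t))" for u v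
    by (simp add: power2_eq_square algebra_simps)
  show "p * (2 * (y + a + b - t)) + (1 - p) * (2 * (y + a - t)) - p * (2 * (y + b - t)) - (1 - p) * (2 * (y - t))
    \<le> (a / b) powr (2 * l - 1) * (p * (2 * (y + a + b - t)) + (1 - p) * (2 * (y + b - t))
         - p * (2 * (y + a - t)) - (1 - p) * (2 * (y - t)))"
    if "0 < b" "b \<le> a" for y a b
    using mult_left_mono[OF key_ineq_linear[OF p l that, where y = y and t = t], of 2] by (simp add: algebra_simps)
qed (use p in auto)

subsection \<open>Generators of the function class\<close>

lemma H_plus_3_derivs:
  assumes "f \<in> H_plus 3"
  obtains f' f'' where "\<And>x. (f has_real_derivative f' x) (at x)" "\<And>x. (f' has_real_derivative f'' x) (at x)"
    "convex_on UNIV f''" "mono f''" "\<And>x. 0 \<le> f x" "\<And>x. 0 \<le> f' x" "\<And>x. 0 \<le> f'' x"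
proof -
  have d: "((deriv ^^ 0) f) field_differentiable at x" "((deriv ^^ Suc 0) f) field_differentiable at x"
    and c: "convex_on UNIV ((deriv ^^ 2) f)"
    and lims: "(f \<longlongrightarrow> 0) at_bot" "(deriv f \<longlongrightarrow> 0) at_bot" "((deriv ^^ 2) f \<longlongrightarrow> 0) at_bot" for x
  proof -
    have *: "\<forall>j<2. \<forall>x. (deriv ^^ j) f field_differentiable at x" "convex_on UNIV ((deriv ^^ 2) f)"
       "\<forall>j<3. ((deriv ^^ j) f \<longlongrightarrow> 0) at_bot"
      using assms by (auto simp: H_plus_def)
    show "((deriv ^^ 0) f) field_differentiable at x" "((deriv ^^ Suc 0) f) field_differentiable at x" "convex_on UNIV ((deriv ^^ 2) f)"
      using *(1)[rule_format, of 0] *(1)[rule_format, of 1] *(2) by simp_all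
    from *(3)[rule_format, of 0] *(3)[rule_format, of 1] *(3)[rule_format, of 2]
    show "(f \<longlongrightarrow> 0) at_bot" "(deriv f \<longlongrightarrow> 0) at_bot" "((deriv ^^ 2) f \<longlongrightarrow> 0) at_bot" by simp_all
  qed
  have d1: "(f has_real_derivative deriv f x) (at x)" for x
    using d(1)[of x] by (simp add: field_differentiable_derivI)
  have d2: "(deriv f has_real_derivative (deriv ^^ 2) f x) (at x)" for x
    using d(2)[of x] by (simp add: field_differentiable_derivI numeral_2_eq_2)
  have m2: "mono ((deriv ^^ 2) f)" using convex_tendsto_at_bot_mono c lims by blast
  have n2: "0 \<le> (deriv ^^ 2) f x" for x using nonneg_of_mono_at_bot[OF m2 lims(3)] .
  have "mono (deriv f)"
  proof (rule monoI)
    fix x y :: real assume "x \<le> y"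
    then show "deriv f x \<le> deriv f y" by (rule DERIV_nonneg_imp_nondecreasing) (use d2 n2 in blast)
  qed
  then have n1: "0 \<le> deriv f x" for x using nonneg_of_mono_at_bot lims(2) by blast
  have "0 \<le> f x" for x using H_plus_nonneg[OF assms] by simp
  then show ?thesis using that[of "deriv f" "(deriv ^^ 2) f"] d1 d2 c m2 n1 n2 by blast
qed

lemma H_plus_3_measurable:
  assumes "f \<in> H_plus 3" shows "f \<in> borel_measurable borel"
proof -
  obtain f' where "\<And>x. (f has_real_derivative f' x) (at x)" using H_plus_3_derivs[OF assms] by metis
  then have "continuous_on UNIV f" by (intro DERIV_continuous_on) (auto intro: has_field_derivative_at_within)
  then show ?thesis by (rule borel_measurable_continuous_onI)
qed

text \<open>Interpolation by chords on a grid finer than the modulus of uniform continuity. On each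
  cell both \<open>h\<close> and its chord lie between the values of \<open>h\<close> at the two
  ends, so the error is at most the oscillation of \<open>h\<close> there.\<close>

lemma convex_mono_piecewise_linear_approx:
  fixes h :: "real \<Rightarrow> real"
  assumes conv: "convex_on UNIV h" and mono: "mono h" and AB: "A < B" and e: "0 < e"
  obtains n :: nat and t d :: "nat \<Rightarrow> real" where "\<And>k. 0 \<le> d k" "\<And>k. A \<le> t k"
    "\<And>x. A \<le> x \<Longrightarrow> x \<le> B \<Longrightarrow> \<bar>h A + (\<Sum>k<n. d k * max 0 (x - t k)) - h x\<bar> \<le> e"
proof -
  have "continuous_on UNIV h" using convex_on_continuous[OF open_UNIV conv] .
  then have "uniformly_continuous_on {A..B} h"
    by (intro compact_uniformly_continuous) (auto intro: continuous_on_subset)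
  then obtain r where r: "0 < r" "\<And>x y. x \<in> {A..B} \<Longrightarrow> y \<in> {A..B} \<Longrightarrow> dist y x < r \<Longrightarrow> dist (h y) (h x) < e"
    using e unfolding uniformly_continuous_on_def by meson
  obtain n :: nat where n: "(B - A) / r < real n" using reals_Archimedean2 by blast
  have "0 < (B - A) / r" using AB r by simp
  then have n0: "0 < n" using n by (cases n) auto
  define \<delta> where "\<delta> = (B - A) / n"
  have \<delta>: "0 < \<delta>" "\<delta> < r" unfolding \<delta>_def using AB n n0 r by (auto simp: field_simps)
  define t where "t = (\<lambda>k::nat. A + k * \<delta>)"
  have tS: "t (Suc k) = t k + \<delta>" for k unfolding t_def by (simp add: algebra_simps)
  have t0: "t 0 = A" "t n = B" unfolding t_def \<delta>_def using n0 by auto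
  have tmono: "mono t" unfolding t_def using \<delta> by (intro monoI) (auto intro!: mult_right_mono)
  define m where "m = (\<lambda>k. (h (t (Suc k)) - h (t k)) / \<delta>)"
  \<comment> \<open>The first coefficient is the first chord slope, nonnegative by monotonicity; the
    later ones are increments of the slopes, nonnegative by convexity. The first knot is
    \<open>A\<close> itself, so no separate linear term appears.\<close>
  define d where "d = (\<lambda>k. case k of 0 \<Rightarrow> m 0 | Suc j \<Rightarrow> m (Suc j) - m j)"
  have d0: "0 \<le> d k" for k
  proof (cases k)
    case 0
    have "h (t 0) \<le> h (t 1)" using mono tmono by (simp add: monoD)
    then show ?thesis unfolding 0 d_def m_def using \<delta> by simp
  next
    case (Suc j)
    have "h ((1 - 1/2) *\<^sub>R t j + (1/2) *\<^sub>R t (Suc (Suc j))) \<le> (1 - 1/2) * h (t j) + (1/2) * h (t (Suc (Suc j)))"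
      by (rule convex_onD[OF conv]) auto
    moreover have "(1 - 1/2) *\<^sub>R t j + (1/2) *\<^sub>R t (Suc (Suc j)) = t (Suc j)" by (simp add: tS field_simps)
    ultimately have "h (t (Suc j)) - h (t j) \<le> h (t (Suc (Suc j))) - h (t (Suc j))" by (simp add: field_simps)
    then show ?thesis unfolding Suc d_def m_def using \<delta> by (simp add: divide_right_mono)
  qed
  have chord: "h A + (\<Sum>k\<le>j. d k * (x - t k)) = h (t j) + m j * (x - t j)" for j x
  proof (induction j)
    case 0
    then show ?case by (simp add: d_def t0)
  next
    case (Suc j)
    have "h (t (Suc j)) = h (t j) + m j * \<delta>" unfolding m_def using \<delta> by simp
    then show ?case using Suc by (simp add: d_def tS algebra_simps)
  qed
  have cell: "\<exists>j<k. t j \<le> x \<and> x \<le> t (Suc j)" if "A \<le> x" "x \<le> t k" "0 < k" for x k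
    using that
  proof (induction k)
    case (Suc k)
    show ?case
    proof (cases "t k \<le> x")
      case False
      then have "0 < k" using Suc.prems t0 by (cases k) auto
      then show ?thesis using Suc False by (meson less_SucI nle_le)
    qed (use Suc in auto)
  qed simp
  have tA: "A \<le> t k" for k unfolding t_def using \<delta> by simp
  show ?thesis
  proof (rule that[where n = n and t = t and d = d, OF d0 tA])
    fix x assume x: "A \<le> x" "x \<le> B"
    then obtain j where j: "j < n" "t j \<le> x" "x \<le> t (Suc j)" using cell[of x n] n0 t0 by auto
    have "(\<Sum>k<n. d k * max 0 (x - t k)) = (\<Sum>k\<le>j. d k * (x - t k))"
    proof (rule sum.mono_neutral_cong_right)
      show "\<forall>k\<in>{..<n} - {..j}. d k * max 0 (x - t k) = 0"
      proof
        fix k assume "k \<in> {..<n} - {..j}"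
        then have "t (Suc j) \<le> t k" using tmono by (intro monoD[OF tmono]) auto
        then show "d k * max 0 (x - t k) = 0" using j by (simp add: max_def)
      qed
      show "d k * max 0 (x - t k) = d k * (x - t k)" if "k \<in> {..j}" for k
      proof -
        have "t k \<le> t j" using that by (intro monoD[OF tmono]) auto
        then show ?thesis using j by (simp add: max_def)
      qed
    qed (use j in auto)
    then have eq: "h A + (\<Sum>k<n. d k * max 0 (x - t k)) = h (t j) + m j * (x - t j)" using chord by simp
    have hm: "h (t j) \<le> h x" "h x \<le> h (t (Suc j))" using mono j by (auto simp: monoD)
    then have m0: "0 \<le> m j" unfolding m_def using \<delta> by simp
    have "m j * (x - t j) \<le> m j * \<delta>" using j tS by (intro mult_left_mono m0) auto
    also have "m j * \<delta> = h (t (Suc j)) - h (t j)" unfolding m_def using \<delta> by simp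
    finally have up: "m j * (x - t j) \<le> h (t (Suc j)) - h (t j)" .
    have lo: "0 \<le> m j * (x - t j)" using m0 j by simp
    have tj: "t j \<in> {A..B}" "t (Suc j) \<in> {A..B}"
      using monoD[OF tmono, of 0 j] monoD[OF tmono, of "j" n] monoD[OF tmono, of 0 "Suc j"] monoD[OF tmono, of "Suc j" n] j t0 by auto
    have "dist (h (t (Suc j))) (h (t j)) < e" using tj \<delta> by (intro r) (auto simp: dist_real_def tS)
    then have "h (t (Suc j)) - h (t j) < e" by (simp add: dist_real_def)
    then show "\<bar>h A + (\<Sum>k<n. d k * max 0 (x - t k)) - h x\<bar> \<le> e" unfolding eq using up lo hm by linarith
  qed
qed


text \<open>The second derivative of \<open>f\<close> is convex and nondecreasing, so it is
  approximated by hinges with nonnegative coefficients, and these are integrated twice from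
  \<open>A\<close>. Hinges become truncated cubes, and the initial values \<open>f A\<close>,
  \<open>f' A\<close> and \<open>h A\<close> at \<open>A\<close>, all nonnegative, give the
  quadratic part. Approximation on a bounded interval is enough because two-point sums are
  bounded.\<close>

lemma H_plus_3_cone_approx:
  assumes f: "f \<in> H_plus 3" and AB: "A < B" and e: "0 < e"
  obtains n :: nat and t d :: "nat \<Rightarrow> real" and a b c :: real
  where "0 \<le> a" "0 \<le> b" "0 \<le> c" "\<And>k. 0 \<le> d k"
    "\<And>x. A \<le> x \<Longrightarrow> x \<le> B \<Longrightarrow>
       \<bar>a + b * (x - A) + c * (x - A)\<^sup>2 + (\<Sum>k<n. d k * (max 0 (x - t k)) ^ 3) - f x\<bar> \<le> e"
proof -
  obtain f' h where fd: "\<And>x. (f has_real_derivative f' x) (at x)" and fd': "\<And>x. (f' has_real_derivative h x) (at x)"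
    and h: "convex_on UNIV h" "mono h" and nn: "\<And>x. 0 \<le> f x" "\<And>x. 0 \<le> f' x" "\<And>x. 0 \<le> h x"
    using H_plus_3_derivs[OF f] by metis
  \<comment> \<open>Each of the two integrations costs a factor \<open>B - A\<close> in the
    error.\<close>
  define \<epsilon> where "\<epsilon> = e / (B - A)\<^sup>2"
  have \<epsilon>: "0 < \<epsilon>" unfolding \<epsilon>_def using AB e by simp
  obtain n :: nat and t d :: "nat \<Rightarrow> real" where d: "\<And>k. 0 \<le> d k" and tA: "\<And>k. A \<le> t k"
    and ap: "\<And>x. A \<le> x \<Longrightarrow> x \<le> B \<Longrightarrow> \<bar>h A + (\<Sum>k<n. d k * max 0 (x - t k)) - h x\<bar> \<le> \<epsilon>"
    using convex_mono_piecewise_linear_approx[OF h AB \<epsilon>] by metis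
  define E2 where "E2 x = h A + (\<Sum>k<n. d k * max 0 (x - t k)) - h x" for x
  define E1 where "E1 = (\<lambda>x. f' A + h A * (x - A) + (\<Sum>k<n. d k / 2 * (max 0 (x - t k))\<^sup>2) - f' x)"
  define E0 where "E0 = (\<lambda>x. f A + f' A * (x - A) + h A / 2 * (x - A)\<^sup>2 + (\<Sum>k<n. d k / 6 * (max 0 (x - t k)) ^ 3) - f x)"
  have D1: "(E1 has_real_derivative E2 x) (at x)" for x
    unfolding E1_def E2_def
    by (rule derivative_eq_intros fd' DERIV_sum DERIV_cmult pos_part_square_deriv refl | simp)+
  have D0: "(E0 has_real_derivative E1 x) (at x)" for x
    unfolding E0_def E1_def
    by (rule derivative_eq_intros fd DERIV_sum DERIV_cmult pos_part_cube_deriv refl | simp)+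
  have zero: "E1 A = 0" "E0 A = 0"
    unfolding E1_def E0_def using tA by simp_all
  have b1: "\<bar>E1 x\<bar> \<le> \<epsilon> * (B - A)" if x: "A \<le> x" "x \<le> B" for x
  proof -
    have "norm (E1 x - E1 A) \<le> \<epsilon> * norm (x - A)"
      by (rule field_differentiable_bound[of "{A..B}" E1 E2])
         (use x ap[folded E2_def] in \<open>auto intro: has_field_derivative_at_within D1\<close>)
    also have "\<dots> \<le> \<epsilon> * (B - A)" using x \<epsilon> by (intro mult_left_mono) auto
    finally show ?thesis by (simp add: zero)
  qed
  have b0: "\<bar>E0 x\<bar> \<le> e" if x: "A \<le> x" "x \<le> B" for x
  proof -
    have "norm (E0 x - E0 A) \<le> \<epsilon> * (B - A) * norm (x - A)"
      by (rule field_differentiable_bound[of "{A..B}" E0 E1])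
         (use x b1 in \<open>auto intro: has_field_derivative_at_within D0\<close>)
    also have "\<dots> \<le> \<epsilon> * (B - A) * (B - A)" using x \<epsilon> AB by (intro mult_left_mono) auto
    also have "\<dots> = e" unfolding \<epsilon>_def using AB by (simp add: power2_eq_square)
    finally show ?thesis by (simp add: zero)
  qed
  show ?thesis
  proof (rule that[where n = n and t = t and d = "\<lambda>k. d k / 6" and a = "f A" and b = "f' A" and c = "h A / 2"])
    show "\<bar>f A + f' A * (x - A) + h A / 2 * (x - A)\<^sup>2 + (\<Sum>k<n. d k / 6 * max 0 (x - t k) ^ 3) - f x\<bar> \<le> e"
      if "A \<le> x" "x \<le> B" for x using b0[OF that] unfolding E0_def by simp
  qed (use nn d in auto)
qed

lemma two_point_expectation_mono_bounded:
  assumes "finite I" "\<And>i. i \<in> I \<Longrightarrow> 0 \<le> \<alpha> i" "\<And>i. i \<in> I \<Longrightarrow> \<alpha> i \<le> 1"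
    and "\<And>s. \<bar>s\<bar> \<le> (\<Sum>i\<in>I. \<bar>x i\<bar> + \<bar>y i\<bar>) \<Longrightarrow> \<phi> s \<le> \<psi> s"
  shows "two_point_expectation I \<alpha> x y \<phi> \<le> two_point_expectation I \<alpha> x y \<psi>"
  unfolding two_point_expectation_def
proof (intro sum_mono mult_left_mono prod_nonneg)
  fix A
  have "\<bar>\<Sum>i\<in>I. if i \<in> A then x i else y i\<bar> \<le> (\<Sum>i\<in>I. \<bar>if i \<in> A then x i else y i\<bar>)" by (rule sum_abs)
  also have "\<dots> \<le> (\<Sum>i\<in>I. \<bar>x i\<bar> + \<bar>y i\<bar>)" by (intro sum_mono) auto
  finally show "\<phi> (\<Sum>i\<in>I. if i \<in> A then x i else y i) \<le> \<psi> (\<Sum>i\<in>I. if i \<in> A then x i else y i)" by (rule assms(4))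
qed (use assms in auto)

lemma two_point_expectation_sum:
  "two_point_expectation I \<alpha> x y (\<lambda>s. \<Sum>k\<in>K. \<phi> k s) = (\<Sum>k\<in>K. two_point_expectation I \<alpha> x y (\<phi> k))"
  unfolding two_point_expectation_def by (simp only: sum_distrib_left) (rule sum.swap)

text \<open>The approximant is a combination with nonnegative coefficients. Its constant and linear
  parts have equal means on both sides because all summands are centred, so the hypotheses on
  squares and cubes carry the comparison, up to an arbitrary \<open>e\<close>.\<close>

lemma two_point_expectation_le_H_plus_3:
  assumes I: "finite I" and \<alpha>: "\<And>i. i \<in> I \<Longrightarrow> 0 \<le> \<alpha> i" "\<And>i. i \<in> I \<Longrightarrow> \<alpha> i \<le> 1"
    and \<alpha>': "\<And>i. i \<in> I \<Longrightarrow> 0 \<le> \<alpha>' i" "\<And>i. i \<in> I \<Longrightarrow> \<alpha>' i \<le> 1"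
    and mean: "\<And>i. i \<in> I \<Longrightarrow> \<alpha> i * x i + (1 - \<alpha> i) * y i = 0"
      "\<And>i. i \<in> I \<Longrightarrow> \<alpha>' i * x' i + (1 - \<alpha>' i) * y' i = 0"
    and square: "\<And>t. two_point_expectation I \<alpha> x y (\<lambda>s. (s - t)\<^sup>2) \<le> two_point_expectation I \<alpha>' x' y' (\<lambda>s. (s - t)\<^sup>2)"
    and cube: "\<And>t. two_point_expectation I \<alpha> x y (\<lambda>s. (max 0 (s - t)) ^ 3) \<le> two_point_expectation I \<alpha>' x' y' (\<lambda>s. (max 0 (s - t)) ^ 3)"
    and f: "f \<in> H_plus 3"
  shows "two_point_expectation I \<alpha> x y f \<le> two_point_expectation I \<alpha>' x' y' f"
proof (rule field_le_epsilon)
  let ?L = "two_point_expectation I \<alpha> x y" and ?R = "two_point_expectation I \<alpha>' x' y'"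
  fix e :: real assume e: "0 < e"
  \<comment> \<open>\<open>K\<close> bounds both sums; the added 1 keeps the interval nondegenerate
    when all values are 0.\<close>
  define K where "K = 1 + (\<Sum>i\<in>I. \<bar>x i\<bar> + \<bar>y i\<bar>) + (\<Sum>i\<in>I. \<bar>x' i\<bar> + \<bar>y' i\<bar>)"
  have sums: "0 \<le> (\<Sum>i\<in>I. \<bar>x i\<bar> + \<bar>y i\<bar>)" "0 \<le> (\<Sum>i\<in>I. \<bar>x' i\<bar> + \<bar>y' i\<bar>)" by (auto intro: sum_nonneg)
  then have K: "- K < K" "(\<Sum>i\<in>I. \<bar>x i\<bar> + \<bar>y i\<bar>) \<le> K" "(\<Sum>i\<in>I. \<bar>x' i\<bar> + \<bar>y' i\<bar>) \<le> K" unfolding K_def by auto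
  obtain n :: nat and t d :: "nat \<Rightarrow> real" and a b c :: real
    where nn: "0 \<le> a" "0 \<le> b" "0 \<le> c" "\<And>k. 0 \<le> d k"
    and ap: "\<And>x. - K \<le> x \<Longrightarrow> x \<le> K \<Longrightarrow>
       \<bar>a + b * (x - (- K)) + c * (x - (- K))\<^sup>2 + (\<Sum>k<n. d k * (max 0 (x - t k)) ^ 3) - f x\<bar> \<le> e / 2"
    by (rule H_plus_3_cone_approx[OF f K(1) half_gt_zero[OF e]]) (rule that, assumption+)
  define F where "F = (\<lambda>x. a + b * (x - (- K)) + c * (x - (- K))\<^sup>2 + (\<Sum>k<n. d k * (max 0 (x - t k)) ^ 3))"
  have exp_F: "two_point_expectation I \<alpha> x y F
      = a + b * K + c * two_point_expectation I \<alpha> x y (\<lambda>s. (s - (- K))\<^sup>2)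
        + (\<Sum>k<n. d k * two_point_expectation I \<alpha> x y (\<lambda>s. (max 0 (s - t k)) ^ 3))"
    if "\<And>i. i \<in> I \<Longrightarrow> \<alpha> i * x i + (1 - \<alpha> i) * y i = 0" for \<alpha> x y
    unfolding F_def two_point_expectation_add two_point_expectation_cmult two_point_expectation_sum two_point_expectation_const[OF I]
    using two_point_expectation_linear[OF I that, where b = K] by (simp add: add.commute)
  have "?L f \<le> ?L (\<lambda>s. F s + e / 2)"
  proof (rule two_point_expectation_mono_bounded[OF I \<alpha>])
    fix s assume "\<bar>s\<bar> \<le> (\<Sum>i\<in>I. \<bar>x i\<bar> + \<bar>y i\<bar>)"
    then show "f s \<le> F s + e / 2" using ap[of s] K unfolding F_def by linarith
  qed
  also have "\<dots> = ?L F + e / 2" by (simp add: two_point_expectation_add two_point_expectation_const[OF I])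
  also have "?L F \<le> ?R F"
    unfolding exp_F[of \<alpha> x y, OF mean(1), simplified] exp_F[of \<alpha>' x' y', OF mean(2), simplified] using nn square cube square[of "- K"]
    by (intro add_mono sum_mono mult_left_mono order_refl) auto
  also have "?R F \<le> ?R (\<lambda>s. f s + e / 2)"
  proof (rule two_point_expectation_mono_bounded[OF I \<alpha>'])
    fix s assume "\<bar>s\<bar> \<le> (\<Sum>i\<in>I. \<bar>x' i\<bar> + \<bar>y' i\<bar>)"
    then show "F s \<le> f s + e / 2" using ap[of s] K unfolding F_def by linarith
  qed
  also have "\<dots> = ?R f + e / 2" by (simp add: two_point_expectation_add two_point_expectation_const[OF I])
  finally show "?L f \<le> ?R f + e" by simp
qed

theorem self_normalized_two_point_le_bernoulli:
  fixes p l :: real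
  assumes p: "0 < p" "p < 1" and l: "lambda_star p \<le> l" and I: "finite I" "I \<noteq> {}"
    and xy: "\<And>i. i \<in> I \<Longrightarrow> (x i = 0 \<and> y i = 0) \<or> (0 < x i \<and> y i < 0 \<and> x i / (- y i) \<le> (1 - p) / p)"
    and f: "f \<in> H_plus 3"
  defines "D \<equiv> (\<Sum>i\<in>I. (x i * - y i) powr l) powr (1 / (2 * l))"
    and "w \<equiv> (1 / card I) powr (1 / (2 * l))" and "v \<equiv> sqrt ((1 - p) / p)"
  shows "two_point_expectation I (\<lambda>i. - y i / (x i - y i)) (\<lambda>i. x i / D) (\<lambda>i. y i / D) f
     \<le> two_point_expectation I (\<lambda>_. p) (\<lambda>_. w * v) (\<lambda>_. - w / v) f"
proof (rule two_point_expectation_le_H_plus_3[OF I(1) _ _ _ _ _ _ _ _ f])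
  fix t
  interpret C: comparison_function p l "\<lambda>x. (x - t)\<^sup>2" "\<lambda>x. 2 * (x - t)"
    by (rule comparison_function_square[OF p l])
  show "two_point_expectation I (\<lambda>i. - y i / (x i - y i)) (\<lambda>i. x i / D) (\<lambda>i. y i / D) (\<lambda>s. (s - t)\<^sup>2)
      \<le> two_point_expectation I (\<lambda>_. p) (\<lambda>_. w * v) (\<lambda>_. - w / v) (\<lambda>s. (s - t)\<^sup>2)"
    using C.self_normalized_two_point_le[OF I, of x y] xy
    unfolding C.bernoulli_mean_def C.V_def D_def w_def C.\<kappa>_def v_def by simp
next
  fix t
  interpret C: comparison_function p l "\<lambda>x. (max 0 (x - t)) ^ 3" "\<lambda>x. 3 * (max 0 (x - t))\<^sup>2"
    by (rule comparison_function_cube[OF p l])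
  show "two_point_expectation I (\<lambda>i. - y i / (x i - y i)) (\<lambda>i. x i / D) (\<lambda>i. y i / D) (\<lambda>s. (max 0 (s - t)) ^ 3)
      \<le> two_point_expectation I (\<lambda>_. p) (\<lambda>_. w * v) (\<lambda>_. - w / v) (\<lambda>s. (max 0 (s - t)) ^ 3)"
    using C.self_normalized_two_point_le[OF I, of x y] xy
    unfolding C.bernoulli_mean_def C.V_def D_def w_def C.\<kappa>_def v_def by simp
next
  fix i assume i: "i \<in> I"
  show "0 \<le> - y i / (x i - y i)" "- y i / (x i - y i) \<le> 1"
    using xy[OF i] by (auto simp: field_simps)
  show "- y i / (x i - y i) * (x i / D) + (1 - - y i / (x i - y i)) * (y i / D) = 0"
  proof (cases "x i = 0")
    case False
    then have "x i - y i > 0" using xy[OF i] by auto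
    then have "- y i / (x i - y i) * x i + (1 - - y i / (x i - y i)) * y i = 0"
      by (simp add: field_simps)
    then have "(- y i / (x i - y i) * x i + (1 - - y i / (x i - y i)) * y i) / D = 0" by simp
    moreover have "\<alpha> * (x i / D) + \<beta> * (y i / D) = (\<alpha> * x i + \<beta> * y i) / D" for \<alpha> \<beta> :: real
      by (simp add: add_divide_distrib)
    ultimately show ?thesis by metis
  qed (use xy[OF i] in auto)
  interpret C: comparison_function p l "\<lambda>x. (x - 0)\<^sup>2" "\<lambda>x. 2 * (x - 0)"
    by (rule comparison_function_square[OF p l])
  have "p * v = (1 - p) / v" using C.pV unfolding C.V_def v_def .
  moreover have "p * (w * v) + (1 - p) * (- w / v) = w * (p * v - (1 - p) / v)" by (simp add: algebra_simps)
  ultimately show "p * (w * v) + (1 - p) * (- w / v) = 0" by simp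
qed (use p in auto)

subsection \<open>Quantiles and the reciprocal\<close>

abbreviation unit_uniform :: "real measure" where
  "unit_uniform \<equiv> uniform_measure lborel {0..1}"

lemma prob_space_unit_uniform: "prob_space unit_uniform"
  by (rule prob_space_uniform_measure) auto

lemma emeasure_unit_uniform_atMost:
  assumes "0 \<le> c" "c \<le> 1" shows "emeasure unit_uniform {..c} = ennreal c"
proof -
  have "{0..1} \<inter> {..c} = {0..c}" using assms by auto
  then show ?thesis using assms by (simp add: divide_ennreal[of _ 1, simplified])
qed

lemma AE_unit_uniform: "AE u in unit_uniform. 0 < u \<and> u \<le> 1"
proof -
  have "AE u in lborel. u \<noteq> (0::real)" by (rule AE_lborel_singleton)
  then have "AE u::real in lborel. u \<in> {0..1} \<longrightarrow> 0 < u \<and> u \<le> 1" by eventually_elim auto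
  then show ?thesis by (intro AE_uniform_measureI) auto
qed

locale positive_finite_measure = finite_borel_measure \<rho> for \<rho> :: "real measure" +
  assumes positive: "measure \<rho> {..0} = 0"
begin

lemmas [measurable_cong] = M_is_borel

definition "mass = measure \<rho> (space \<rho>)"
text \<open>The left-continuous generalized inverse of the distribution function on the range
  \<open>0 < h < mass\<close>. The value 0 from \<open>mass\<close> on is a default that keeps the
  function total and real valued.\<close>

definition "quantile h = (if h < mass then Inf {x. 0 \<le> x \<and> h \<le> cdf \<rho> x} else 0)"
text \<open>The distributional transform: a jump of the distribution function is spread out by the
  second coordinate, later uniform on [0,1], which compensates for atoms.\<close>

definition "randomized_cdf z = measure \<rho> {..<fst z} + snd z * measure \<rho> {fst z}"

lemma cdf_split: "cdf \<rho> x = measure \<rho> {..<x} + measure \<rho> {x}"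
proof -
  have "{..x} = {..<x} \<union> {x}" by auto
  then show ?thesis unfolding cdf_def by (metis Int_insert_right_if0 finite_measure_Union inf_bot_right lessThan_iff less_irrefl
        sets_M borel_closed borel_open closed_singleton open_lessThan)
qed

lemma cdf_neg: "x \<le> 0 \<Longrightarrow> cdf \<rho> x = 0"
  using cdf_nondecreasing[of x 0] cdf_nonneg[of x] positive cdf_def2[of \<rho> 0] by linarith

lemma measure_lessThan_mono: "x \<le> y \<Longrightarrow> measure \<rho> {..<x} \<le> measure \<rho> {..<y}"
  by (intro finite_measure_mono) (auto simp: sets_M)

lemma cdf_le_lessThan: "x < y \<Longrightarrow> cdf \<rho> x \<le> measure \<rho> {..<y}"
  unfolding cdf_def by (intro finite_measure_mono) (auto simp: sets_M)

lemma exists_cdf_ge: "h < mass \<Longrightarrow> \<exists>x\<ge>0. h \<le> cdf \<rho> x"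
proof -
  assume "h < mass"
  then have "\<forall>\<^sub>F x in at_top. h < cdf \<rho> x"
    using order_tendstoD(1)[OF cdf_lim_at_top] unfolding mass_def by blast
  moreover have "\<forall>\<^sub>F x::real in at_top. 0 \<le> x" by (rule eventually_ge_at_top)
  ultimately have "\<forall>\<^sub>F x in at_top. 0 \<le> x \<and> h \<le> cdf \<rho> x" by eventually_elim auto
  then show ?thesis using eventually_happens by force
qed

text \<open>Right-continuity of the distribution function makes the infimum attained, so quantile
  and distribution function form a Galois connection.\<close>

lemma quantile_le_iff:
  assumes h: "h < mass" and y: "0 \<le> y"
  shows "quantile h \<le> y \<longleftrightarrow> h \<le> cdf \<rho> y"
proof -
  let ?S = "{x. 0 \<le> x \<and> h \<le> cdf \<rho> x}"
  have eq: "quantile h = Inf ?S" using h by (simp add: quantile_def)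
  have ne: "?S \<noteq> {}" using exists_cdf_ge[OF h] by auto
  have bdd: "bdd_below ?S" by (rule bdd_belowI[of _ 0]) auto
  have Q0: "h \<le> cdf \<rho> (quantile h)"
  proof (rule ccontr)
    assume "\<not> ?thesis"
    then have "cdf \<rho> (quantile h) < h" by simp
    moreover have "(cdf \<rho> \<longlongrightarrow> cdf \<rho> (quantile h)) (at_right (quantile h))"
      using cdf_is_right_cont by (simp add: continuous_within)
    ultimately have "\<forall>\<^sub>F x in at_right (quantile h). cdf \<rho> x < h" by (rule order_tendstoD(2)[rotated])
    then obtain b where b: "quantile h < b" "\<And>x. quantile h < x \<Longrightarrow> x < b \<Longrightarrow> cdf \<rho> x < h"
      unfolding eventually_at_right_field by auto
    obtain s where s: "s \<in> ?S" "s < b"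
      using b(1) cInf_less_iff[OF ne bdd] unfolding eq by auto
    have "quantile h \<le> s" unfolding eq by (rule cInf_lower[OF s(1) bdd])
    then show False
      using s b(2)[of s] \<open>cdf \<rho> (quantile h) < h\<close> by (cases "quantile h = s") auto
  qed
  show ?thesis
  proof
    assume "quantile h \<le> y"
    then show "h \<le> cdf \<rho> y" using Q0 cdf_nondecreasing order_trans by blast
  next
    assume "h \<le> cdf \<rho> y"
    then show "quantile h \<le> y" unfolding eq using y by (intro cInf_lower bdd) auto
  qed
qed

lemma quantile_nonneg: "0 \<le> quantile h"
  unfolding quantile_def using exists_cdf_ge by (auto intro!: cInf_greatest)

lemma measurable_quantile [measurable]: "quantile \<in> borel_measurable borel"
proof (rule borel_measurableI_le)
  fix y :: real
  show "{h \<in> space borel. quantile h \<le> y} \<in> sets borel"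
  proof (cases "0 \<le> y")
    case True
    have "{h \<in> space borel. quantile h \<le> y} = {mass..} \<union> ({..<mass} \<inter> {..cdf \<rho> y})"
      using quantile_le_iff[OF _ True] True by (auto simp: not_less) (auto simp: quantile_def)
    then show ?thesis by simp
  next
    case False
    then have "\<not> quantile h \<le> y" for h using quantile_nonneg[of h] by linarith
    then have "{h \<in> space borel. quantile h \<le> y} = {}" by simp
    then show ?thesis by simp
  qed
qed

lemma quantile_pos: "0 < h \<Longrightarrow> h < mass \<Longrightarrow> 0 < quantile h"
  using quantile_le_iff[of h 0] cdf_neg[of 0] quantile_nonneg[of h] by force

text \<open>The set is an interval starting at \<open>q\<close>. If it has a largest element it is a
  single null interval; otherwise it is covered by the countably many null intervals from
  \<open>q\<close> to its rational points.\<close>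

lemma null_flat: "emeasure \<rho> {x. q < x \<and> cdf \<rho> x = cdf \<rho> q} = 0"
proof -
  define N where "N = {x. q < x \<and> cdf \<rho> x = cdf \<rho> q}"
  have null: "{q<..x} \<in> null_sets \<rho>" if "x \<in> N" for x
  proof -
    have "emeasure \<rho> {q<..x} = ennreal (cdf \<rho> x - cdf \<rho> q)"
      using that by (intro emeasure_Ioc[THEN trans]) (auto simp: N_def)
    then show ?thesis using that by (auto simp: N_def sets_M)
  qed
  have between: "y \<in> N" if "q < y" "y \<le> x" "x \<in> N" for x y
    using that cdf_nondecreasing[of q y] cdf_nondecreasing[of y x] unfolding N_def by auto
  have "\<exists>C. C \<in> null_sets \<rho> \<and> N \<subseteq> C"
  proof (cases "\<exists>x\<in>N. \<forall>y\<in>N. y \<le> x")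
    case True
    then obtain x where "x \<in> N" "\<forall>y\<in>N. y \<le> x" by blast
    then show ?thesis using null by (intro exI[of _ "{q<..x}"]) (auto simp: N_def)
  next
    case False
    let ?C = "\<Union>r\<in>\<rat> \<inter> N. {q<..r}"
    have "?C \<in> null_sets \<rho>"
      using null by (intro null_sets_UN') (auto intro: countable_subset[OF _ countable_rat])
    moreover have "N \<subseteq> ?C"
    proof
      fix x assume x: "x \<in> N"
      then obtain y where y: "y \<in> N" "x < y" using False by (meson not_le)
      obtain r where r: "r \<in> \<rat>" "x < r" "r < y" using Rats_dense_in_real[OF y(2)] by blast
      then have "r \<in> N" using between[of r y] x y by (auto simp: N_def)
      then show "x \<in> ?C" using r x by (intro UN_I[of r]) (auto simp: N_def)
    qed
    ultimately show ?thesis by blast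
  qed
  then obtain C where C: "C \<in> null_sets \<rho>" "N \<subseteq> C" by blast
  then have "emeasure \<rho> N \<le> emeasure \<rho> C" by (intro emeasure_mono) (auto simp: null_setsD2)
  then show ?thesis using C unfolding N_def by (simp add: null_setsD1)
qed

lemma measurable_cdf [measurable]: "cdf \<rho> \<in> borel_measurable borel"
  by (intro borel_measurable_mono monoI cdf_nondecreasing)

lemma flat_sets [measurable]: "{x. q < x \<and> cdf \<rho> x = c} \<in> sets borel"
  by measurable

text \<open>Rational left endpoints are enough, because a nondegenerate stretch on which the
  distribution function is constant contains a rational point. This keeps the exceptional set a
  countable union of null sets.\<close>

lemma AE_not_flat: "AE x in \<rho>. \<forall>r\<in>\<rat>. \<not> (r < x \<and> cdf \<rho> x = cdf \<rho> r)"
proof (subst AE_ball_countable[OF countable_rat], intro ballI)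
  fix r :: real
  show "AE x in \<rho>. \<not> (r < x \<and> cdf \<rho> x = cdf \<rho> r)"
    by (rule AE_I[of _ _ "{x. r < x \<and> cdf \<rho> x = cdf \<rho> r}"]) (auto simp: null_flat sets_M)
qed

lemma AE_pos: "AE x in \<rho>. 0 < x"
  by (rule AE_I[of _ _ "{..0}"]) (use positive in \<open>auto simp: sets_M emeasure_eq_measure\<close>)

lemma measurable_lessThan_measure [measurable]: "(\<lambda>x. measure \<rho> {..<x}) \<in> borel_measurable borel"
  by (intro borel_measurable_mono monoI measure_lessThan_mono)

lemma measurable_point_measure [measurable]: "(\<lambda>x. measure \<rho> {x}) \<in> borel_measurable borel"
proof -
  have "(\<lambda>x. measure \<rho> {x}) = (\<lambda>x. cdf \<rho> x - measure \<rho> {..<x})" using cdf_split by auto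
  then show ?thesis by simp
qed

lemma measurable_randomized_cdf [measurable]: "randomized_cdf \<in> borel_measurable (borel \<Otimes>\<^sub>M borel)"
  unfolding randomized_cdf_def by measurable

lemma randomized_cdf_bounds:
  assumes "0 \<le> u" "u \<le> 1"
  shows "measure \<rho> {..<x} \<le> randomized_cdf (x, u)" "randomized_cdf (x, u) \<le> cdf \<rho> x"
  using assms mult_right_mono[of u 1 "measure \<rho> {x}"] unfolding randomized_cdf_def cdf_split by auto

abbreviation "\<rho>U \<equiv> \<rho> \<Otimes>\<^sub>M unit_uniform"

lemma sets_\<rho>U [measurable_cong]: "sets \<rho>U = sets (borel \<Otimes>\<^sub>M borel)"
  by (intro sets_pair_measure_cong) (auto simp: M_is_borel)

lemma measure_lessThan_quantile:
  assumes h: "0 \<le> h" "h < mass"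
  shows "measure \<rho> {..<quantile h} \<le> h"
proof -
  define x0 where "x0 = quantile h"
  have below: "cdf \<rho> x < h" if "x < x0" "0 \<le> x" for x
    using that quantile_le_iff[of h x] h unfolding x0_def by force
  have "measure \<rho> {..<x0} \<le> h"
  proof (cases "0 < x0")
    case True
    show ?thesis
    proof (rule tendsto_upperbound[OF cdf_at_left])
      have "\<forall>\<^sub>F x in at_left x0. x < x0" "\<forall>\<^sub>F x in at_left x0. 0 < x"
        using True by (auto simp: eventually_at_left_field)
      then show "\<forall>\<^sub>F x in at_left x0. cdf \<rho> x \<le> h" by eventually_elim (use below in force)
    qed simp
  next
    case False
    then have "measure \<rho> {..<x0} \<le> cdf \<rho> 0" unfolding cdf_def by (intro finite_measure_mono) (auto simp: sets_M)
    then show ?thesis using cdf_neg[of 0] h by simp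
  qed
  then show ?thesis unfolding x0_def .
qed

lemma AE_snd: "AE z in \<rho>U. 0 < snd z \<and> snd z \<le> 1"
proof -
  interpret U: prob_space unit_uniform by (rule prob_space_unit_uniform)
  interpret P: pair_sigma_finite \<rho> unit_uniform ..
  show ?thesis
  proof (rule P.AE_pair_measure)
    show "{z \<in> space \<rho>U. 0 < snd z \<and> snd z \<le> 1} \<in> sets \<rho>U" by measurable
  qed (use AE_unit_uniform in \<open>auto intro!: AE_I2\<close>)
qed

lemma AE_fst:
  assumes "AE x in \<rho>. P x" shows "AE z in \<rho>U. P (fst z)"
proof -
  interpret U: prob_space unit_uniform by (rule prob_space_unit_uniform)
  show ?thesis by (rule AE_distrD[of fst _ \<rho>], simp, subst U.distr_pair_fst, rule assms)
qed

lemma AE_randomized_cdf_bounds: "AE z in \<rho>U. 0 \<le> randomized_cdf z \<and> randomized_cdf z \<le> mass"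
  using AE_snd
proof eventually_elim
  case (elim z)
  obtain x u where z: "z = (x, u)" by (cases z)
  have "0 \<le> measure \<rho> {..<x}" by simp
  moreover have "cdf \<rho> x \<le> mass" unfolding mass_def by (rule cdf_bounded)
  ultimately show ?case using randomized_cdf_bounds[of u x] elim unfolding z snd_conv by linarith
qed

text \<open>For fixed \<open>x\<close> the section in \<open>u\<close> is all of [0,1] to the left
  of the quantile \<open>x0\<close> and at most \<open>{0}\<close> to its right; at
  \<open>x0\<close> it is the fraction \<open>c\<close> of the atom needed to reach the level
  \<open>h\<close>. If \<open>x0\<close> is no atom, division by 0 makes \<open>c\<close> equal to
  0, and the corresponding term lives on a null set.\<close>

lemma fiber_measure:
  assumes h: "0 \<le> h" "h < mass"
  defines "x0 \<equiv> quantile h"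
  defines "c \<equiv> (h - measure \<rho> {..<x0}) / measure \<rho> {x0}"
  shows "AE x in \<rho>. emeasure unit_uniform {u. randomized_cdf (x, u) \<le> h}
      = indicator {..<x0} x + indicator {x0} x * ennreal c"
proof -
  interpret U: prob_space unit_uniform by (rule prob_space_unit_uniform)
  have x0: "0 \<le> x0" "h \<le> cdf \<rho> x0" unfolding x0_def using quantile_nonneg quantile_le_iff h by auto
  have below: "cdf \<rho> x < h" if "x < x0" "0 \<le> x" for x
    using that quantile_le_iff[of h x] h unfolding x0_def by force
  have left: "measure \<rho> {..<x0} \<le> h" unfolding x0_def by (rule measure_lessThan_quantile[OF h])
  have flat: "AE x in \<rho>. \<not> (x0 < x \<and> cdf \<rho> x = cdf \<rho> x0)"
    by (rule AE_I[of _ _ "{x. x0 < x \<and> cdf \<rho> x = cdf \<rho> x0}"]) (auto simp: null_flat sets_M)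
  have atoms: "AE x in \<rho>. x = x0 \<longrightarrow> measure \<rho> {x0} > 0"
    by (cases "measure \<rho> {x0} > 0", simp,
        rule AE_I[of _ _ "{x0}"]) (auto simp: sets_M emeasure_eq_measure zero_less_measure_iff)
  have one: "emeasure unit_uniform A = 1" if "{0..1} \<subseteq> A" "A \<in> sets borel" for A
  proof -
    have "{0..1} \<inter> A = {0..1}" using that by auto
    then show ?thesis using that by simp
  qed
  have zero: "emeasure unit_uniform A = 0" if "{0..1} \<inter> A \<subseteq> {0}" "A \<in> sets borel" for A
  proof -
    have "emeasure lborel ({0..1} \<inter> A) \<le> emeasure lborel {0::real}" using that by (intro emeasure_mono) auto
    then show ?thesis using that by simp
  qed
  show ?thesis
    using flat atoms AE_pos
  proof eventually_elim
    case (elim x)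
    have meas: "{u. randomized_cdf (x, u) \<le> h} \<in> sets borel"
      unfolding randomized_cdf_def by measurable
    consider "x < x0" | "x = x0" | "x0 < x" by linarith
    then show ?case
    proof cases
      case 1
      then have "{0..1} \<subseteq> {u. randomized_cdf (x, u) \<le> h}"
        using below[of x] elim randomized_cdf_bounds[of _ x] by force
      then show ?thesis using 1 one[OF _ meas] by simp
    next
      case 2
      then have pos: "0 < measure \<rho> {x0}" using elim by simp
      have "{u. randomized_cdf (x, u) \<le> h} = {..c}"
        unfolding randomized_cdf_def c_def 2 using pos by (auto simp: field_simps)
      moreover have "0 \<le> c" "c \<le> 1"
        unfolding c_def using pos left x0(2) by (auto simp: field_simps cdf_split)
      ultimately show ?thesis using 2 emeasure_unit_uniform_atMost by simp
    next
      case 3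
      have le: "h \<le> measure \<rho> {..<x}" using cdf_le_lessThan[OF 3] x0(2) by simp
      \<comment> \<open>A positive \<open>u\<close> would force \<open>x\<close> to carry no mass
        while the distribution function is still \<open>h\<close> at \<open>x\<close>; then it would
        be constant from \<open>x0\<close> to \<open>x\<close>, which is excluded almost
        everywhere.\<close>
      have "{0..1} \<inter> {u. randomized_cdf (x, u) \<le> h} \<subseteq> {0}"
      proof
        fix u assume u: "u \<in> {0..1} \<inter> {u. randomized_cdf (x, u) \<le> h}"
        then have u01: "0 \<le> u" "u \<le> 1" and Wh: "measure \<rho> {..<x} + u * measure \<rho> {x} \<le> h"
          by (auto simp: randomized_cdf_def)
        have "0 \<le> u * measure \<rho> {x}" using u01 by simp
        then have eq: "measure \<rho> {..<x} = h" "u * measure \<rho> {x} = 0" using Wh le by linarith+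
        have "measure \<rho> {x} \<noteq> 0"
        proof
          assume "measure \<rho> {x} = 0"
          then have "cdf \<rho> x = h" using cdf_split eq by simp
          moreover have "cdf \<rho> x0 \<le> cdf \<rho> x" using 3 by (intro cdf_nondecreasing) auto
          ultimately show False using elim 3 x0(2) by auto
        qed
        then show "u \<in> {0}" using eq by simp
      qed
      then show ?thesis using 3 zero[OF _ meas] by simp
    qed
  qed
qed

lemma emeasure_randomized_cdf_le:
  assumes h: "0 \<le> h" "h < mass"
  shows "emeasure \<rho>U {z. randomized_cdf z \<le> h} = ennreal h"
proof -
  interpret U: prob_space unit_uniform by (rule prob_space_unit_uniform)
  define x0 where "x0 = quantile h"
  define c where "c = (h - measure \<rho> {..<x0}) / measure \<rho> {x0}"
  have x0: "0 \<le> x0" "h \<le> cdf \<rho> x0" unfolding x0_def using quantile_nonneg quantile_le_iff h by auto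
  have meas: "{z. randomized_cdf z \<le> h} \<in> sets \<rho>U"
  proof -
    have "{z \<in> space (borel \<Otimes>\<^sub>M borel). randomized_cdf z \<le> h} \<in> sets (borel \<Otimes>\<^sub>M borel)" by measurable
    then show ?thesis unfolding sets_\<rho>U by (simp add: space_pair_measure)
  qed
  have "emeasure \<rho>U {z. randomized_cdf z \<le> h}
     = (\<integral>\<^sup>+x. emeasure unit_uniform (Pair x -` {z. randomized_cdf z \<le> h}) \<partial>\<rho>)"
    by (rule U.emeasure_pair_measure_alt[OF meas])
  also have "\<dots> = (\<integral>\<^sup>+x. indicator {..<x0} x + indicator {x0} x * ennreal c \<partial>\<rho>)"
    using fiber_measure[OF h] unfolding x0_def c_def by (intro nn_integral_cong_AE) (auto simp: vimage_def)
  also have "\<dots> = emeasure \<rho> {..<x0} + ennreal c * emeasure \<rho> {x0}"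
    by (subst nn_integral_add) (auto simp: sets_M nn_integral_cmult mult.commute)
  also have "\<dots> = ennreal h"
  proof -
    have le: "measure \<rho> {..<x0} \<le> h" unfolding x0_def by (rule measure_lessThan_quantile[OF h])
    have "measure \<rho> {..<x0} + c * measure \<rho> {x0} = h"
    proof (cases "measure \<rho> {x0} = 0")
      case True
      then show ?thesis using le x0(2) cdf_split[of x0] by simp
    qed (simp add: c_def)
    moreover have "0 \<le> c" unfolding c_def using le by simp
    ultimately show ?thesis
      by (simp add: emeasure_eq_measure flip: ennreal_mult ennreal_plus)
  qed
  finally show ?thesis .
qed

text \<open>The transform is uniform: its distribution function is \<open>h\<close> on
  \<open>[0, mass)\<close>, by integrating \<open>fiber_measure\<close>. The atoms of the original
  measure leave no trace.\<close>

lemma distr_randomized_cdf: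
  "distr \<rho>U borel randomized_cdf = density lborel (indicator {0<..<mass})" (is "?L = ?R")
proof (rule cdf_unique')
  interpret U: prob_space unit_uniform by (rule prob_space_unit_uniform)
  interpret P: pair_sigma_finite \<rho> unit_uniform ..
  have meas: "randomized_cdf \<in> measurable \<rho>U borel" by measurable
  have mass0: "0 \<le> mass" unfolding mass_def by simp
  have total: "emeasure \<rho>U (space \<rho>U) = ennreal mass"
    unfolding space_pair_measure mass_def
    by (subst U.emeasure_pair_measure_Times) (auto simp: U.emeasure_space_1[simplified] emeasure_eq_measure)
  have finL: "finite_measure ?L"
    by (rule finite_measureI) (simp add: emeasure_distr[OF meas] vimage_def total[simplified])
  show L: "finite_borel_measure ?L"
    using finL by (simp add: finite_borel_measure_def finite_borel_measure_axioms_def)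
  have eR: "emeasure ?R A = emeasure lborel ({0<..<mass} \<inter> A)" if "A \<in> sets borel" for A
    using that by (simp add: emeasure_density Int_commute flip: indicator_inter_arith)
  have finR: "finite_measure ?R"
    by (rule finite_measureI) (simp add: eR mass0)
  show R: "finite_borel_measure ?R"
    using finR by (simp add: finite_borel_measure_def finite_borel_measure_axioms_def)
  show "cdf ?L = cdf ?R"
  proof
    fix h
    have eL: "emeasure ?L {..h} = emeasure \<rho>U {z \<in> space \<rho>U. randomized_cdf z \<le> h}"
      by (simp add: emeasure_distr[OF meas] vimage_def Int_def conj_commute)
    have sp: "space \<rho>U = UNIV" by (simp add: space_pair_measure borel_UNIV)
    consider "h < 0" | "0 \<le> h" "h < mass" | "mass \<le> h" by linarith
    then have "emeasure ?L {..h} = emeasure ?R {..h}"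
    proof cases
      case 1
      have "{0<..<mass} \<inter> {..h} = {}" using 1 by auto
      moreover have "emeasure \<rho>U {z \<in> space \<rho>U. randomized_cdf z \<le> h} = 0"
        by (rule emeasure_eq_0_AE) (use AE_randomized_cdf_bounds 1 in \<open>auto elim!: eventually_mono\<close>)
      ultimately show ?thesis unfolding eL by (simp add: eR)
    next
      case 2
      have "{0<..<mass} \<inter> {..h} = {0<..h}" using 2 by auto
      then show ?thesis unfolding eL sp using 2 emeasure_randomized_cdf_le by (simp add: eR)
    next
      case 3
      have "{0<..<mass} \<inter> {..h} = {0<..<mass}" using 3 by auto
      moreover have "emeasure \<rho>U {z \<in> space \<rho>U. randomized_cdf z \<le> h} = emeasure \<rho>U (space \<rho>U)"
      proof (rule emeasure_eq_AE)
        show "AE z in \<rho>U. z \<in> {z \<in> space \<rho>U. randomized_cdf z \<le> h} \<longleftrightarrow> z \<in> space \<rho>U"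
          using AE_randomized_cdf_bounds by eventually_elim (use 3 in auto)
        show "{z \<in> space \<rho>U. randomized_cdf z \<le> h} \<in> sets \<rho>U" by measurable
      qed (rule sets.top)
      ultimately show ?thesis unfolding eL total using mass0 by (simp add: eR)
    qed
    then show "cdf ?L h = cdf ?R h" unfolding cdf_def by (simp add: measure_def)
  qed
qed

lemma nn_integral_randomized_cdf:
  assumes [measurable]: "\<phi> \<in> borel_measurable borel"
  shows "(\<integral>\<^sup>+z. \<phi> (randomized_cdf z) \<partial>\<rho>U) = (\<integral>\<^sup>+h\<in>{0<..<mass}. \<phi> h \<partial>lborel)"
proof -
  have "(\<integral>\<^sup>+z. \<phi> (randomized_cdf z) \<partial>\<rho>U) = (\<integral>\<^sup>+h. \<phi> h \<partial>distr \<rho>U borel randomized_cdf)"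
    by (subst nn_integral_distr) auto
  then show ?thesis unfolding distr_randomized_cdf by (subst (asm) nn_integral_density) (auto simp: mult.commute)
qed

text \<open>The transform loses no information: the quantile recovers the original point almost
  everywhere. A smaller quantile would place a rational number at the left end of a flat stretch of
  the distribution function.\<close>

lemma AE_quantile_randomized_cdf:
  "AE z in \<rho>U. 0 < randomized_cdf z \<and> randomized_cdf z < mass \<and> quantile (randomized_cdf z) = fst z"
proof -
  interpret U: prob_space unit_uniform by (rule prob_space_unit_uniform)
  interpret P: pair_sigma_finite \<rho> unit_uniform ..
  have "AE h in distr \<rho>U borel randomized_cdf. 0 < h \<and> h < mass"
    unfolding distr_randomized_cdf by (subst AE_density) (auto simp: indicator_def)
  then have 1: "AE z in \<rho>U. 0 < randomized_cdf z \<and> randomized_cdf z < mass"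
    by (rule AE_distrD[rotated]) measurable
  have 2: "AE z in \<rho>U. (\<forall>r\<in>\<rat>. \<not> (r < fst z \<and> cdf \<rho> (fst z) = cdf \<rho> r)) \<and> 0 < fst z"
    using AE_fst[OF AE_not_flat] AE_fst[OF AE_pos] by eventually_elim blast
  show ?thesis
    using 1 2 AE_snd
  proof eventually_elim
    case (elim z)
    obtain x u where z: "z = (x, u)" by (cases z)
    note elim = elim[unfolded z fst_conv snd_conv]
    let ?w = "randomized_cdf (x, u)"
    have b: "measure \<rho> {..<x} \<le> ?w" "?w \<le> cdf \<rho> x" using randomized_cdf_bounds[of u x] elim by auto
    have le: "quantile ?w \<le> x" using quantile_le_iff[of ?w x] b elim by auto
    have "\<not> quantile ?w < x"
    proof
      assume lt: "quantile ?w < x"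
      define y where "y = quantile ?w"
      have y: "y < x" "0 \<le> y" "?w \<le> cdf \<rho> y"
        using lt quantile_le_iff[of ?w y] quantile_nonneg[of ?w] elim unfolding y_def by auto
      have e: "cdf \<rho> y = measure \<rho> {..<x}" "?w = measure \<rho> {..<x}" using y b cdf_le_lessThan[OF y(1)] by linarith+
      \<comment> \<open>As \<open>u > 0\<close> almost everywhere, \<open>x\<close> is not an atom,
        so the distribution function takes the same value at \<open>y\<close> and at
        \<open>x\<close>.\<close>
      then have "u * measure \<rho> {x} = 0" unfolding randomized_cdf_def by simp
      then have xy: "cdf \<rho> x = cdf \<rho> y" using cdf_split[of x] e elim by simp
      obtain r where r: "r \<in> \<rat>" "y < r" "r < x" using Rats_dense_in_real[OF y(1)] by blast
      then have "cdf \<rho> r = cdf \<rho> x"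
        using xy cdf_nondecreasing[of y r] cdf_nondecreasing[of r x] by simp
      then show False using elim r by force
    qed
    then show ?case using le elim z by simp
  qed
qed

end

section \<open>Size-biased measures, and the reciprocal as a quantile of a distributional
  transform\<close>

definition size_biased :: "real measure \<Rightarrow> real measure" where
  "size_biased \<nu> = density \<nu> (\<lambda>x. ennreal x)"

abbreviation reflect :: "real measure \<Rightarrow> real measure" where
  "reflect \<nu> \<equiv> distr \<nu> borel uminus"

locale integrable_distribution = real_distribution \<nu> for \<nu> :: "real measure" +
  assumes integrable: "integrable \<nu> (\<lambda>x. x)"
begin

lemma emeasure_size_biased:
  "A \<in> sets borel \<Longrightarrow> emeasure (size_biased \<nu>) A = (\<integral>\<^sup>+x. ennreal x * indicator A x \<partial>\<nu>)"
  unfolding size_biased_def by (subst emeasure_density) auto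

lemma emeasure_size_biased_UNIV: "emeasure (size_biased \<nu>) UNIV = (\<integral>\<^sup>+x. ennreal x \<partial>\<nu>)"
  by (simp add: emeasure_size_biased)

lemma nn_integral_finite: "(\<integral>\<^sup>+x. ennreal x \<partial>\<nu>) < \<infinity>"
proof -
  have "(\<integral>\<^sup>+x. ennreal x \<partial>\<nu>) \<le> (\<integral>\<^sup>+x. ennreal (norm x) \<partial>\<nu>)"
    by (intro nn_integral_mono ennreal_leI) auto
  also have "\<dots> < \<infinity>" using integrable by (simp add: integrable_iff_bounded)
  finally show ?thesis .
qed

sublocale P: positive_finite_measure "size_biased \<nu>"
proof (intro positive_finite_measure.intro positive_finite_measure_axioms.intro finite_borel_measure.intro
      finite_borel_measure_axioms.intro finite_measureI)
  show "sets (size_biased \<nu>) = sets borel" by (simp add: size_biased_def)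
  have sp: "space (size_biased \<nu>) = UNIV" by (simp add: size_biased_def)
  show "emeasure (size_biased \<nu>) (space (size_biased \<nu>)) \<noteq> \<infinity>"
    unfolding sp emeasure_size_biased_UNIV using nn_integral_finite by simp
  have "emeasure (size_biased \<nu>) {..0} = (\<integral>\<^sup>+x. 0 \<partial>\<nu>)"
    unfolding emeasure_size_biased[OF borel_closed[OF closed_atMost]]
    by (intro nn_integral_cong) (auto simp: indicator_def ennreal_neg)
  then show "measure (size_biased \<nu>) {..0} = 0" by (simp add: measure_def)
qed

text \<open>Since \<open>ennreal\<close> sends negative numbers to 0, \<open>size_biased\<close>
  weights by the positive part and is carried by the positive half line. Its distribution function
  is therefore \<open>G\<close> on \<open>[0, \<infinity>)\<close>.\<close>

lemma G_fun_nonneg: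
  assumes "0 \<le> x" shows "G_fun \<nu> (ereal x) = ereal (cdf (size_biased \<nu>) x)"
proof -
  have "(\<integral>\<^sup>+z\<in>{z. 0 < z \<and> ereal z \<le> ereal x}. ennreal z \<partial>\<nu>) = emeasure (size_biased \<nu>) {..x}"
    unfolding emeasure_size_biased[OF borel_closed[OF closed_atMost]]
    by (intro nn_integral_cong) (auto simp: indicator_def ennreal_neg)
  then show ?thesis using assms
    by (simp add: G_fun_def P.emeasure_eq_measure cdf_def)
qed

lemma x_plus_eq_quantile:
  assumes h: "0 < h" "h < P.mass"
  shows "x_plus \<nu> (ereal h) = ereal (P.quantile h)"
  unfolding x_plus_def
proof (rule antisym)
  show "Inf {x. 0 \<le> x \<and> ereal h \<le> G_fun \<nu> x} \<le> ereal (P.quantile h)"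
    using P.quantile_nonneg[of h] P.quantile_le_iff[OF h(2), of "P.quantile h"]
    by (intro Inf_lower) (auto simp: G_fun_nonneg)
  show "ereal (P.quantile h) \<le> Inf {x. 0 \<le> x \<and> ereal h \<le> G_fun \<nu> x}"
  proof (rule Inf_greatest)
    fix x assume x: "x \<in> {x. 0 \<le> x \<and> ereal h \<le> G_fun \<nu> x}"
    show "ereal (P.quantile h) \<le> x"
      using x P.quantile_le_iff[OF h(2)] by (cases x) (auto simp: G_fun_nonneg)
  qed
qed

lemma G_fun_at_left:
  assumes "0 < x"
  shows "(G_fun \<nu> \<longlongrightarrow> ereal (measure (size_biased \<nu>) {..<x})) (at_left (ereal x))"
  unfolding at_left_ereal tendsto_compose_filtermap[symmetric]
proof -
  have "((\<lambda>y. ereal (cdf (size_biased \<nu>) y)) \<longlongrightarrow> ereal (measure (size_biased \<nu>) {..<x})) (at_left x)"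
    using P.cdf_at_left by simp
  moreover have "\<forall>\<^sub>F y in at_left x. ereal (cdf (size_biased \<nu>) y) = (G_fun \<nu> \<circ> ereal) y"
  proof -
    have "\<forall>\<^sub>F y in at_left x. 0 < y" using assms by (auto simp: eventually_at_left_field)
    then show ?thesis by eventually_elim (simp add: G_fun_nonneg)
  qed
  ultimately show "((G_fun \<nu> \<circ> ereal) \<longlongrightarrow> ereal (measure (size_biased \<nu>) {..<x})) (at_left x)"
    using tendsto_cong by fastforce
qed

text \<open>The interpolation by \<open>u\<close> across a jump of \<open>G\<close> is the
  randomization of the distributional transform, so the reciprocal can be studied through
  quantiles.\<close>

lemma G_tilde_pos:
  assumes x: "0 < x"
  shows "G_tilde \<nu> (ereal x) u = ereal (P.randomized_cdf (x, u))"
proof -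
  have "Lim (at_left (ereal x)) (G_fun \<nu>) = ereal (measure (size_biased \<nu>) {..<x})"
    using G_fun_at_left[OF x] by (intro tendsto_Lim) (auto simp: at_left_ereal filtermap_bot_iff)
  then show ?thesis
    using x by (simp add: G_tilde_def G_fun_nonneg P.randomized_cdf_def P.cdf_split mult.commute)
qed

end

text \<open>The negative half of the law is handled through its reflection, so the quantile calculus
  is developed for positive measures alone.\<close>

lemma G_fun_reflect:
  assumes \<nu>: "sets \<nu> = sets borel" and x: "0 \<le> x"
  shows "G_fun \<nu> (- x) = G_fun (reflect \<nu>) x"
proof (cases "x = 0")
  case False
  then have x0: "0 < x" "\<not> 0 \<le> - x" using x by (auto simp: less_le ereal_uminus_le_reorder)
  have "(\<integral>\<^sup>+z\<in>{z. 0 < z \<and> ereal z \<le> x}. ennreal z \<partial>reflect \<nu>) =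
        (\<integral>\<^sup>+z. ennreal (- z) * indicator {z. 0 < z \<and> ereal z \<le> x} (- z) \<partial>\<nu>)"
    using \<nu> by (subst nn_integral_distr) (auto simp: measurable_cong_sets[OF \<nu> refl])
  also have "\<dots> = (\<integral>\<^sup>+z\<in>{z. - x \<le> ereal z \<and> z < 0}. ennreal (- z) \<partial>\<nu>)"
    by (intro nn_integral_cong) (auto simp: indicator_def ereal_uminus_le_reorder simp flip: uminus_ereal.simps)
  finally show ?thesis using x0 x by (simp add: G_fun_def)
qed (simp add: G_fun_def)

lemma x_minus_reflect:
  assumes \<nu>: "sets \<nu> = sets borel"
  shows "x_minus \<nu> h = - x_plus (reflect \<nu>) h"
proof -
  have "{x. x \<le> 0 \<and> h \<le> G_fun \<nu> x} = uminus ` {x. 0 \<le> x \<and> h \<le> G_fun (reflect \<nu>) x}"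
  proof (intro set_eqI iffI)
    fix x assume x: "x \<in> {x. x \<le> 0 \<and> h \<le> G_fun \<nu> x}"
    then have "0 \<le> - x" by (simp add: ereal_uminus_le_reorder)
    then have "- x \<in> {x. 0 \<le> x \<and> h \<le> G_fun (reflect \<nu>) x}"
      using x G_fun_reflect[OF \<nu>, of "- x"] by simp
    then show "x \<in> uminus ` {x. 0 \<le> x \<and> h \<le> G_fun (reflect \<nu>) x}" by (intro image_eqI[of _ _ "- x"]) auto
  next
    fix x assume "x \<in> uminus ` {x. 0 \<le> x \<and> h \<le> G_fun (reflect \<nu>) x}"
    then show "x \<in> {x. x \<le> 0 \<and> h \<le> G_fun \<nu> x}" using G_fun_reflect[OF \<nu>] by auto
  qed
  then show ?thesis unfolding x_minus_def x_plus_def by (simp add: ereal_Sup_uminus_image_eq)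
qed

lemma (in integrable_distribution) integrable_distribution_reflect: "integrable_distribution (reflect \<nu>)"
proof -
  have rd: "real_distribution (reflect \<nu>)" by (rule real_distribution_distr) simp
  have int: "integrable (reflect \<nu>) (\<lambda>x. x)"
  proof (rule integrable_distr_eq[THEN iffD2])
    show "integrable \<nu> (\<lambda>x. - x)" by (rule Bochner_Integration.integrable_minus[OF integrable])
  qed measurable
  show ?thesis by (rule integrable_distribution.intro[OF rd integrable_distribution_axioms.intro[OF int]])
qed

locale centered_distribution = integrable_distribution +
  assumes centered: "(\<integral>x. x \<partial>\<nu>) = 0"
begin

sublocale R: integrable_distribution "reflect \<nu>"
  by (rule integrable_distribution_reflect)

lemma sets_\<nu>: "sets \<nu> = sets borel" by simp

text \<open>Zero mean means \<open>E X^+ = E X^-\<close>. The two quantile functions therefore share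
  the parameter interval \<open>(0, mass)\<close>, and the value produced on one side lies in the
  domain of the other.\<close>

lemma mass_eq: "R.P.mass = P.mass"
proof -
  have sp: "space (size_biased M) = UNIV" if "sets M = sets borel" for M
    using sets_eq_imp_space_eq[OF that] by (simp add: size_biased_def)
  have "P.mass = enn2real (\<integral>\<^sup>+x. ennreal x \<partial>\<nu>)"
    unfolding P.mass_def measure_def sp[OF sets_\<nu>] emeasure_size_biased_UNIV ..
  moreover have "R.P.mass = enn2real (\<integral>\<^sup>+x. ennreal (- x) \<partial>\<nu>)"
    unfolding R.P.mass_def measure_def sp[OF sets_distr] R.emeasure_size_biased_UNIV
    by (subst nn_integral_distr) auto
  moreover have "(\<integral>x. x \<partial>\<nu>) = enn2real (\<integral>\<^sup>+x. ennreal x \<partial>\<nu>) - enn2real (\<integral>\<^sup>+x. ennreal (- x) \<partial>\<nu>)"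
    by (rule real_lebesgue_integral_def[OF integrable])
  ultimately show ?thesis using centered by simp
qed

lemma G_tilde_neg:
  assumes x: "x < 0"
  shows "G_tilde \<nu> (ereal x) u = ereal (R.P.randomized_cdf (- x, u))"
proof -
  let ?l = "ereal (measure (size_biased (reflect \<nu>)) {..<- x})"
  have eq: "G_fun \<nu> (ereal y) = G_fun (reflect \<nu>) (ereal (- y))" if "y < 0" for y
    using G_fun_reflect[OF sets_\<nu>, of "ereal (- y)"] that by simp
  have "((\<lambda>y. G_fun (reflect \<nu>) (ereal (- y))) \<longlongrightarrow> ?l) (at_right x)"
    using R.G_fun_at_left[of "- x"] x
    by (simp add: at_left_ereal at_right_minus[of x] filterlim_filtermap o_def)
  moreover have "\<forall>\<^sub>F y in at_right x. G_fun (reflect \<nu>) (ereal (- y)) = G_fun \<nu> (ereal y)"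
  proof -
    have "\<forall>\<^sub>F y in at_right x. y < 0" using x by (auto simp: eventually_at_right_field)
    then show ?thesis by eventually_elim (simp add: eq)
  qed
  ultimately have "((\<lambda>y. G_fun \<nu> (ereal y)) \<longlongrightarrow> ?l) (at_right x)"
    using tendsto_cong by fastforce
  then have "Lim (at_right (ereal x)) (G_fun \<nu>) = ?l"
    by (intro tendsto_Lim) (auto simp: at_right_ereal filtermap_bot_iff filterlim_filtermap)
  then show ?thesis
    using x eq[OF x] by (simp add: G_tilde_def R.G_fun_nonneg R.P.randomized_cdf_def R.P.cdf_split mult.commute)
qed

text \<open>A measurable real-valued version of \<open>recip\<close> on pairs: transform one half of
  the law to a uniform level and take the quantile of the other half at that level. At
  \<open>fst z = 0\<close> the value is set to 0, so that degenerate pairs are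
  \<open>(0, 0)\<close>.\<close>

definition real_recip :: "real \<times> real \<Rightarrow> real" where
  "real_recip z = (if 0 < fst z then - R.P.quantile (P.randomized_cdf z)
     else if fst z < 0 then P.quantile (R.P.randomized_cdf (- fst z, snd z)) else 0)"

lemma measurable_real_recip [measurable]: "real_recip \<in> borel_measurable (borel \<Otimes>\<^sub>M borel)"
proof -
  have "(\<lambda>z. R.P.quantile (P.randomized_cdf z)) \<in> borel_measurable (borel \<Otimes>\<^sub>M borel)"
    by (rule measurable_compose[OF P.measurable_randomized_cdf R.P.measurable_quantile])
  moreover have "(\<lambda>z. P.quantile (R.P.randomized_cdf (- fst z, snd z))) \<in> borel_measurable (borel \<Otimes>\<^sub>M borel)"
    by (rule measurable_compose[OF measurable_compose[OF _ R.P.measurable_randomized_cdf] P.measurable_quantile]) simp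
  ultimately show ?thesis unfolding real_recip_def by (intro measurable_If) auto
qed

lemma recip_pos:
  assumes x: "0 < x" and w: "0 < P.randomized_cdf (x, u)" "P.randomized_cdf (x, u) < P.mass"
  shows "recip \<nu> (ereal x) u = ereal (real_recip (x, u))"
proof -
  have "P.randomized_cdf (x, u) < R.P.mass" using w(2) unfolding mass_eq .
  then have e: "x_plus (reflect \<nu>) (ereal (P.randomized_cdf (x, u))) = ereal (R.P.quantile (P.randomized_cdf (x, u)))"
    by (rule R.x_plus_eq_quantile[OF w(1)])
  have "0 \<le> ereal x" using x by simp
  then have "recip \<nu> (ereal x) u = x_minus \<nu> (G_tilde \<nu> (ereal x) u)" unfolding recip_def by (rule if_P)
  also have "\<dots> = ereal (- R.P.quantile (P.randomized_cdf (x, u)))"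
    unfolding G_tilde_pos[OF x] x_minus_reflect[OF sets_\<nu>] e by (rule uminus_ereal.simps)
  also have "- R.P.quantile (P.randomized_cdf (x, u)) = real_recip (x, u)"
    unfolding real_recip_def fst_conv using x by (rule if_P[symmetric])
  finally show ?thesis .
qed

lemma recip_neg:
  assumes x: "x < 0" and w: "0 < R.P.randomized_cdf (- x, u)" "R.P.randomized_cdf (- x, u) < P.mass"
  shows "recip \<nu> (ereal x) u = ereal (real_recip (x, u))"
proof -
  have "\<not> 0 \<le> ereal x" using x by simp
  then have "recip \<nu> (ereal x) u = x_plus \<nu> (G_tilde \<nu> (ereal x) u)" unfolding recip_def by (rule if_not_P)
  also have "\<dots> = ereal (P.quantile (R.P.randomized_cdf (- x, u)))"
    unfolding G_tilde_neg[OF x] by (rule x_plus_eq_quantile[OF w])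
  also have "P.quantile (R.P.randomized_cdf (- x, u)) = real_recip (x, u)"
    unfolding real_recip_def fst_conv snd_conv using x by simp
  finally show ?thesis .
qed

end

context integrable_distribution
begin

abbreviation "\<nu>U \<equiv> \<nu> \<Otimes>\<^sub>M unit_uniform"

lemma sets_\<nu>U [measurable_cong]: "sets \<nu>U = sets (borel \<Otimes>\<^sub>M borel)"
  by (intro sets_pair_measure_cong) auto

lemma size_biased_pair: "size_biased \<nu> \<Otimes>\<^sub>M unit_uniform = density \<nu>U (\<lambda>z. ennreal (fst z))"
proof -
  interpret U: prob_space unit_uniform by (rule prob_space_unit_uniform)
  have "density \<nu> (\<lambda>x. ennreal x) \<Otimes>\<^sub>M density unit_uniform (\<lambda>_. 1)
      = density \<nu>U (\<lambda>(x, y). ennreal x * 1)"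
    by (rule pair_measure_density) (auto simp: density_1 U.sigma_finite_measure_axioms)
  also have "(\<lambda>(x, y). ennreal x * 1) = (\<lambda>z. ennreal (fst z))" by (auto simp: fun_eq_iff)
  finally show ?thesis by (simp add: size_biased_def density_1)
qed

lemma nn_integral_size_biased_pair:
  assumes [measurable]: "f \<in> borel_measurable (borel \<Otimes>\<^sub>M borel)"
  shows "(\<integral>\<^sup>+z. f z \<partial>P.\<rho>U) = (\<integral>\<^sup>+z. ennreal (fst z) * f z \<partial>\<nu>U)"
  unfolding size_biased_pair
  by (rule nn_integral_density) measurable

lemma AE_size_biased_pair: "(AE z in P.\<rho>U. Q z) \<longleftrightarrow> (AE z in \<nu>U. 0 < fst z \<longrightarrow> Q z)"
  unfolding size_biased_pair by (subst AE_density) simp_all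

lemma AE_quantile:
  "AE z in \<nu>U. 0 < fst z \<longrightarrow> 0 < P.randomized_cdf z \<and> P.randomized_cdf z < P.mass \<and> P.quantile (P.randomized_cdf z) = fst z"
  using P.AE_quantile_randomized_cdf unfolding AE_size_biased_pair .

lemma reflect_pair: "reflect \<nu> \<Otimes>\<^sub>M unit_uniform = distr \<nu>U (borel \<Otimes>\<^sub>M borel) (\<lambda>z. (- fst z, snd z))"
proof -
  interpret U: prob_space unit_uniform by (rule prob_space_unit_uniform)
  have id: "distr unit_uniform borel (\<lambda>x. x) = unit_uniform"
    by (rule distr_id2) simp
  have "reflect \<nu> \<Otimes>\<^sub>M distr unit_uniform borel (\<lambda>x. x)
      = distr \<nu>U (borel \<Otimes>\<^sub>M borel) (\<lambda>(x, y). (- x, y))"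
    by (rule pair_measure_distr) (auto simp: id U.sigma_finite_measure_axioms)
  also have "(\<lambda>(x, y). (- x, y)) = (\<lambda>z. (- fst z, snd z))" by (auto simp: fun_eq_iff)
  finally show ?thesis unfolding id .
qed

end

context centered_distribution
begin

lemma AE_quantile_reflect:
  "AE z in \<nu>U. fst z < 0 \<longrightarrow> 0 < R.P.randomized_cdf (- fst z, snd z) \<and> R.P.randomized_cdf (- fst z, snd z) < P.mass
      \<and> R.P.quantile (R.P.randomized_cdf (- fst z, snd z)) = - fst z"
proof -
  have "AE z in \<nu>U. 0 < fst (- fst z, snd z) \<longrightarrow> 0 < R.P.randomized_cdf (- fst z, snd z)
      \<and> R.P.randomized_cdf (- fst z, snd z) < R.P.mass
      \<and> R.P.quantile (R.P.randomized_cdf (- fst z, snd z)) = fst (- fst z, snd z)"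
    by (rule AE_distrD[OF _ R.AE_quantile[unfolded reflect_pair]]) simp
  then show ?thesis unfolding mass_eq by simp
qed

lemma AE_recip:
  "AE z in \<nu>U. fst z \<noteq> 0 \<longrightarrow> recip \<nu> (ereal (fst z)) (snd z) = ereal (real_recip z) \<and> fst z * real_recip z < 0"
  using AE_quantile AE_quantile_reflect
proof eventually_elim
  case (elim z)
  obtain x u where z: "z = (x, u)" by (cases z)
  consider "0 < x" | "x < 0" | "x = 0" by linarith
  then show ?case
  proof cases
    case 1
    then have w: "0 < P.randomized_cdf (x, u)" "P.randomized_cdf (x, u) < P.mass" using elim z by auto
    have "0 < R.P.quantile (P.randomized_cdf (x, u))" by (rule R.P.quantile_pos) (use w mass_eq in auto)
    then show ?thesis using recip_pos[OF 1 w] 1 unfolding z by (simp add: real_recip_def mult_pos_neg)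
  next
    case 2
    then have w: "0 < R.P.randomized_cdf (- x, u)" "R.P.randomized_cdf (- x, u) < P.mass" using elim z by auto
    have "0 < P.quantile (R.P.randomized_cdf (- x, u))" by (rule P.quantile_pos) (use w in auto)
    then show ?thesis using recip_neg[OF 2 w] 2 unfolding z by (simp add: real_recip_def mult_neg_pos)
  qed (simp add: z)
qed

definition "recip_law = distr \<nu>U (borel \<Otimes>\<^sub>M borel) (\<lambda>z. (fst z, real_recip z))"

lemma sets_recip_law [measurable_cong, simp]: "sets recip_law = sets (borel \<Otimes>\<^sub>M borel)"
  by (simp add: recip_law_def)

lemma measurable_recip_pair: "(\<lambda>z. (fst z, real_recip z)) \<in> \<nu>U \<rightarrow>\<^sub>M borel \<Otimes>\<^sub>M borel"
proof -
  have "(\<lambda>z. (fst z, real_recip z)) \<in> borel \<Otimes>\<^sub>M borel \<rightarrow>\<^sub>M borel \<Otimes>\<^sub>M borel" by measurable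
  then show ?thesis by (simp cong: measurable_cong_sets sets_pair_measure_cong)
qed

lemma prob_space_recip_law: "prob_space recip_law"
proof -
  interpret U: prob_space unit_uniform by (rule prob_space_unit_uniform)
  interpret P: pair_prob_space \<nu> unit_uniform ..
  show ?thesis unfolding recip_law_def by (rule P.prob_space_distr[OF measurable_recip_pair])
qed

lemma nn_integral_recip_law:
  assumes "\<Psi> \<in> borel_measurable (borel \<Otimes>\<^sub>M borel)"
  shows "(\<integral>\<^sup>+z. \<Psi> z \<partial>recip_law) = (\<integral>\<^sup>+z. \<Psi> (fst z, real_recip z) \<partial>\<nu>U)"
  unfolding recip_law_def
  by (rule nn_integral_distr[OF measurable_recip_pair]) (simp only: measurable_distr_eq1 assms)

text \<open>Weighting by the positive part turns the law of \<open>X\<close> into the size-biased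
  measure, under which the transform is uniform and its quantile returns \<open>X\<close>. The pair
  thus becomes the image of a level \<open>h\<close> under both quantiles. The negative part yields
  the same image with the two entries interchanged.\<close>

lemma recip_law_pos:
  assumes [measurable]: "\<Psi> \<in> borel_measurable (borel \<Otimes>\<^sub>M borel)"
  shows "(\<integral>\<^sup>+z. ennreal (fst z) * \<Psi> z \<partial>recip_law)
     = (\<integral>\<^sup>+h\<in>{0<..<P.mass}. \<Psi> (P.quantile h, - R.P.quantile h) \<partial>lborel)"
proof -
  have "(\<integral>\<^sup>+z. ennreal (fst z) * \<Psi> z \<partial>recip_law) = (\<integral>\<^sup>+z. ennreal (fst z) * \<Psi> (fst z, real_recip z) \<partial>\<nu>U)"
    by (subst nn_integral_recip_law) auto
  also have "\<dots> = (\<integral>\<^sup>+z. ennreal (fst z) * \<Psi> (P.quantile (P.randomized_cdf z), - R.P.quantile (P.randomized_cdf z)) \<partial>\<nu>U)"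
  proof (rule nn_integral_cong_AE)
    show "AE z in \<nu>U. ennreal (fst z) * \<Psi> (fst z, real_recip z)
        = ennreal (fst z) * \<Psi> (P.quantile (P.randomized_cdf z), - R.P.quantile (P.randomized_cdf z))"
      using AE_quantile
    proof eventually_elim
      case (elim z)
      show ?case
      proof (cases "0 < fst z")
        case True
        then show ?thesis using elim by (simp add: real_recip_def)
      next
        case False
        then show ?thesis by (simp add: ennreal_neg)
      qed
    qed
  qed
  also have "\<dots> = (\<integral>\<^sup>+z. \<Psi> (P.quantile (P.randomized_cdf z), - R.P.quantile (P.randomized_cdf z)) \<partial>P.\<rho>U)"
    by (rule nn_integral_size_biased_pair[symmetric]) measurable
  also have "\<dots> = (\<integral>\<^sup>+h\<in>{0<..<P.mass}. \<Psi> (P.quantile h, - R.P.quantile h) \<partial>lborel)"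
    by (rule P.nn_integral_randomized_cdf) measurable
  finally show ?thesis .
qed

lemma recip_law_neg:
  assumes [measurable]: "\<Psi> \<in> borel_measurable (borel \<Otimes>\<^sub>M borel)"
  shows "(\<integral>\<^sup>+z. ennreal (- fst z) * \<Psi> z \<partial>recip_law)
     = (\<integral>\<^sup>+h\<in>{0<..<P.mass}. \<Psi> (- R.P.quantile h, P.quantile h) \<partial>lborel)"
proof -
  let ?f = "\<lambda>z. \<Psi> (- R.P.quantile (R.P.randomized_cdf z), P.quantile (R.P.randomized_cdf z))"
  have f[measurable]: "?f \<in> borel_measurable (borel \<Otimes>\<^sub>M borel)" by measurable
  have "(\<integral>\<^sup>+z. ennreal (- fst z) * \<Psi> z \<partial>recip_law) = (\<integral>\<^sup>+z. ennreal (- fst z) * \<Psi> (fst z, real_recip z) \<partial>\<nu>U)"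
    by (subst nn_integral_recip_law) auto
  also have "\<dots> = (\<integral>\<^sup>+z. ennreal (fst (- fst z, snd z)) * ?f (- fst z, snd z) \<partial>\<nu>U)"
  proof (rule nn_integral_cong_AE)
    show "AE z in \<nu>U. ennreal (- fst z) * \<Psi> (fst z, real_recip z)
        = ennreal (fst (- fst z, snd z)) * ?f (- fst z, snd z)"
      using AE_quantile_reflect
    proof eventually_elim
      case (elim z)
      show ?case
      proof (cases "fst z < 0")
        case True
        then show ?thesis using elim by (simp add: real_recip_def)
      next
        case False
        then show ?thesis by (simp add: ennreal_neg)
      qed
    qed
  qed
  also have "\<dots> = (\<integral>\<^sup>+z. ennreal (fst z) * ?f z \<partial>(reflect \<nu> \<Otimes>\<^sub>M unit_uniform))"
    unfolding reflect_pair by (rule nn_integral_distr[symmetric]) measurable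
  also have "\<dots> = (\<integral>\<^sup>+z. ?f z \<partial>R.P.\<rho>U)"
    by (rule R.nn_integral_size_biased_pair[symmetric, OF f])
  also have "\<dots> = (\<integral>\<^sup>+h\<in>{0<..<R.P.mass}. \<Psi> (- R.P.quantile h, P.quantile h) \<partial>lborel)"
    by (rule R.P.nn_integral_randomized_cdf) measurable
  finally show ?thesis unfolding mass_eq .
qed

lemma recip_law_exchange:
  assumes \<Psi>[measurable]: "\<Psi> \<in> borel_measurable (borel \<Otimes>\<^sub>M borel)"
  shows "(\<integral>\<^sup>+z. ennreal \<bar>fst z\<bar> * \<Psi> z \<partial>recip_law) = (\<integral>\<^sup>+z. ennreal \<bar>fst z\<bar> * \<Psi> (prod.swap z) \<partial>recip_law)"
proof -
  have split: "(\<integral>\<^sup>+z. ennreal \<bar>fst z\<bar> * \<Phi> z \<partial>recip_law)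
      = (\<integral>\<^sup>+h\<in>{0<..<P.mass}. \<Phi> (P.quantile h, - R.P.quantile h) \<partial>lborel)
      + (\<integral>\<^sup>+h\<in>{0<..<P.mass}. \<Phi> (- R.P.quantile h, P.quantile h) \<partial>lborel)"
    if [measurable]: "\<Phi> \<in> borel_measurable (borel \<Otimes>\<^sub>M borel)" for \<Phi>
  proof -
    have "ennreal \<bar>x\<bar> = ennreal x + ennreal (- x)" for x by (cases "0 \<le> x") (auto simp: ennreal_neg)
    then have "(\<integral>\<^sup>+z. ennreal \<bar>fst z\<bar> * \<Phi> z \<partial>recip_law)
       = (\<integral>\<^sup>+z. ennreal (fst z) * \<Phi> z + ennreal (- fst z) * \<Phi> z \<partial>recip_law)"
      by (simp add: distrib_right)
    also have "\<dots> = (\<integral>\<^sup>+z. ennreal (fst z) * \<Phi> z \<partial>recip_law) + (\<integral>\<^sup>+z. ennreal (- fst z) * \<Phi> z \<partial>recip_law)"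
      by (rule nn_integral_add) measurable
    finally show ?thesis unfolding recip_law_pos[OF that] recip_law_neg[OF that] .
  qed
  have sw: "(\<lambda>z. \<Psi> (prod.swap z)) \<in> borel_measurable (borel \<Otimes>\<^sub>M borel)" unfolding prod.swap_def by measurable
  show ?thesis unfolding split[OF \<Psi>] split[OF sw] by (simp add: add.commute)
qed

end

text \<open>The conditional probability of seeing the other order of the pair. For entries of
  opposite sign it is the unique weight that gives mean zero:
  \<open>(1 - w) * fst z + w * snd z = 0\<close>. For the pair \<open>(0, 0)\<close> it is
  0.\<close>

definition swap_weight :: "real \<times> real \<Rightarrow> real" where
  "swap_weight z = \<bar>fst z\<bar> / (\<bar>fst z\<bar> + \<bar>snd z\<bar>)"

lemma swap_weight_bounds: "0 \<le> swap_weight z" "swap_weight z \<le> 1"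
  by (auto simp: swap_weight_def divide_le_eq_1)

lemma measurable_swap_weight [measurable]: "swap_weight \<in> borel_measurable (borel \<Otimes>\<^sub>M borel)"
  unfolding swap_weight_def by measurable

text \<open>Exchangeability of the law weighted by \<open>\<bar>fst z\<bar>\<close> is applied to
  \<open>\<Phi>\<close> divided by the symmetric quantity
  \<open>\<bar>fst z\<bar> + \<bar>snd z\<bar>\<close>. This moves the portion
  \<open>swap_weight\<close> of the integral from each pair to its swap.\<close>

lemma (in centered_distribution) recip_law_symmetrize:
  assumes \<Phi>[measurable]: "\<Phi> \<in> borel_measurable (borel \<Otimes>\<^sub>M borel)"
  shows "(\<integral>\<^sup>+z. \<Phi> z \<partial>recip_law)
     = (\<integral>\<^sup>+z. ennreal (1 - swap_weight z) * \<Phi> z + ennreal (swap_weight z) * \<Phi> (prod.swap z) \<partial>recip_law)"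
proof -
  have sw[measurable]: "(\<lambda>z. \<Phi> (prod.swap z)) \<in> borel_measurable (borel \<Otimes>\<^sub>M borel)" unfolding prod.swap_def by measurable
  let ?\<Psi> = "\<lambda>z. ennreal (1 / (\<bar>fst z\<bar> + \<bar>snd z\<bar>)) * \<Phi> z"
  have w: "ennreal (swap_weight z) * a = ennreal \<bar>fst z\<bar> * (ennreal (1 / (\<bar>fst z\<bar> + \<bar>snd z\<bar>)) * a)" for z a
    by (simp add: swap_weight_def flip: mult.assoc ennreal_mult')
  have "(\<integral>\<^sup>+z. ennreal (swap_weight z) * \<Phi> z \<partial>recip_law) = (\<integral>\<^sup>+z. ennreal \<bar>fst z\<bar> * ?\<Psi> z \<partial>recip_law)"
    by (simp only: w)
  also have "\<dots> = (\<integral>\<^sup>+z. ennreal \<bar>fst z\<bar> * ?\<Psi> (prod.swap z) \<partial>recip_law)"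
    by (rule recip_law_exchange) measurable
  also have "\<dots> = (\<integral>\<^sup>+z. ennreal (swap_weight z) * \<Phi> (prod.swap z) \<partial>recip_law)"
    by (simp only: w) (simp add: add.commute)
  finally have ex: "(\<integral>\<^sup>+z. ennreal (swap_weight z) * \<Phi> z \<partial>recip_law)
      = (\<integral>\<^sup>+z. ennreal (swap_weight z) * \<Phi> (prod.swap z) \<partial>recip_law)" .
  have "ennreal (1 - swap_weight z) + ennreal (swap_weight z) = 1" for z
    using swap_weight_bounds[of z] by (simp flip: ennreal_plus)
  then have "(\<integral>\<^sup>+z. \<Phi> z \<partial>recip_law) = (\<integral>\<^sup>+z. ennreal (1 - swap_weight z) * \<Phi> z + ennreal (swap_weight z) * \<Phi> z \<partial>recip_law)"
    by (simp flip: distrib_right)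
  also have "\<dots> = (\<integral>\<^sup>+z. ennreal (1 - swap_weight z) * \<Phi> z \<partial>recip_law) + (\<integral>\<^sup>+z. ennreal (swap_weight z) * \<Phi> z \<partial>recip_law)"
    by (rule nn_integral_add) measurable
  also have "\<dots> = (\<integral>\<^sup>+z. ennreal (1 - swap_weight z) * \<Phi> z + ennreal (swap_weight z) * \<Phi> (prod.swap z) \<partial>recip_law)"
    unfolding ex by (rule nn_integral_add[symmetric]) measurable
  finally show ?thesis .
qed

subsection \<open>Independent families\<close>

text \<open>Regrouping a vector of \<open>x\<close>-coordinates and a vector of
  \<open>u\<close>-coordinates into a vector of pairs. Each inductive step peels off one index and
  interchanges its \<open>x\<close>-integral with the remaining \<open>u\<close>-integral.\<close>

lemma nn_integral_PiM_pair:
  fixes A :: "'i \<Rightarrow> 'a measure" and B :: "'i \<Rightarrow> 'b measure"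
  assumes I: "finite I" and prob: "\<And>i. prob_space (A i)" "\<And>i. prob_space (B i)"
    and F: "F \<in> borel_measurable (Pi\<^sub>M I (\<lambda>i. A i \<Otimes>\<^sub>M B i))"
  shows "(\<integral>\<^sup>+x. \<integral>\<^sup>+u. F (\<lambda>i\<in>I. (x i, u i)) \<partial>Pi\<^sub>M I B \<partial>Pi\<^sub>M I A) = (\<integral>\<^sup>+z. F z \<partial>Pi\<^sub>M I (\<lambda>i. A i \<Otimes>\<^sub>M B i))"
  using I F
proof (induction I arbitrary: F rule: finite_induct)
  case empty
  show ?case by (simp add: PiM_empty nn_integral_count_space_finite)
next
  case (insert j I)
  interpret A: product_prob_space A by (rule product_prob_spaceI) (rule prob)
  interpret B: product_prob_space B by (rule product_prob_spaceI) (rule prob)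
  have AB: "prob_space (A i \<Otimes>\<^sub>M B i)" for i
  proof -
    interpret pair_prob_space "A i" "B i"
      by (simp add: pair_prob_space_def pair_sigma_finite_def prob prob_space_imp_sigma_finite)
    show ?thesis by (rule prob_space_axioms)
  qed
  interpret AB: product_prob_space "\<lambda>i. A i \<Otimes>\<^sub>M B i" by (rule product_prob_spaceI) (rule AB)
  interpret PA: prob_space "Pi\<^sub>M I A" by (rule prob_space_PiM) (simp add: prob)
  interpret PB: prob_space "Pi\<^sub>M I B" by (rule prob_space_PiM) (simp add: prob)
  interpret PIB: prob_space "Pi\<^sub>M (insert j I) B" by (rule prob_space_PiM) (simp add: prob)
  interpret Aj: prob_space "A j" by (rule prob)
  interpret Bj: prob_space "B j" by (rule prob)
  interpret AjPB: pair_sigma_finite "A j" "Pi\<^sub>M I B" ..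
  note [measurable] = insert.prems
  define H where "H z = (\<integral>\<^sup>+ab. F (z(j := ab)) \<partial>(A j \<Otimes>\<^sub>M B j))" for z
  have H[measurable]: "H \<in> borel_measurable (Pi\<^sub>M I (\<lambda>i. A i \<Otimes>\<^sub>M B i))"
    unfolding H_def by measurable
  have upd: "(\<lambda>i\<in>insert j I. ((x(j := a)) i, (u(j := b)) i)) = (\<lambda>i\<in>I. (x i, u i))(j := (a, b))" for x u a b
    using insert.hyps by (auto simp: fun_eq_iff)
  have m1[measurable]: "(\<lambda>(x, u). \<lambda>i\<in>insert j I. (x i, u i)) \<in> Pi\<^sub>M (insert j I) A \<Otimes>\<^sub>M Pi\<^sub>M (insert j I) B \<rightarrow>\<^sub>M Pi\<^sub>M (insert j I) (\<lambda>i. A i \<Otimes>\<^sub>M B i)"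
    by (auto intro!: measurable_restrict simp: case_prod_beta)
  have Fu: "(\<lambda>q. F ((fst q)(j := snd q))) \<in> borel_measurable (Pi\<^sub>M I (\<lambda>i. A i \<Otimes>\<^sub>M B i) \<Otimes>\<^sub>M (A j \<Otimes>\<^sub>M B j))"
    by measurable
  have cx: "(\<lambda>u. \<lambda>i\<in>I. (x i, u i)) \<in> Pi\<^sub>M I B \<rightarrow>\<^sub>M Pi\<^sub>M I (\<lambda>i. A i \<Otimes>\<^sub>M B i)" if "x \<in> space (Pi\<^sub>M I A)" for x
    using that by (intro measurable_restrict measurable_Pair measurable_const) (auto simp: space_PiM PiE_iff)
  have "(\<integral>\<^sup>+x. \<integral>\<^sup>+u. F (\<lambda>i\<in>insert j I. (x i, u i)) \<partial>Pi\<^sub>M (insert j I) B \<partial>Pi\<^sub>M (insert j I) A)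
      = (\<integral>\<^sup>+x. \<integral>\<^sup>+a. \<integral>\<^sup>+u. F (\<lambda>i\<in>insert j I. ((x(j := a)) i, u i)) \<partial>Pi\<^sub>M (insert j I) B \<partial>A j \<partial>Pi\<^sub>M I A)"
    by (rule A.product_nn_integral_insert) (use insert.hyps in simp_all)
  also have "\<dots> = (\<integral>\<^sup>+x. \<integral>\<^sup>+a. \<integral>\<^sup>+u. \<integral>\<^sup>+b. F ((\<lambda>i\<in>I. (x i, u i))(j := (a, b))) \<partial>B j \<partial>Pi\<^sub>M I B \<partial>A j \<partial>Pi\<^sub>M I A)"
  proof (intro nn_integral_cong)
    fix x a assume x: "x \<in> space (Pi\<^sub>M I A)" and a: "a \<in> space (A j)"
    have xa: "x(j := a) \<in> space (Pi\<^sub>M (insert j I) A)"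
      using x a by (auto simp: space_PiM PiE_iff extensional_def)
    show "(\<integral>\<^sup>+u. F (\<lambda>i\<in>insert j I. ((x(j := a)) i, u i)) \<partial>Pi\<^sub>M (insert j I) B)
       = (\<integral>\<^sup>+u. \<integral>\<^sup>+b. F ((\<lambda>i\<in>I. (x i, u i))(j := (a, b))) \<partial>B j \<partial>Pi\<^sub>M I B)"
      unfolding upd[symmetric]
      by (rule B.product_nn_integral_insert) (use insert.hyps xa in measurable)
  qed
  also have "\<dots> = (\<integral>\<^sup>+x. \<integral>\<^sup>+u. \<integral>\<^sup>+a. \<integral>\<^sup>+b. F ((\<lambda>i\<in>I. (x i, u i))(j := (a, b))) \<partial>B j \<partial>A j \<partial>Pi\<^sub>M I B \<partial>Pi\<^sub>M I A)"
  proof (rule nn_integral_cong)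
    fix x assume x: "x \<in> space (Pi\<^sub>M I A)"
    show "(\<integral>\<^sup>+a. \<integral>\<^sup>+u. \<integral>\<^sup>+b. F ((\<lambda>i\<in>I. (x i, u i))(j := (a, b))) \<partial>B j \<partial>Pi\<^sub>M I B \<partial>A j)
       = (\<integral>\<^sup>+u. \<integral>\<^sup>+a. \<integral>\<^sup>+b. F ((\<lambda>i\<in>I. (x i, u i))(j := (a, b))) \<partial>B j \<partial>A j \<partial>Pi\<^sub>M I B)"
    proof (rule AjPB.Fubini'[symmetric])
      have "(\<lambda>q. F ((\<lambda>i\<in>I. (x i, snd (fst q) i))(j := (fst (fst q), snd q)))) \<in> borel_measurable ((A j \<Otimes>\<^sub>M Pi\<^sub>M I B) \<Otimes>\<^sub>M B j)"
      proof -
        have 1: "(\<lambda>q. \<lambda>i\<in>I. (x i, snd (fst q) i)) \<in> (A j \<Otimes>\<^sub>M Pi\<^sub>M I B) \<Otimes>\<^sub>M B j \<rightarrow>\<^sub>M Pi\<^sub>M I (\<lambda>i. A i \<Otimes>\<^sub>M B i)"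
          by (rule measurable_compose[OF _ cx[OF x]]) measurable
        have 2: "(\<lambda>q. (fst (fst q), snd q)) \<in> (A j \<Otimes>\<^sub>M Pi\<^sub>M I B) \<Otimes>\<^sub>M B j \<rightarrow>\<^sub>M A j \<Otimes>\<^sub>M B j"
          by measurable
        show ?thesis using measurable_compose[OF measurable_Pair[OF 1 2] Fu] by simp
      qed
      then show "(\<lambda>(a, u). \<integral>\<^sup>+b. F ((\<lambda>i\<in>I. (x i, u i))(j := (a, b))) \<partial>B j) \<in> borel_measurable (A j \<Otimes>\<^sub>M Pi\<^sub>M I B)"
        unfolding case_prod_beta' by (rule sigma_finite_measure.borel_measurable_nn_integral_fst[OF prob_space_imp_sigma_finite[OF prob(2)], where f = "\<lambda>q. F ((\<lambda>i\<in>I. (x i, snd (fst q) i))(j := (fst (fst q), snd q)))", simplified])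
    qed
  qed
  also have "\<dots> = (\<integral>\<^sup>+x. \<integral>\<^sup>+u. H (\<lambda>i\<in>I. (x i, u i)) \<partial>Pi\<^sub>M I B \<partial>Pi\<^sub>M I A)"
  proof (intro nn_integral_cong)
    fix x u assume x: "x \<in> space (Pi\<^sub>M I A)" and u: "u \<in> space (Pi\<^sub>M I B)"
    have z: "(\<lambda>i\<in>I. (x i, u i)) \<in> space (Pi\<^sub>M I (\<lambda>i. A i \<Otimes>\<^sub>M B i))"
      using measurable_space[OF cx[OF x] u] .
    show "(\<integral>\<^sup>+a. \<integral>\<^sup>+b. F ((\<lambda>i\<in>I. (x i, u i))(j := (a, b))) \<partial>B j \<partial>A j) = H (\<lambda>i\<in>I. (x i, u i))"
      unfolding H_def
      by (rule sigma_finite_measure.nn_integral_fst[OF prob_space_imp_sigma_finite[OF prob(2)]]) (rule measurable_compose[OF measurable_Pair1'[OF z] Fu, simplified])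
  qed
  also have "\<dots> = (\<integral>\<^sup>+z. H z \<partial>Pi\<^sub>M I (\<lambda>i. A i \<Otimes>\<^sub>M B i))"
    by (rule insert.IH[OF H])
  also have "\<dots> = (\<integral>\<^sup>+z. F z \<partial>Pi\<^sub>M (insert j I) (\<lambda>i. A i \<Otimes>\<^sub>M B i))"
    unfolding H_def by (rule AB.product_nn_integral_insert[symmetric]) (use insert.hyps in simp_all)
  finally show ?case .
qed

text \<open>Independence permits the one-pair identity in each coordinate separately, so the two
  orders of every pair are averaged over all subsets; \<open>A\<close> collects the coordinates left
  in place. The result is an exact integral of a finite two-point average.\<close>

lemma nn_integral_PiM_symmetrize:
  fixes \<mu> :: "'i \<Rightarrow> (real \<times> real) measure"
  assumes I: "finite I" and prob: "\<And>i. prob_space (\<mu> i)"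
    and sets: "\<And>i. sets (\<mu> i) = sets (borel \<Otimes>\<^sub>M borel)"
    and sym: "\<And>i \<Phi>. i \<in> I \<Longrightarrow> \<Phi> \<in> borel_measurable (borel \<Otimes>\<^sub>M borel) \<Longrightarrow> (\<integral>\<^sup>+z. \<Phi> z \<partial>\<mu> i)
       = (\<integral>\<^sup>+z. ennreal (1 - swap_weight z) * \<Phi> z + ennreal (swap_weight z) * \<Phi> (prod.swap z) \<partial>\<mu> i)"
    and F: "F \<in> borel_measurable (Pi\<^sub>M I (\<lambda>_. borel \<Otimes>\<^sub>M borel))"
  shows "(\<integral>\<^sup>+z. F z \<partial>Pi\<^sub>M I \<mu>) = (\<integral>\<^sup>+z. (\<Sum>A\<in>Pow I. (\<Prod>i\<in>I. ennreal (if i \<in> A then 1 - swap_weight (z i) else swap_weight (z i)))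
          * F (\<lambda>i\<in>I. if i \<in> A then z i else prod.swap (z i))) \<partial>Pi\<^sub>M I \<mu>)"
  using I sym F
proof (induction I arbitrary: F rule: finite_induct)
  case empty
  show ?case by (simp add: PiM_empty nn_integral_count_space_finite)
next
  case (insert j I)
  interpret product_prob_space \<mu> by (rule product_prob_spaceI) (rule prob)
  note F = insert.prems(2)
  have S: "sets (Pi\<^sub>M J \<mu>) = sets (Pi\<^sub>M J (\<lambda>_. borel \<Otimes>\<^sub>M borel))" for J
    by (intro sets_PiM_cong) (auto simp: sets)
  define w where "w I A z = (\<Prod>i\<in>I. ennreal (if i \<in> A then 1 - swap_weight (z i) else swap_weight (z i)))"
    for I :: "'i set" and A and z :: "'i \<Rightarrow> real \<times> real"
  define s where "s I A z = (\<lambda>i\<in>I. if i \<in> A then z i else prod.swap (z i))"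
    for I :: "'i set" and A and z :: "'i \<Rightarrow> real \<times> real"
  have sw[measurable]: "prod.swap \<in> borel \<Otimes>\<^sub>M borel \<rightarrow>\<^sub>M (borel \<Otimes>\<^sub>M borel :: (real \<times> real) measure)"
    unfolding prod.swap_def by measurable
  have w[measurable]: "w J A \<in> borel_measurable (Pi\<^sub>M J (\<lambda>_. borel \<Otimes>\<^sub>M borel))" for J A
    unfolding w_def by measurable
  have s[measurable]: "s J A \<in> Pi\<^sub>M J (\<lambda>_. borel \<Otimes>\<^sub>M borel) \<rightarrow>\<^sub>M Pi\<^sub>M J (\<lambda>_. borel \<Otimes>\<^sub>M borel)" for J A
    unfolding s_def by (intro measurable_restrict) measurable
  have Fu[measurable]: "(\<lambda>q. F ((fst q)(j := snd q))) \<in> borel_measurable (Pi\<^sub>M I (\<lambda>_. borel \<Otimes>\<^sub>M borel) \<Otimes>\<^sub>M (borel \<Otimes>\<^sub>M borel))"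
    using F by measurable
  define G where "G q = (\<Sum>A\<in>Pow I. w I A (fst q) * F ((s I A (fst q))(j := snd q)))" for q
  have sA[measurable]: "(\<lambda>q. F ((s I A (fst q))(j := snd q))) \<in> borel_measurable (Pi\<^sub>M I (\<lambda>_. borel \<Otimes>\<^sub>M borel) \<Otimes>\<^sub>M (borel \<Otimes>\<^sub>M borel))" for A
  proof -
    have "(\<lambda>q. (s I A (fst q), snd q)) \<in> Pi\<^sub>M I (\<lambda>_. borel \<Otimes>\<^sub>M borel) \<Otimes>\<^sub>M (borel \<Otimes>\<^sub>M borel) \<rightarrow>\<^sub>M Pi\<^sub>M I (\<lambda>_. borel \<Otimes>\<^sub>M borel) \<Otimes>\<^sub>M (borel \<Otimes>\<^sub>M borel)"
      by measurable
    from measurable_compose[OF this Fu] show ?thesis by simp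
  qed
  have G: "G \<in> borel_measurable (Pi\<^sub>M I (\<lambda>_. borel \<Otimes>\<^sub>M borel) \<Otimes>\<^sub>M (borel \<Otimes>\<^sub>M borel))"
    unfolding G_def by measurable
  interpret PI: prob_space "Pi\<^sub>M I \<mu>" by (rule prob_space_PiM) (simp add: prob)
  note [measurable_cong] = S sets
  have G'[measurable]: "G \<in> borel_measurable (Pi\<^sub>M I \<mu> \<Otimes>\<^sub>M (borel \<Otimes>\<^sub>M borel))"
    using G by (simp cong: measurable_cong_sets sets_pair_measure_cong add: S)
  have Gz: "(\<lambda>z. G (z, y)) \<in> borel_measurable (Pi\<^sub>M I \<mu>)" for y
    using measurable_compose[OF measurable_Pair2'[of y "borel \<Otimes>\<^sub>M borel"] G'] by (simp add: space_pair_measure)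
  define \<Phi> where "\<Phi> y = (\<integral>\<^sup>+z. G (z, y) \<partial>Pi\<^sub>M I \<mu>)" for y
  have \<Phi>: "\<Phi> \<in> borel_measurable (borel \<Otimes>\<^sub>M borel)"
    unfolding \<Phi>_def by measurable
  define RHS where "RHS z = (\<Sum>A\<in>Pow (insert j I). w (insert j I) A z * F (s (insert j I) A z))" for z
  have RHS: "RHS \<in> borel_measurable (Pi\<^sub>M (insert j I) \<mu>)"
  proof -
    note [measurable] = F
    have "(\<lambda>z. F (s (insert j I) A z)) \<in> borel_measurable (Pi\<^sub>M (insert j I) (\<lambda>_. borel \<Otimes>\<^sub>M borel))" for A
      by (rule measurable_compose[OF s F])
    then have "RHS \<in> borel_measurable (Pi\<^sub>M (insert j I) (\<lambda>_. borel \<Otimes>\<^sub>M borel))"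
      unfolding RHS_def by (intro borel_measurable_sum borel_measurable_times_ennreal w) auto
    then show ?thesis by (simp cong: measurable_cong_sets add: S)
  qed
  have step: "RHS (z(j := y)) = ennreal (1 - swap_weight y) * G (z, y) + ennreal (swap_weight y) * G (z, prod.swap y)" for z y
  proof -
    have wj: "w (insert j I) A (z(j := y)) = ennreal (swap_weight y) * w I A z"
      "w (insert j I) (insert j A) (z(j := y)) = ennreal (1 - swap_weight y) * w I A z" if "A \<subseteq> I" for A
    proof -
      have jA: "j \<notin> A" using that insert.hyps by auto
      have "w I (insert j A) (z(j := y)) = w I A z" "w I A (z(j := y)) = w I A z"
        unfolding w_def using insert.hyps by (auto intro!: prod.cong)
      moreover have "w (insert j I) B v = ennreal (if j \<in> B then 1 - swap_weight (v j) else swap_weight (v j)) * w I B v" for B v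
        unfolding w_def using insert.hyps by simp
      ultimately show "w (insert j I) A (z(j := y)) = ennreal (swap_weight y) * w I A z"
        "w (insert j I) (insert j A) (z(j := y)) = ennreal (1 - swap_weight y) * w I A z"
        using jA by simp_all
    qed
    have sj: "s (insert j I) A (z(j := y)) = (s I A z)(j := prod.swap y)"
      "s (insert j I) (insert j A) (z(j := y)) = (s I A z)(j := y)" if "A \<subseteq> I" for A
      using that insert.hyps by (auto simp: s_def fun_eq_iff)
    have disj: "Pow I \<inter> insert j ` Pow I = {}" using insert.hyps by auto
    have inj: "inj_on (insert j) (Pow I)"
    proof (rule inj_onI)
      fix A B assume *: "A \<in> Pow I" "B \<in> Pow I" "insert j A = insert j B"
      then have "A = insert j A - {j}" "B = insert j B - {j}" using insert.hyps by auto
      then show "A = B" using * by metis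
    qed
    have "RHS (z(j := y)) = (\<Sum>A\<in>Pow I. w (insert j I) A (z(j := y)) * F (s (insert j I) A (z(j := y))))
       + (\<Sum>A\<in>Pow I. w (insert j I) (insert j A) (z(j := y)) * F (s (insert j I) (insert j A) (z(j := y))))"
      unfolding RHS_def Pow_insert using insert.hyps disj inj by (simp add: sum.union_disjoint sum.reindex)
    also have "\<dots> = (\<Sum>A\<in>Pow I. ennreal (swap_weight y) * (w I A z * F ((s I A z)(j := prod.swap y))))
       + (\<Sum>A\<in>Pow I. ennreal (1 - swap_weight y) * (w I A z * F ((s I A z)(j := y))))"
      by (intro arg_cong2[where f = "(+)"] sum.cong refl) (simp_all add: wj sj mult.assoc)
    also have "\<dots> = ennreal (1 - swap_weight y) * G (z, y) + ennreal (swap_weight y) * G (z, prod.swap y)"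
      unfolding G_def by (simp add: sum_distrib_left add.commute)
    finally show ?thesis .
  qed
  have "(\<integral>\<^sup>+z. F z \<partial>Pi\<^sub>M (insert j I) \<mu>) = (\<integral>\<^sup>+y. \<integral>\<^sup>+z. F (z(j := y)) \<partial>Pi\<^sub>M I \<mu> \<partial>\<mu> j)"
    by (rule product_nn_integral_insert_rev) (use insert.hyps F in measurable)
  also have "\<dots> = (\<integral>\<^sup>+y. \<Phi> y \<partial>\<mu> j)"
  proof (rule nn_integral_cong)
    fix y
    have "(\<lambda>z. F (z(j := y))) \<in> borel_measurable (Pi\<^sub>M I (\<lambda>_. borel \<Otimes>\<^sub>M borel))"
      using measurable_compose[OF measurable_Pair2'[of y "borel \<Otimes>\<^sub>M borel"] Fu] by (simp add: space_pair_measure)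
    from insert.IH[OF insert.prems(1)[OF insertI2] this] show "(\<integral>\<^sup>+z. F (z(j := y)) \<partial>Pi\<^sub>M I \<mu>) = \<Phi> y"
      unfolding \<Phi>_def G_def w_def s_def fst_conv snd_conv .
  qed
  also have "\<dots> = (\<integral>\<^sup>+y. ennreal (1 - swap_weight y) * \<Phi> y + ennreal (swap_weight y) * \<Phi> (prod.swap y) \<partial>\<mu> j)"
    by (rule insert.prems(1)[OF _ \<Phi>]) simp
  also have "\<dots> = (\<integral>\<^sup>+y. \<integral>\<^sup>+z. RHS (z(j := y)) \<partial>Pi\<^sub>M I \<mu> \<partial>\<mu> j)"
  proof (rule nn_integral_cong)
    fix y
    have "(\<integral>\<^sup>+z. RHS (z(j := y)) \<partial>Pi\<^sub>M I \<mu>)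
        = (\<integral>\<^sup>+z. ennreal (1 - swap_weight y) * G (z, y) \<partial>Pi\<^sub>M I \<mu>) + (\<integral>\<^sup>+z. ennreal (swap_weight y) * G (z, prod.swap y) \<partial>Pi\<^sub>M I \<mu>)"
      unfolding step by (rule nn_integral_add) (intro borel_measurable_times_ennreal borel_measurable_const Gz)+
    also have "\<dots> = ennreal (1 - swap_weight y) * \<Phi> y + ennreal (swap_weight y) * \<Phi> (prod.swap y)"
      unfolding \<Phi>_def nn_integral_cmult[OF Gz] ..
    finally show "ennreal (1 - swap_weight y) * \<Phi> y + ennreal (swap_weight y) * \<Phi> (prod.swap y)
      = (\<integral>\<^sup>+z. RHS (z(j := y)) \<partial>Pi\<^sub>M I \<mu>)" ..
  qed
  also have "\<dots> = (\<integral>\<^sup>+z. RHS z \<partial>Pi\<^sub>M (insert j I) \<mu>)"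
    by (rule product_nn_integral_insert_rev[symmetric]) (use insert.hyps RHS in simp_all)
  finally show ?case unfolding RHS_def w_def s_def .
qed


text \<open>Independence within each family and between the two vectors identifies the law of the
  vector of pairs as the product of the laws \<open>A i \<Otimes>\<^sub>M B i\<close>, tested on
  indicators by \<open>nn_integral_PiM_pair\<close>. Independence of the pairs and their marginals
  are read off from this product.\<close>

lemma (in prob_space) indep_vars_Pair:
  fixes X U :: "'i \<Rightarrow> 'a \<Rightarrow> real"
  assumes I: "finite I" "I \<noteq> {}"
    and X: "indep_vars (\<lambda>_. borel) X I" and U: "indep_vars (\<lambda>_. borel) U I"
    and XU: "indep_var (Pi\<^sub>M I (\<lambda>_. borel)) (\<lambda>\<omega>. \<lambda>i\<in>I. X i \<omega>) (Pi\<^sub>M I (\<lambda>_. borel)) (\<lambda>\<omega>. \<lambda>i\<in>I. U i \<omega>)"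
  shows "indep_vars (\<lambda>_. borel \<Otimes>\<^sub>M borel) (\<lambda>i \<omega>. (X i \<omega>, U i \<omega>)) I"
    and "i \<in> I \<Longrightarrow> distr M (borel \<Otimes>\<^sub>M borel) (\<lambda>\<omega>. (X i \<omega>, U i \<omega>)) = distr M borel (X i) \<Otimes>\<^sub>M distr M borel (U i)"
proof -
  have rvX: "random_variable borel (X i)" if "i \<in> I" for i using X that by (auto simp: indep_vars_def)
  have rvU: "random_variable borel (U i)" if "i \<in> I" for i using U that by (auto simp: indep_vars_def)
  \<comment> \<open>An index to fall back on outside \<open>I\<close>: the product arguments want a
    probability measure at every index.\<close>
  obtain i0 where i0: "i0 \<in> I" using I by blast
  define A where "A i = distr M borel (X (if i \<in> I then i else i0))" for i
  define B where "B i = distr M borel (U (if i \<in> I then i else i0))" for i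
  have AB: "prob_space (A i)" "prob_space (B i)" for i
    unfolding A_def B_def using rvX rvU i0 by (auto intro!: prob_space_distr)
  have sAB: "sets (A i) = sets borel" "sets (B i) = sets borel" for i by (auto simp: A_def B_def)
  have dX: "distr M (Pi\<^sub>M I (\<lambda>_. borel)) (\<lambda>\<omega>. \<lambda>i\<in>I. X i \<omega>) = Pi\<^sub>M I A"
    using X rvX by (subst (asm) indep_vars_iff_distr_eq_PiM'[OF I(2)]) (auto simp: A_def intro!: PiM_cong)
  have dU: "distr M (Pi\<^sub>M I (\<lambda>_. borel)) (\<lambda>\<omega>. \<lambda>i\<in>I. U i \<omega>) = Pi\<^sub>M I B"
    using U rvU by (subst (asm) indep_vars_iff_distr_eq_PiM'[OF I(2)]) (auto simp: B_def intro!: PiM_cong)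
  let ?S = "Pi\<^sub>M I (\<lambda>_. borel \<Otimes>\<^sub>M borel) :: ('i \<Rightarrow> real \<times> real) measure"
  let ?V = "\<lambda>\<omega>. \<lambda>i\<in>I. (X i \<omega>, U i \<omega>)"
  have rvV: "random_variable ?S ?V"
    using rvX rvU by (intro measurable_restrict measurable_Pair)
  have sS: "sets (Pi\<^sub>M I (\<lambda>i. A i \<Otimes>\<^sub>M B i)) = sets ?S"
    by (intro sets_PiM_cong refl sets_pair_measure_cong sAB)
  have merge: "(\<lambda>(x, u). \<lambda>i\<in>I. (x i, u i)) \<in> Pi\<^sub>M I (\<lambda>_. borel) \<Otimes>\<^sub>M Pi\<^sub>M I (\<lambda>_. borel) \<rightarrow>\<^sub>M ?S"
    by (auto intro!: measurable_restrict simp: case_prod_beta)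
  interpret PA: prob_space "Pi\<^sub>M I A" by (rule prob_space_PiM) (rule AB)
  interpret PB: prob_space "Pi\<^sub>M I B" by (rule prob_space_PiM) (rule AB)
  have vec: "distr M ?S ?V = Pi\<^sub>M I (\<lambda>i. A i \<Otimes>\<^sub>M B i)"
  proof (rule measure_eqI)
    show "sets (distr M ?S ?V) = sets (Pi\<^sub>M I (\<lambda>i. A i \<Otimes>\<^sub>M B i))" using sS by simp
    fix C assume "C \<in> sets (distr M ?S ?V)"
    then have C: "C \<in> sets ?S" by simp
    let ?f = "indicator C :: _ \<Rightarrow> ennreal"
    let ?g = "\<lambda>(x, u). ?f (\<lambda>i\<in>I. (x i, u i))"
    have f: "?f \<in> borel_measurable ?S" using C by simp
    have g: "?g \<in> borel_measurable (Pi\<^sub>M I (\<lambda>_. borel) \<Otimes>\<^sub>M Pi\<^sub>M I (\<lambda>_. borel))"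
      using measurable_compose[OF merge f] by (simp add: case_prod_beta')
    have rvX': "random_variable (Pi\<^sub>M I (\<lambda>_. borel)) (\<lambda>\<omega>. \<lambda>i\<in>I. X i \<omega>)"
      and rvU': "random_variable (Pi\<^sub>M I (\<lambda>_. borel)) (\<lambda>\<omega>. \<lambda>i\<in>I. U i \<omega>)"
      using XU by (auto simp: indep_var_distribution_eq)
    have joint: "distr M (Pi\<^sub>M I (\<lambda>_. borel) \<Otimes>\<^sub>M Pi\<^sub>M I (\<lambda>_. borel)) (\<lambda>\<omega>. (\<lambda>i\<in>I. X i \<omega>, \<lambda>i\<in>I. U i \<omega>))
        = Pi\<^sub>M I A \<Otimes>\<^sub>M Pi\<^sub>M I B"
      using XU unfolding indep_var_distribution_eq dX dU by simp
    have "emeasure (distr M ?S ?V) C = (\<integral>\<^sup>+\<omega>. ?f (?V \<omega>) \<partial>M)"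
      using nn_integral_distr[OF rvV, of ?f] f C by simp
    also have "\<dots> = (\<integral>\<^sup>+\<omega>. ?g (\<lambda>i\<in>I. X i \<omega>, \<lambda>i\<in>I. U i \<omega>) \<partial>M)"
      by (intro nn_integral_cong) (auto intro!: arg_cong[where f = ?f] simp: fun_eq_iff)
    also have "\<dots> = (\<integral>\<^sup>+q. ?g q \<partial>(Pi\<^sub>M I A \<Otimes>\<^sub>M Pi\<^sub>M I B))"
      unfolding joint[symmetric] using g rvX' rvU' by (intro nn_integral_distr[symmetric]) auto
    also have "\<dots> = (\<integral>\<^sup>+x. \<integral>\<^sup>+u. ?g (x, u) \<partial>Pi\<^sub>M I B \<partial>Pi\<^sub>M I A)"
    proof (rule sigma_finite_measure.nn_integral_fst[OF PB.sigma_finite_measure_axioms, symmetric])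
      have "sets (Pi\<^sub>M I A \<Otimes>\<^sub>M Pi\<^sub>M I B) = sets (Pi\<^sub>M I (\<lambda>_. borel) \<Otimes>\<^sub>M Pi\<^sub>M I (\<lambda>_. borel))"
        by (intro sets_pair_measure_cong sets_PiM_cong refl sAB)
      then show "?g \<in> borel_measurable (Pi\<^sub>M I A \<Otimes>\<^sub>M Pi\<^sub>M I B)" using g by (simp cong: measurable_cong_sets)
    qed
    also have "\<dots> = (\<integral>\<^sup>+z. ?f z \<partial>Pi\<^sub>M I (\<lambda>i. A i \<Otimes>\<^sub>M B i))"
      unfolding prod.case using f sS by (intro nn_integral_PiM_pair I AB) (simp cong: measurable_cong_sets)
    also have "\<dots> = emeasure (Pi\<^sub>M I (\<lambda>i. A i \<Otimes>\<^sub>M B i)) C" using C sS by simp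
    finally show "emeasure (distr M ?S ?V) C = emeasure (Pi\<^sub>M I (\<lambda>i. A i \<Otimes>\<^sub>M B i)) C" .
  qed
  have pAB: "prob_space (A i \<Otimes>\<^sub>M B i)" for i
  proof -
    interpret pair_prob_space "A i" "B i"
      by (simp add: pair_prob_space_def pair_sigma_finite_def AB prob_space_imp_sigma_finite)
    show ?thesis by (rule prob_space_axioms)
  qed
  have marg: "distr M (borel \<Otimes>\<^sub>M borel) (\<lambda>\<omega>. (X i \<omega>, U i \<omega>)) = A i \<Otimes>\<^sub>M B i" if i: "i \<in> I" for i
  proof -
    have s: "sets (A i \<Otimes>\<^sub>M B i) = sets (borel \<Otimes>\<^sub>M borel)" by (intro sets_pair_measure_cong sAB)
    have "A i \<Otimes>\<^sub>M B i = distr (Pi\<^sub>M I (\<lambda>i. A i \<Otimes>\<^sub>M B i)) (A i \<Otimes>\<^sub>M B i) (\<lambda>z. z i)"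
      by (rule distr_PiM_component[symmetric]) (use pAB i in auto)
    also have "\<dots> = distr (distr M ?S ?V) (borel \<Otimes>\<^sub>M borel) (\<lambda>z. z i)"
      unfolding vec by (rule distr_cong) (auto simp: s)
    also have "\<dots> = distr M (borel \<Otimes>\<^sub>M borel) (\<lambda>\<omega>. ?V \<omega> i)"
      using rvV i by (subst distr_distr) (auto simp: o_def)
    finally show ?thesis using i by simp
  qed
  show "indep_vars (\<lambda>_. borel \<Otimes>\<^sub>M borel) (\<lambda>i \<omega>. (X i \<omega>, U i \<omega>)) I"
  proof (subst indep_vars_iff_distr_eq_PiM'[OF I(2)])
    show "distr M ?S ?V = Pi\<^sub>M I (\<lambda>i. distr M (borel \<Otimes>\<^sub>M borel) (\<lambda>\<omega>. (X i \<omega>, U i \<omega>)))"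
      unfolding vec by (intro PiM_cong refl) (simp add: marg)
  qed (use rvX rvU in auto)
  show "distr M (borel \<Otimes>\<^sub>M borel) (\<lambda>\<omega>. (X i \<omega>, U i \<omega>)) = distr M borel (X i) \<Otimes>\<^sub>M distr M borel (U i)" if "i \<in> I"
    using marg[OF that] that by (simp add: A_def B_def)
qed

lemma two_point_expectation_scale:
  "two_point_expectation I \<alpha> x y (\<lambda>s. \<phi> (s / c)) = two_point_expectation I \<alpha> (\<lambda>i. x i / c) (\<lambda>i. y i / c) \<phi>"
proof -
  have "(\<Sum>i\<in>I. if i \<in> A then x i else y i) / c = (\<Sum>i\<in>I. if i \<in> A then x i / c else y i / c)" for A
    by (subst sum_divide_distrib) (auto intro!: sum.cong)
  then show ?thesis unfolding two_point_expectation_def by simp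
qed

section \<open>The self-normalized sum as a mixture of two-point sums\<close>

definition self_normalized_sum :: "nat \<Rightarrow> real \<Rightarrow> (nat \<Rightarrow> real \<times> real) \<Rightarrow> real" where
  "self_normalized_sum n l z = (\<Sum>i\<in>{1..n}. fst (z i)) / (\<Sum>i\<in>{1..n}. \<bar>fst (z i) * snd (z i)\<bar> powr l) powr (1 / (2 * l))"

locale reciprocal_family = prob_space M for M :: "'a measure" +
  fixes n :: nat and X U :: "nat \<Rightarrow> 'a \<Rightarrow> real"
  assumes family: "zero_mean_unif_family M n X U" and n: "1 \<le> n"
begin

text \<open>Outside the index range the law of \<open>X 1\<close> is used, so that every
  \<open>law i\<close> is a centred distribution; this needs \<open>n >= 1\<close>.\<close>

definition "law i = distr M borel (X (if i \<in> {1..n} then i else 1))"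

lemma rvX: "i \<in> {1..n} \<Longrightarrow> random_variable borel (X i)"
  using family by (auto simp: zero_mean_unif_family_def indep_vars_def)

lemma rvU: "i \<in> {1..n} \<Longrightarrow> random_variable borel (U i)"
  using family by (auto simp: zero_mean_unif_family_def indep_vars_def)

lemma centered_law: "centered_distribution (law i)"
proof -
  define j where "j = (if i \<in> {1..n} then i else 1)"
  have j: "j \<in> {1..n}" using n by (auto simp: j_def)
  have lj: "law i = distr M borel (X j)" by (simp add: law_def j_def)
  have X: "integrable M (X j)" "integral\<^sup>L M (X j) = 0"
    using family j by (auto simp: zero_mean_unif_family_def)
  have "real_distribution (law i)" unfolding lj using rvX[OF j] by (rule real_distribution_distr)
  moreover have "integrable (law i) (\<lambda>x. x)" unfolding lj using X rvX[OF j] by (subst integrable_distr_eq) auto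
  moreover have "(\<integral>x. x \<partial>law i) = 0" unfolding lj using X rvX[OF j] by (subst integral_distr) auto
  ultimately show ?thesis
    by (intro centered_distribution.intro integrable_distribution.intro integrable_distribution_axioms.intro
        centered_distribution_axioms.intro)
qed

definition "R i \<omega> = centered_distribution.real_recip (law i) (X i \<omega>, U i \<omega>)"
definition "pair_law i = centered_distribution.recip_law (law i)"

lemma pair_distr:
  assumes i: "i \<in> {1..n}"
  shows "distr M (borel \<Otimes>\<^sub>M borel) (\<lambda>\<omega>. (X i \<omega>, U i \<omega>)) = law i \<Otimes>\<^sub>M unit_uniform"
  using family indep_vars_Pair(2)[of "{1..n}" X U i] n i by (auto simp: zero_mean_unif_family_def law_def)

lemma indep_pairs: "indep_vars (\<lambda>_. borel \<Otimes>\<^sub>M borel) (\<lambda>i \<omega>. (X i \<omega>, U i \<omega>)) {1..n}"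
  using family n by (intro indep_vars_Pair(1)) (auto simp: zero_mean_unif_family_def)

lemma measurable_recip_map:
  "(\<lambda>z. (fst z, centered_distribution.real_recip (law i) z)) \<in> borel \<Otimes>\<^sub>M borel \<rightarrow>\<^sub>M borel \<Otimes>\<^sub>M borel"
proof -
  interpret C: centered_distribution "law i" by (rule centered_law)
  show ?thesis by measurable
qed

lemma rvXU: "i \<in> {1..n} \<Longrightarrow> (\<lambda>\<omega>. (X i \<omega>, U i \<omega>)) \<in> M \<rightarrow>\<^sub>M borel \<Otimes>\<^sub>M borel"
  using rvX rvU by (intro measurable_Pair)

lemma rvXR: "i \<in> {1..n} \<Longrightarrow> (\<lambda>\<omega>. (X i \<omega>, R i \<omega>)) \<in> M \<rightarrow>\<^sub>M borel \<Otimes>\<^sub>M borel"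
  using measurable_compose[OF rvXU measurable_recip_map, of i i] by (simp add: R_def)

lemma recip_pair_distr:
  assumes i: "i \<in> {1..n}"
  shows "distr M (borel \<Otimes>\<^sub>M borel) (\<lambda>\<omega>. (X i \<omega>, R i \<omega>)) = pair_law i"
proof -
  interpret C: centered_distribution "law i" by (rule centered_law)
  have "pair_law i = distr (distr M (borel \<Otimes>\<^sub>M borel) (\<lambda>\<omega>. (X i \<omega>, U i \<omega>))) (borel \<Otimes>\<^sub>M borel)
      (\<lambda>z. (fst z, centered_distribution.real_recip (law i) z))"
    unfolding pair_law_def C.recip_law_def pair_distr[OF i] ..
  also have "\<dots> = distr M (borel \<Otimes>\<^sub>M borel) (\<lambda>\<omega>. (X i \<omega>, R i \<omega>))"
    unfolding distr_distr[OF measurable_recip_map rvXU[OF i]] by (simp add: o_def R_def)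
  finally show ?thesis ..
qed

lemma vector_distr:
  "distr M (Pi\<^sub>M {1..n} (\<lambda>_. borel \<Otimes>\<^sub>M borel)) (\<lambda>\<omega>. \<lambda>i\<in>{1..n}. (X i \<omega>, R i \<omega>)) = Pi\<^sub>M {1..n} pair_law"
proof -
  have "indep_vars (\<lambda>_. borel \<Otimes>\<^sub>M borel) (\<lambda>i \<omega>. (fst (X i \<omega>, U i \<omega>), centered_distribution.real_recip (law i) (X i \<omega>, U i \<omega>))) {1..n}"
    by (rule indep_vars_compose2[OF indep_pairs measurable_recip_map])
  then have "indep_vars (\<lambda>_. borel \<Otimes>\<^sub>M borel) (\<lambda>i \<omega>. (X i \<omega>, R i \<omega>)) {1..n}" by (simp add: R_def)
  then have "distr M (Pi\<^sub>M {1..n} (\<lambda>_. borel \<Otimes>\<^sub>M borel)) (\<lambda>\<omega>. \<lambda>i\<in>{1..n}. (X i \<omega>, R i \<omega>))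
      = Pi\<^sub>M {1..n} (\<lambda>i. distr M (borel \<Otimes>\<^sub>M borel) (\<lambda>\<omega>. (X i \<omega>, R i \<omega>)))"
    by (subst (asm) indep_vars_iff_distr_eq_PiM') (use n rvXR in auto)
  also have "\<dots> = Pi\<^sub>M {1..n} pair_law" by (intro PiM_cong refl recip_pair_distr)
  finally show ?thesis .
qed

text \<open>On \<open>X i = 0\<close> the real version of the reciprocal is 0, and elsewhere it
  agrees almost surely with \<open>recip_rv\<close> and has the sign opposite to \<open>X i\<close>.
  In both cases \<open>Y_rv\<close> is \<open>\<bar>X i * R i\<bar>\<close>.\<close>

lemma AE_recip_rv:
  assumes i: "i \<in> {1..n}"
  shows "AE \<omega> in M. (X i \<omega> = 0 \<and> R i \<omega> = 0) \<or> (recip_rv M X U i \<omega> = ereal (R i \<omega>) \<and> X i \<omega> * R i \<omega> < 0)"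
proof -
  interpret C: centered_distribution "law i" by (rule centered_law)
  have "AE z in distr M (borel \<Otimes>\<^sub>M borel) (\<lambda>\<omega>. (X i \<omega>, U i \<omega>)). fst z \<noteq> 0 \<longrightarrow>
     recip (law i) (ereal (fst z)) (snd z) = ereal (C.real_recip z) \<and> fst z * C.real_recip z < 0"
    unfolding pair_distr[OF i] by (rule C.AE_recip)
  from AE_distrD[OF rvXU[OF i] this] show ?thesis
  proof eventually_elim
    case (elim \<omega>)
    have "law i = distr M borel (X i)" using i by (simp add: law_def)
    moreover have "R i \<omega> = 0" if "X i \<omega> = 0" using that by (simp add: R_def C.real_recip_def)
    ultimately show ?case using elim by (cases "X i \<omega> = 0") (auto simp: R_def recip_rv_def)
  qed
qed

lemma AE_S_Y:
  "AE \<omega> in M. S_Y M n X U l \<omega> = self_normalized_sum n l (\<lambda>i\<in>{1..n}. (X i \<omega>, R i \<omega>))"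
proof -
  have "AE \<omega> in M. \<forall>i\<in>{1..n}. Y_rv M X U i \<omega> = \<bar>X i \<omega> * R i \<omega>\<bar>"
  proof (rule AE_finite_allI)
    fix i assume i: "i \<in> {1..n}"
    show "AE \<omega> in M. Y_rv M X U i \<omega> = \<bar>X i \<omega> * R i \<omega>\<bar>"
      using AE_recip_rv[OF i] by eventually_elim (auto simp: Y_rv_def zero_ereal_def[symmetric])
  qed simp
  then show ?thesis by eventually_elim (simp add: S_Y_def self_normalized_sum_def)
qed

lemma measurable_self_normalized_sum:
  "self_normalized_sum n l \<in> borel_measurable (Pi\<^sub>M {1..n} (\<lambda>_. borel \<Otimes>\<^sub>M borel))"
  unfolding self_normalized_sum_def by measurable

lemma nn_integral_S_Y:
  assumes f[measurable]: "f \<in> borel_measurable borel"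
  shows "(\<integral>\<^sup>+\<omega>. ennreal (f (S_Y M n X U l \<omega>)) \<partial>M) = (\<integral>\<^sup>+z. ennreal (f (self_normalized_sum n l z)) \<partial>Pi\<^sub>M {1..n} pair_law)"
proof -
  note measurable_self_normalized_sum[measurable]
  have "(\<integral>\<^sup>+\<omega>. ennreal (f (S_Y M n X U l \<omega>)) \<partial>M)
      = (\<integral>\<^sup>+\<omega>. ennreal (f (self_normalized_sum n l (\<lambda>i\<in>{1..n}. (X i \<omega>, R i \<omega>)))) \<partial>M)"
    by (rule nn_integral_cong_AE) (use AE_S_Y[of l] in \<open>auto elim!: eventually_mono\<close>)
  also have "\<dots> = (\<integral>\<^sup>+z. ennreal (f (self_normalized_sum n l z)) \<partial>Pi\<^sub>M {1..n} pair_law)"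
    unfolding vector_distr[symmetric]
  proof (rule nn_integral_distr[symmetric])
    show "(\<lambda>\<omega>. \<lambda>i\<in>{1..n}. (X i \<omega>, R i \<omega>)) \<in> M \<rightarrow>\<^sub>M Pi\<^sub>M {1..n} (\<lambda>_. borel \<Otimes>\<^sub>M borel)"
      by (rule measurable_restrict[OF rvXR])
  qed measurable
  finally show ?thesis .
qed

text \<open>The self-normalization is designed for this step: the denominator depends on a pair only
  through the product of its entries, hence is unaffected by swaps. It becomes a constant
  \<open>D z\<close> once the unordered pairs are fixed, and only the numerator is averaged.\<close>

lemma nn_integral_S_Y_two_point:
  fixes l :: real and f :: "real \<Rightarrow> real"
  assumes f[measurable]: "f \<in> borel_measurable borel" and f0: "\<And>x. 0 \<le> f x"
  defines "D z \<equiv> (\<Sum>i\<in>{1..n}. \<bar>fst (z i) * snd (z i)\<bar> powr l) powr (1 / (2 * l))"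
  shows "(\<integral>\<^sup>+\<omega>. ennreal (f (S_Y M n X U l \<omega>)) \<partial>M)
     = (\<integral>\<^sup>+z. ennreal (two_point_expectation {1..n} (\<lambda>i. 1 - swap_weight (z i))
            (\<lambda>i. fst (z i) / D z) (\<lambda>i. snd (z i) / D z) f) \<partial>Pi\<^sub>M {1..n} pair_law)"
proof -
  note measurable_self_normalized_sum[measurable]
  let ?F = "\<lambda>z. ennreal (f (self_normalized_sum n l z))"
  have F: "?F \<in> borel_measurable (Pi\<^sub>M {1..n} (\<lambda>_. borel \<Otimes>\<^sub>M borel))" by measurable
  have "(\<integral>\<^sup>+z. ?F z \<partial>Pi\<^sub>M {1..n} pair_law)
     = (\<integral>\<^sup>+z. (\<Sum>A\<in>Pow {1..n}. (\<Prod>i\<in>{1..n}. ennreal (if i \<in> A then 1 - swap_weight (z i) else swap_weight (z i)))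
          * ?F (\<lambda>i\<in>{1..n}. if i \<in> A then z i else prod.swap (z i))) \<partial>Pi\<^sub>M {1..n} pair_law)"
  proof (rule nn_integral_PiM_symmetrize)
    show "prob_space (pair_law i)" "sets (pair_law i) = sets (borel \<Otimes>\<^sub>M borel)" for i
      unfolding pair_law_def
      using centered_distribution.prob_space_recip_law[OF centered_law]
        centered_distribution.sets_recip_law[OF centered_law] by auto
    show "(\<integral>\<^sup>+z. \<Phi> z \<partial>pair_law i)
        = (\<integral>\<^sup>+z. ennreal (1 - swap_weight z) * \<Phi> z + ennreal (swap_weight z) * \<Phi> (prod.swap z) \<partial>pair_law i)"
      if "\<Phi> \<in> borel_measurable (borel \<Otimes>\<^sub>M borel)" for i \<Phi>
      unfolding pair_law_def by (rule centered_distribution.recip_law_symmetrize[OF centered_law that])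
  qed (use F in auto)
  also have "\<dots> = (\<integral>\<^sup>+z. ennreal (two_point_expectation {1..n} (\<lambda>i. 1 - swap_weight (z i))
            (\<lambda>i. fst (z i) / D z) (\<lambda>i. snd (z i) / D z) f) \<partial>Pi\<^sub>M {1..n} pair_law)"
  proof (rule nn_integral_cong)
    fix z :: "nat \<Rightarrow> real \<times> real"
    have Fz: "self_normalized_sum n l (\<lambda>i\<in>{1..n}. if i \<in> A then z i else prod.swap (z i))
        = (\<Sum>i\<in>{1..n}. if i \<in> A then fst (z i) / D z else snd (z i) / D z)" for A
    proof -
      have "(\<Sum>i\<in>{1..n}. fst ((\<lambda>i\<in>{1..n}. if i \<in> A then z i else prod.swap (z i)) i))
          = (\<Sum>i\<in>{1..n}. if i \<in> A then fst (z i) else snd (z i))"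
        by (intro sum.cong) auto
      moreover have "(\<Sum>i\<in>{1..n}. \<bar>fst ((\<lambda>i\<in>{1..n}. if i \<in> A then z i else prod.swap (z i)) i)
            * snd ((\<lambda>i\<in>{1..n}. if i \<in> A then z i else prod.swap (z i)) i)\<bar> powr l) = (\<Sum>i\<in>{1..n}. \<bar>fst (z i) * snd (z i)\<bar> powr l)"
        by (intro sum.cong) (auto simp: mult.commute)
      moreover have "(\<Sum>i\<in>{1..n}. if i \<in> A then fst (z i) else snd (z i)) / D z
          = (\<Sum>i\<in>{1..n}. if i \<in> A then fst (z i) / D z else snd (z i) / D z)"
        by (subst sum_divide_distrib) (auto intro!: sum.cong)
      ultimately show ?thesis unfolding self_normalized_sum_def D_def by simp
    qed
    have w: "0 \<le> (if i \<in> A then 1 - swap_weight (z i) else swap_weight (z i))" for i A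
      using swap_weight_bounds[of "z i"] by auto
    have P: "(\<Prod>i\<in>{1..n}. ennreal (if i \<in> A then 1 - swap_weight (z i) else swap_weight (z i)))
        = ennreal (\<Prod>i\<in>{1..n}. if i \<in> A then 1 - swap_weight (z i) else 1 - (1 - swap_weight (z i)))" for A
      by (subst prod_ennreal) (use swap_weight_bounds in \<open>auto intro!: arg_cong[where f = ennreal] prod.cong\<close>)
    have w': "0 \<le> (\<Prod>i\<in>{1..n}. if i \<in> A then 1 - swap_weight (z i) else 1 - (1 - swap_weight (z i)))" for A
      using swap_weight_bounds by (intro prod_nonneg) auto
    show "(\<Sum>A\<in>Pow {1..n}. (\<Prod>i\<in>{1..n}. ennreal (if i \<in> A then 1 - swap_weight (z i) else swap_weight (z i)))
          * ?F (\<lambda>i\<in>{1..n}. if i \<in> A then z i else prod.swap (z i)))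
      = ennreal (two_point_expectation {1..n} (\<lambda>i. 1 - swap_weight (z i)) (\<lambda>i. fst (z i) / D z) (\<lambda>i. snd (z i) / D z) f)"
      unfolding two_point_expectation_def Fz P
      by (subst sum_ennreal[symmetric]) (use w' f0 in \<open>auto simp: ennreal_mult' intro!: mult_nonneg_nonneg\<close>)
  qed
  finally show ?thesis unfolding nn_integral_S_Y[OF f] .
qed

end

text \<open>Passage to an orientation with nonnegative \<open>x i\<close> and nonpositive
  \<open>y i\<close>, as the two-point comparison expects. The weight \<open>1 - swap_weight\<close>
  belongs to whichever entry stands first, so the underlying two-point variables do not
  change.\<close>

lemma two_point_expectation_flip_le:
  assumes I: "finite I" and z: "\<And>i. i \<in> I \<Longrightarrow> (fst (z i) = 0 \<and> snd (z i) = 0) \<or> fst (z i) * snd (z i) < 0"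
  defines "x i \<equiv> max (fst (z i)) (snd (z i))" and "y i \<equiv> min (fst (z i)) (snd (z i))"
  shows "two_point_expectation I (\<lambda>i. 1 - swap_weight (z i)) (\<lambda>i. fst (z i) / D) (\<lambda>i. snd (z i) / D) f
     \<le> two_point_expectation I (\<lambda>i. - y i / (x i - y i)) (\<lambda>i. x i / D) (\<lambda>i. y i / D) f"
proof (rule two_point_expectation_replace_all[OF I])
  fix i assume i: "i \<in> I"
  show "0 \<le> 1 - swap_weight (z i)" "1 - swap_weight (z i) \<le> 1" using swap_weight_bounds[of "z i"] by auto
  consider "fst (z i) = 0" "snd (z i) = 0" | "0 < fst (z i)" "snd (z i) < 0" | "fst (z i) < 0" "0 < snd (z i)"
    using z[OF i] by (auto simp: mult_less_0_iff)
  note cases = this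
  have xy: "(x i = 0 \<and> y i = 0) \<or> (0 < x i \<and> y i < 0)"
    using cases by cases (auto simp: x_def y_def)
  then show "0 \<le> - y i / (x i - y i)" "- y i / (x i - y i) \<le> 1" by (auto simp: field_simps)
  show "(1 - swap_weight (z i)) * f (fst (z i) / D + s) + (1 - (1 - swap_weight (z i))) * f (snd (z i) / D + s)
      \<le> - y i / (x i - y i) * f (x i / D + s) + (1 - - y i / (x i - y i)) * f (y i / D + s)" for s
    using cases
  proof cases
    case 2
    have "1 - swap_weight (z i) = - y i / (x i - y i)" using 2 by (simp add: swap_weight_def x_def y_def field_simps)
    then show ?thesis using 2 by (simp add: x_def y_def)
  next
    case 3
    have "swap_weight (z i) = - y i / (x i - y i)" using 3 by (simp add: swap_weight_def x_def y_def field_simps)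
    then show ?thesis using 3 by (simp add: x_def y_def)
  qed (simp add: x_def y_def algebra_simps)
qed

context reciprocal_family
begin

lemma AE_pair_law_iff:
  assumes "i \<in> {1..n}" and "{z. P z} \<in> sets (borel \<Otimes>\<^sub>M borel)"
  shows "(AE z in pair_law i. P z) \<longleftrightarrow> (AE \<omega> in M. P (X i \<omega>, R i \<omega>))"
  unfolding recip_pair_distr[OF assms(1), symmetric]
  by (rule AE_distr_iff[OF rvXR[OF assms(1)]]) (use assms(2) in \<open>simp add: space_pair_measure\<close>)

lemma AE_pair_law_sign:
  assumes i: "i \<in> {1..n}"
  shows "AE z in pair_law i. (fst z = 0 \<and> snd z = 0) \<or> fst z * snd z < 0"
proof (subst AE_pair_law_iff[OF i])
  have "{z \<in> space (borel \<Otimes>\<^sub>M borel). (fst z = 0 \<and> snd z = 0) \<or> fst z * snd z < (0::real)} \<in> sets (borel \<Otimes>\<^sub>M borel)" by measurable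
  then show "{z. (fst z = 0 \<and> snd z = 0) \<or> fst z * snd z < (0::real)} \<in> sets (borel \<Otimes>\<^sub>M borel)" by (simp add: space_pair_measure)
  show "AE \<omega> in M. (fst (X i \<omega>, R i \<omega>) = 0 \<and> snd (X i \<omega>, R i \<omega>) = 0) \<or> fst (X i \<omega>, R i \<omega>) * snd (X i \<omega>, R i \<omega>) < 0"
    using AE_recip_rv[OF i] by eventually_elim auto
qed

text \<open>By exchangeability, what holds almost surely for \<open>(X, R)\<close> on \<open>X \<noteq> 0\<close> also holds for \<open>(R, X)\<close>.\<close>

lemma AE_pair_law_swap:
  assumes i: "i \<in> {1..n}" and P: "{z. P z} \<in> sets (borel \<Otimes>\<^sub>M borel)" and ae: "AE z in pair_law i. P z"
  shows "AE z in pair_law i. fst z \<noteq> 0 \<longrightarrow> P (prod.swap z)"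
proof -
  interpret C: centered_distribution "law i" by (rule centered_law)
  have [measurable]: "Measurable.pred (borel \<Otimes>\<^sub>M borel) P" using P by (simp add: pred_def space_pair_measure)
  let ?\<Psi> = "\<lambda>z. if P z then 0 else 1 :: ennreal"
  have m: "?\<Psi> \<in> borel_measurable (borel \<Otimes>\<^sub>M borel)" by measurable
  have ms: "(\<lambda>z. ennreal \<bar>fst z\<bar> * ?\<Psi> (prod.swap z)) \<in> borel_measurable (pair_law i)"
    unfolding pair_law_def prod.swap_def by measurable
  have "(\<integral>\<^sup>+z. ennreal \<bar>fst z\<bar> * ?\<Psi> z \<partial>pair_law i) = (\<integral>\<^sup>+z. 0 \<partial>pair_law i)"
    by (rule nn_integral_cong_AE) (use ae in \<open>auto elim!: eventually_mono\<close>)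
  then have "(\<integral>\<^sup>+z. ennreal \<bar>fst z\<bar> * ?\<Psi> (prod.swap z) \<partial>pair_law i) = 0"
    using C.recip_law_exchange[OF m] unfolding pair_law_def by simp
  then have "AE z in pair_law i. ennreal \<bar>fst z\<bar> * ?\<Psi> (prod.swap z) = 0"
    using nn_integral_0_iff_AE[OF ms] by simp
  then show ?thesis by eventually_elim (auto split: if_splits)
qed

text \<open>The assumption controls the ratio only where \<open>X > 0\<close>. Where
  \<open>X < 0\<close> it is the reciprocal that is positive, and the bound is transported there by
  exchangeability; so it holds for the unordered pair.\<close>

lemma AE_pair_law_ratio:
  assumes i: "i \<in> {1..n}" and p: "0 < p" "p < 1" and bound: "recip_ratio_bound M n X U p"
  shows "AE z in pair_law i. max (fst z) (snd z) \<le> (1 - p) / p * - min (fst z) (snd z)"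
proof -
  have c: "0 < (1 - p) / p" using p by simp
  let ?P = "\<lambda>z. 0 < fst z \<longrightarrow> fst z \<le> (1 - p) / p * \<bar>snd z\<bar>"
  have "{z \<in> space (borel \<Otimes>\<^sub>M borel). ?P z} \<in> sets (borel \<Otimes>\<^sub>M borel)" by measurable
  then have P: "{z. ?P z} \<in> sets (borel \<Otimes>\<^sub>M borel)" by (simp add: space_pair_measure)
  have "AE \<omega> in M. (if X i \<omega> > 0 then ereal (X i \<omega>) / \<bar>recip_rv M X U i \<omega>\<bar> else 0) \<le> ereal ((1 - p) / p)"
    using bound i by (auto simp: recip_ratio_bound_def)
  with AE_recip_rv[OF i] have "AE \<omega> in M. ?P (X i \<omega>, R i \<omega>)"
  proof eventually_elim
    case (elim \<omega>)
    show ?case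
    proof (cases "0 < X i \<omega>")
      case True
      then have r: "recip_rv M X U i \<omega> = ereal (R i \<omega>)" "R i \<omega> < 0" using elim(1) by (auto simp: mult_less_0_iff)
      then have "X i \<omega> / \<bar>R i \<omega>\<bar> \<le> (1 - p) / p" using elim(2) True by simp
      then have "X i \<omega> \<le> (1 - p) / p * \<bar>R i \<omega>\<bar>" using r by (subst (asm) pos_divide_le_eq) auto
      then show ?thesis by simp
    qed simp
  qed
  then have ae: "AE z in pair_law i. ?P z" unfolding AE_pair_law_iff[OF i P] .
  show ?thesis
    using ae AE_pair_law_swap[OF i P ae] AE_pair_law_sign[OF i]
  proof eventually_elim
    case (elim z)
    then consider "fst z = 0" "snd z = 0" | "0 < fst z" "snd z < 0" | "fst z < 0" "0 < snd z"
      by (auto simp: mult_less_0_iff)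
    then show ?case using elim by cases auto
  qed
qed

theorem nn_integral_S_Y_le:
  assumes p: "0 < p" "p < 1" and bound: "recip_ratio_bound M n X U p" and l: "lambda_star p \<le> l" and f: "f \<in> H_plus 3"
  defines "w \<equiv> (1 / real n) powr (1 / (2 * l))" and "v \<equiv> sqrt ((1 - p) / p)"
  shows "(\<integral>\<^sup>+\<omega>. ennreal (f (S_Y M n X U l \<omega>)) \<partial>M)
     \<le> ennreal (two_point_expectation {1..n} (\<lambda>_. p) (\<lambda>_. w * v) (\<lambda>_. - w / v) f)"
proof -
  have f0: "0 \<le> f x" for x using H_plus_nonneg[OF f] by simp
  note fm = H_plus_3_measurable[OF f]
  define D where "D z = (\<Sum>i\<in>{1..n}. \<bar>fst (z i) * snd (z i)\<bar> powr l) powr (1 / (2 * l))" for z :: "nat \<Rightarrow> real \<times> real"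
  let ?E = "\<lambda>z. two_point_expectation {1..n} (\<lambda>i. 1 - swap_weight (z i)) (\<lambda>i. fst (z i) / D z) (\<lambda>i. snd (z i) / D z) f"
  let ?B = "two_point_expectation {1..n} (\<lambda>_. p) (\<lambda>_. w * v) (\<lambda>_. - w / v) f"
  have prob: "prob_space (pair_law i)" for i
    unfolding pair_law_def using centered_distribution.prob_space_recip_law[OF centered_law] .
  interpret PM: prob_space "Pi\<^sub>M {1..n} pair_law" by (rule prob_space_PiM) (rule prob)
  have "AE z in Pi\<^sub>M {1..n} pair_law. \<forall>i\<in>{1..n}. ((fst (z i) = 0 \<and> snd (z i) = 0) \<or> fst (z i) * snd (z i) < 0)
      \<and> max (fst (z i)) (snd (z i)) \<le> (1 - p) / p * - min (fst (z i)) (snd (z i))"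
  proof (rule AE_finite_allI)
    fix i assume i: "i \<in> {1..n}"
    show "AE z in Pi\<^sub>M {1..n} pair_law. ((fst (z i) = 0 \<and> snd (z i) = 0) \<or> fst (z i) * snd (z i) < 0)
      \<and> max (fst (z i)) (snd (z i)) \<le> (1 - p) / p * - min (fst (z i)) (snd (z i))"
      using AE_pair_law_sign[OF i] AE_pair_law_ratio[OF i p bound]
      by (intro AE_PiM_component[OF prob i]) (rule AE_conjI)
  qed simp
  then have le: "AE z in Pi\<^sub>M {1..n} pair_law. ennreal (?E z) \<le> ennreal ?B"
  proof eventually_elim
    case (elim z)
    define x where "x i = max (fst (z i)) (snd (z i))" for i
    define y where "y i = min (fst (z i)) (snd (z i))" for i
    have xy: "(x i = 0 \<and> y i = 0) \<or> (0 < x i \<and> y i < 0 \<and> x i / (- y i) \<le> (1 - p) / p)" if i: "i \<in> {1..n}" for i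
    proof -
      have "(fst (z i) = 0 \<and> snd (z i) = 0) \<or> fst (z i) * snd (z i) < 0" using elim i by blast
      then consider "fst (z i) = 0" "snd (z i) = 0" | "0 < fst (z i)" "snd (z i) < 0" | "fst (z i) < 0" "0 < snd (z i)"
        by (auto simp: mult_less_0_iff)
      then have "(x i = 0 \<and> y i = 0) \<or> (0 < x i \<and> y i < 0)" by cases (auto simp: x_def y_def)
      moreover have "x i \<le> (1 - p) / p * - y i" using elim i unfolding x_def y_def by blast
      ultimately show ?thesis using pos_divide_le_eq[of "- y i" "x i" "(1 - p) / p"] by auto
    qed
    have Dz: "D z = (\<Sum>i\<in>{1..n}. (x i * - y i) powr l) powr (1 / (2 * l))"
    proof -
      have "\<bar>fst (z i) * snd (z i)\<bar> = x i * - y i" if i: "i \<in> {1..n}" for i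
      proof -
        have "fst (z i) * snd (z i) = x i * y i" by (simp add: x_def y_def max_def min_def)
        moreover have "x i * y i \<le> 0" using xy[OF i] by (auto simp: mult_le_0_iff)
        ultimately show ?thesis by simp
      qed
      then show ?thesis unfolding D_def by simp
    qed
    have "?E z \<le> two_point_expectation {1..n} (\<lambda>i. - y i / (x i - y i)) (\<lambda>i. x i / D z) (\<lambda>i. y i / D z) f"
      unfolding x_def y_def by (rule two_point_expectation_flip_le) (use elim in auto)
    also have "\<dots> \<le> ?B"
      using self_normalized_two_point_le_bernoulli[OF p l, of "{1..n}" x y f] xy n f unfolding Dz w_def v_def by simp
    finally show ?case by (rule ennreal_leI)
  qed
  have "(\<integral>\<^sup>+\<omega>. ennreal (f (S_Y M n X U l \<omega>)) \<partial>M) = (\<integral>\<^sup>+z. ennreal (?E z) \<partial>Pi\<^sub>M {1..n} pair_law)"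
    unfolding D_def by (rule nn_integral_S_Y_two_point[OF fm f0])
  also have "\<dots> \<le> (\<integral>\<^sup>+z. ennreal ?B \<partial>Pi\<^sub>M {1..n} pair_law)" by (rule nn_integral_mono_AE[OF le])
  also have "\<dots> = ennreal ?B" using PM.emeasure_space_1 by simp
  finally show ?thesis .
qed

end

section \<open>Sums of standardized Bernoulli variables\<close>

lemma nn_integral_std_bernoulli:
  assumes p: "0 < p" "p < 1" and f: "f \<in> borel_measurable borel"
  shows "(\<integral>\<^sup>+x. f x \<partial>std_bernoulli p)
    = ennreal p * f (sqrt ((1 - p) / p)) + ennreal (1 - p) * f (- 1 / sqrt ((1 - p) / p))"
proof -
  have s: "sqrt (p * (1 - p)) * sqrt ((1 - p) / p) = 1 - p"
    using p by (simp add: power2_eq_square flip: real_sqrt_mult)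
  have s': "sqrt (p * (1 - p)) = p * sqrt ((1 - p) / p)"
  proof -
    have "p * sqrt ((1 - p) / p) = sqrt (p\<^sup>2) * sqrt ((1 - p) / p)" using p by simp
    also have "\<dots> = sqrt (p\<^sup>2 * ((1 - p) / p))" by (rule real_sqrt_mult[symmetric])
    also have "p\<^sup>2 * ((1 - p) / p) = p * (1 - p)" using p by (simp add: power2_eq_square)
    finally show ?thesis by simp
  qed
  have pos: "0 < sqrt (p * (1 - p))" "0 < sqrt ((1 - p) / p)" using p by auto
  have a: "(1 - p) / sqrt (p * (1 - p)) = sqrt ((1 - p) / p)"
    by (rule divide_eq_imp) (use s pos in \<open>auto simp: mult.commute\<close>)
  have b: "(0 - p) / sqrt (p * (1 - p)) = - 1 / sqrt ((1 - p) / p)" unfolding s' using p pos by (simp add: field_simps)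
  have "(\<integral>\<^sup>+x. f x \<partial>std_bernoulli p) = (\<integral>\<^sup>+b. f ((of_bool b - p) / sqrt (p * (1 - p))) \<partial>bernoulli_pmf p)"
    unfolding std_bernoulli_def by (subst nn_integral_distr) (use f in auto)
  also have "\<dots> = ennreal p * f (sqrt ((1 - p) / p)) + ennreal (1 - p) * f (- 1 / sqrt ((1 - p) / p))"
    using p a b by (simp add: mult.commute)
  finally show ?thesis .
qed

lemma prob_space_std_bernoulli: "prob_space (std_bernoulli p)"
  unfolding std_bernoulli_def by (intro prob_space.prob_space_distr) (auto simp: prob_space_measure_pmf)

lemma nn_integral_PiM_std_bernoulli:
  fixes I :: "'a set" and f :: "real \<Rightarrow> real"
  assumes p: "0 < p" "p < 1" and I: "finite I" and f: "f \<in> borel_measurable borel" "\<And>x. 0 \<le> f x"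
  defines "v \<equiv> sqrt ((1 - p) / p)"
  shows "(\<integral>\<^sup>+z. ennreal (f (\<Sum>i\<in>I. z i)) \<partial>Pi\<^sub>M I (\<lambda>_. std_bernoulli p))
    = ennreal (two_point_expectation I (\<lambda>_. p) (\<lambda>_. v) (\<lambda>_. - 1 / v) f)"
  using I f
proof (induction I arbitrary: f rule: finite_induct)
  case empty
  show ?case by (simp add: PiM_empty nn_integral_count_space_finite)
next
  case (insert j I)
  interpret product_prob_space "\<lambda>_. std_bernoulli p" by (rule product_prob_spaceI) (rule prob_space_std_bernoulli)
  have sb[measurable_cong]: "sets (std_bernoulli p) = sets borel" by (simp add: std_bernoulli_def)
  note f[measurable] = insert.prems(1)
  let ?E = "\<lambda>c. two_point_expectation I (\<lambda>_. p) (\<lambda>_. v) (\<lambda>_. - 1 / v) (\<lambda>s. f (c + s))"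
  have E0: "0 \<le> ?E c" for c
    unfolding two_point_expectation_def using p insert.prems(2) by (intro sum_nonneg mult_nonneg_nonneg prod_nonneg) auto
  have "(\<integral>\<^sup>+z. ennreal (f (\<Sum>i\<in>insert j I. z i)) \<partial>Pi\<^sub>M (insert j I) (\<lambda>_. std_bernoulli p))
     = (\<integral>\<^sup>+y. \<integral>\<^sup>+z. ennreal (f (\<Sum>i\<in>insert j I. (z(j := y)) i)) \<partial>Pi\<^sub>M I (\<lambda>_. std_bernoulli p) \<partial>std_bernoulli p)"
    by (rule product_nn_integral_insert_rev) (use insert.hyps in measurable)
  also have "\<dots> = (\<integral>\<^sup>+y. ennreal (?E y) \<partial>std_bernoulli p)"
  proof (rule nn_integral_cong)
    fix y :: real
    have "(\<Sum>i\<in>insert j I. (z(j := y)) i) = y + (\<Sum>i\<in>I. z i)" for z :: "'a \<Rightarrow> real"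
    proof -
      have "(\<Sum>i\<in>I. (z(j := y)) i) = (\<Sum>i\<in>I. z i)" using insert.hyps by (intro sum.cong) auto
      then show ?thesis using insert.hyps by simp
    qed
    then show "(\<integral>\<^sup>+z. ennreal (f (\<Sum>i\<in>insert j I. (z(j := y)) i)) \<partial>Pi\<^sub>M I (\<lambda>_. std_bernoulli p)) = ennreal (?E y)"
      using insert.IH[of "\<lambda>s. f (y + s)"] insert.prems by simp
  qed
  also have "\<dots> = ennreal p * ennreal (?E v) + ennreal (1 - p) * ennreal (?E (- 1 / v))"
    unfolding v_def by (rule nn_integral_std_bernoulli[OF p]) (simp add: two_point_expectation_def)
  also have "\<dots> = ennreal (two_point_expectation (insert j I) (\<lambda>_. p) (\<lambda>_. v) (\<lambda>_. - 1 / v) f)"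
  proof -
    have "ennreal p * ennreal a + ennreal (1 - p) * ennreal b = ennreal (p * a + (1 - p) * b)"
      if "0 \<le> a" "0 \<le> b" for a b using p that by (simp add: ennreal_mult ennreal_plus)
    from this[OF E0 E0] show ?thesis unfolding two_point_expectation_insert[OF insert.hyps] .
  qed
  finally show ?case .
qed

lemma nn_integral_T_sum:
  fixes l :: real and f :: "real \<Rightarrow> real"
  assumes p: "0 < p" "p < 1" and n: "1 \<le> n" and Z: "std_bernoulli_family N n p Z"
    and f: "f \<in> borel_measurable borel" "\<And>x. 0 \<le> f x"
  defines "w \<equiv> (1 / real n) powr (1 / (2 * l))" and "v \<equiv> sqrt ((1 - p) / p)"
  shows "(\<integral>\<^sup>+\<omega>. ennreal (f (T_sum n Z l \<omega>)) \<partial>N)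
     = ennreal (two_point_expectation {1..n} (\<lambda>_. p) (\<lambda>_. w * v) (\<lambda>_. - w / v) f)"
proof -
  interpret prob_space N using Z by (simp add: std_bernoulli_family_def)
  have ind: "indep_vars (\<lambda>_. borel) Z {1..n}" and d: "\<And>i. i \<in> {1..n} \<Longrightarrow> distr N borel (Z i) = std_bernoulli p"
    using Z by (auto simp: std_bernoulli_family_def)
  have rv: "random_variable borel (Z i)" if "i \<in> {1..n}" for i using ind that by (auto simp: indep_vars_def)
  define c where "c = real n powr (1 / (2 * l))"
  have w: "w = 1 / c" unfolding w_def c_def using n by (simp add: powr_divide)
  have D: "distr N (Pi\<^sub>M {1..n} (\<lambda>_. borel)) (\<lambda>\<omega>. \<lambda>i\<in>{1..n}. Z i \<omega>) = Pi\<^sub>M {1..n} (\<lambda>_. std_bernoulli p)"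
    using ind rv n d by (subst (asm) indep_vars_iff_distr_eq_PiM') (auto intro!: PiM_cong)
  note f(1)[measurable]
  have "(\<integral>\<^sup>+\<omega>. ennreal (f (T_sum n Z l \<omega>)) \<partial>N) = (\<integral>\<^sup>+\<omega>. ennreal (f ((\<Sum>i\<in>{1..n}. (\<lambda>i\<in>{1..n}. Z i \<omega>) i) / c)) \<partial>N)"
    unfolding T_sum_def c_def by simp
  also have "\<dots> = (\<integral>\<^sup>+z. ennreal (f ((\<Sum>i\<in>{1..n}. z i) / c)) \<partial>Pi\<^sub>M {1..n} (\<lambda>_. std_bernoulli p))"
    unfolding D[symmetric]
  proof (rule nn_integral_distr[symmetric])
    show "(\<lambda>\<omega>. \<lambda>i\<in>{1..n}. Z i \<omega>) \<in> N \<rightarrow>\<^sub>M Pi\<^sub>M {1..n} (\<lambda>_. borel)" by (rule measurable_restrict[OF rv])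
  qed measurable
  also have "\<dots> = ennreal (two_point_expectation {1..n} (\<lambda>_. p) (\<lambda>_. v) (\<lambda>_. - 1 / v) (\<lambda>s. f (s / c)))"
    unfolding v_def by (rule nn_integral_PiM_std_bernoulli[OF p, where f = "\<lambda>s. f (s / c)"]) (use f in auto)
  also have "two_point_expectation {1..n} (\<lambda>_. p) (\<lambda>_. v) (\<lambda>_. - 1 / v) (\<lambda>s. f (s / c))
      = two_point_expectation {1..n} (\<lambda>_. p) (\<lambda>_. w * v) (\<lambda>_. - w / v) f"
    unfolding two_point_expectation_scale w by (simp add: field_simps)
  finally show ?thesis .
qed

subsection \<open>Tail comparison\<close>

lemma cube_H_plus_3: "(\<lambda>x. (max 0 (x - t)) ^ 3) \<in> H_plus 3"
proof -
  let ?f = "\<lambda>x::real. (max 0 (x - t)) ^ 3"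
  have d1: "deriv ?f = (\<lambda>x. 3 * (max 0 (x - t))\<^sup>2)"
    by (rule ext) (rule DERIV_imp_deriv[OF pos_part_cube_deriv])
  have dd: "((\<lambda>x. 3 * (max 0 (x - t))\<^sup>2) has_real_derivative 6 * max 0 (x - t)) (at x)" for x
    using DERIV_cmult[OF pos_part_square_deriv, of 3 t x] by simp
  have d2: "(deriv ^^ 2) ?f = (\<lambda>x. 6 * max 0 (x - t))"
    using DERIV_imp_deriv[OF dd] by (simp add: numeral_2_eq_2 d1 fun_eq_iff)
  have j: "j = 0 \<or> j = 1" if "j < 2" for j :: nat using that by auto
  have j': "j = 0 \<or> j = 1 \<or> j = 2" if "j < 3" for j :: nat using that by auto
  have diff: "(deriv ^^ j) ?f field_differentiable at x" if "j < 2" for j x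
    using j[OF that] pos_part_cube_deriv[of t x] dd[of x]
    by (auto simp: d1 field_differentiable_def)
  have "convex_on UNIV (\<lambda>x. 6 * max 0 (x - t))"
  proof (rule convex_onI)
    fix r x y :: real assume r: "0 < r" "r < 1"
    have "(1 - r) * (x - t) \<le> (1 - r) * max 0 (x - t)" "r * (y - t) \<le> r * max 0 (y - t)"
      using r by (auto intro!: mult_left_mono)
    moreover have "(1 - r) *\<^sub>R x + r *\<^sub>R y - t = (1 - r) * (x - t) + r * (y - t)" by (simp add: algebra_simps)
    moreover have "0 \<le> (1 - r) * max 0 (x - t)" "0 \<le> r * max 0 (y - t)" using r by auto
    ultimately have "max 0 ((1 - r) *\<^sub>R x + r *\<^sub>R y - t) \<le> (1 - r) * max 0 (x - t) + r * max 0 (y - t)" by linarith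
    then have "6 * max 0 ((1 - r) *\<^sub>R x + r *\<^sub>R y - t) \<le> 6 * ((1 - r) * max 0 (x - t) + r * max 0 (y - t))"
      by (intro mult_left_mono) auto
    also have "\<dots> = (1 - r) * (6 * max 0 (x - t)) + r * (6 * max 0 (y - t))" by (simp only: distrib_left mult.left_commute)
    finally show "6 * max 0 ((1 - r) *\<^sub>R x + r *\<^sub>R y - t) \<le> (1 - r) * (6 * max 0 (x - t)) + r * (6 * max 0 (y - t))" .
  qed simp
  then have conv: "convex_on UNIV ((deriv ^^ 2) ?f)" by (simp add: d2)
  have ev: "\<forall>\<^sub>F x in at_bot. max 0 (x - t) = 0"
    using eventually_le_at_bot[of t] by eventually_elim auto
  have lim: "((deriv ^^ j) ?f \<longlongrightarrow> 0) at_bot" if "j < 3" for j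
  proof (rule tendsto_eventually)
    show "\<forall>\<^sub>F x in at_bot. (deriv ^^ j) ?f x = 0"
      using ev by eventually_elim (use j'[OF that] in \<open>auto simp: d1 d2\<close>)
  qed
  show ?thesis unfolding H_plus_def using diff conv lim by simp
qed

text \<open>A truncated cube is the integral of \<open>3 (u - t)^2\<close> from \<open>t\<close> to
  its argument. Interchanging the integrals expresses the mean through the tail, where a pointwise
  bound on the tail can be inserted.\<close>

lemma nn_integral_cube_layer_cake:
  assumes N: "prob_space N" and T[measurable]: "T \<in> borel_measurable N"
  shows "(\<integral>\<^sup>+\<omega>. ennreal ((max 0 (T \<omega> - t)) ^ 3) \<partial>N)
    = (\<integral>\<^sup>+u. ennreal (3 * (u - t)\<^sup>2) * indicator {t..} u * emeasure N {\<omega> \<in> space N. u \<le> T \<omega>} \<partial>lborel)"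
proof -
  interpret prob_space N by fact
  interpret P: pair_sigma_finite N lborel ..
  have "ennreal ((max 0 (T \<omega> - t)) ^ 3) = (\<integral>\<^sup>+u. ennreal (3 * (u - t)\<^sup>2) * indicator {t..T \<omega>} u \<partial>lborel)" for \<omega>
  proof (cases "t \<le> T \<omega>")
    case True
    have "(\<integral>\<^sup>+u. ennreal (3 * (u - t)\<^sup>2) * indicator {t..T \<omega>} u \<partial>lborel) = ennreal ((T \<omega> - t) ^ 3 - (t - t) ^ 3)"
      by (rule nn_integral_FTC_Icc[OF _ _ _ True]) (auto intro!: derivative_eq_intros)
    then show ?thesis using True by simp
  qed simp
  then have "(\<integral>\<^sup>+\<omega>. ennreal ((max 0 (T \<omega> - t)) ^ 3) \<partial>N)
      = (\<integral>\<^sup>+\<omega>. \<integral>\<^sup>+u. ennreal (3 * (u - t)\<^sup>2) * indicator {t..T \<omega>} u \<partial>lborel \<partial>N)" by simp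
  also have "\<dots> = (\<integral>\<^sup>+\<omega>. \<integral>\<^sup>+u. ennreal (3 * (u - t)\<^sup>2) * indicator {t..} u * (if u \<le> T \<omega> then 1 else 0) \<partial>lborel \<partial>N)"
    by (intro nn_integral_cong) (auto simp: indicator_def)
  also have "\<dots> = (\<integral>\<^sup>+u. \<integral>\<^sup>+\<omega>. ennreal (3 * (u - t)\<^sup>2) * indicator {t..} u * (if u \<le> T \<omega> then 1 else 0) \<partial>N \<partial>lborel)"
    by (rule P.Fubini'[symmetric]) measurable
  also have "\<dots> = (\<integral>\<^sup>+u. ennreal (3 * (u - t)\<^sup>2) * indicator {t..} u * emeasure N {\<omega> \<in> space N. u \<le> T \<omega>} \<partial>lborel)"
  proof (rule nn_integral_cong)
    fix u
    have "(\<integral>\<^sup>+\<omega>. (if u \<le> T \<omega> then 1 else 0) \<partial>N) = (\<integral>\<^sup>+\<omega>. indicator {\<omega> \<in> space N. u \<le> T \<omega>} \<omega> \<partial>N)"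
      by (intro nn_integral_cong) (auto simp: indicator_def)
    also have "\<dots> = emeasure N {\<omega> \<in> space N. u \<le> T \<omega>}" by (rule nn_integral_indicator) measurable
    finally show "(\<integral>\<^sup>+\<omega>. ennreal (3 * (u - t)\<^sup>2) * indicator {t..} u * (if u \<le> T \<omega> then 1 else 0) \<partial>N)
        = ennreal (3 * (u - t)\<^sup>2) * indicator {t..} u * emeasure N {\<omega> \<in> space N. u \<le> T \<omega>}"
      by (subst nn_integral_cmult) auto
  qed
  finally show ?thesis .
qed

text \<open>A Gamma integral: rescaling by \<open>\<beta>\<close> leaves
  \<open>3 * 2 / \<beta>^3\<close>. It is the layer-cake integral for a purely exponential
  tail.\<close>

lemma nn_integral_square_exp:
  assumes \<beta>: "0 < \<beta>"
  shows "(\<integral>\<^sup>+u. ennreal (3 * (u - t)\<^sup>2) * indicator {t..} u * ennreal (exp (- \<beta> * (u - t))) \<partial>lborel) = ennreal (6 / \<beta> ^ 3)"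
proof -
  let ?f = "\<lambda>u. ennreal (3 * (u - t)\<^sup>2) * indicator {t..} u * ennreal (exp (- \<beta> * (u - t)))"
  have "(\<integral>\<^sup>+u. ?f u \<partial>lborel) = ennreal \<bar>1 / \<beta>\<bar> * (\<integral>\<^sup>+y. ?f (t + 1 / \<beta> * y) \<partial>lborel)"
    by (rule nn_integral_real_affine) (use \<beta> in auto)
  also have "(\<integral>\<^sup>+y. ?f (t + 1 / \<beta> * y) \<partial>lborel) = (\<integral>\<^sup>+y. ennreal (3 / \<beta>\<^sup>2) * (ennreal (y ^ 2 * exp (- y)) * indicator {0..} y) \<partial>lborel)"
  proof (rule nn_integral_cong)
    fix y :: real
    show "?f (t + 1 / \<beta> * y) = ennreal (3 / \<beta>\<^sup>2) * (ennreal (y ^ 2 * exp (- y)) * indicator {0..} y)"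
    proof (cases "0 \<le> y")
      case True
      then have "?f (t + 1 / \<beta> * y) = ennreal (3 * (y / \<beta>)\<^sup>2 * exp (- y))" using \<beta> by (simp flip: ennreal_mult)
      also have "3 * (y / \<beta>)\<^sup>2 * exp (- y) = 3 / \<beta>\<^sup>2 * (y ^ 2 * exp (- y))" by (simp add: power_divide)
      finally show ?thesis using True \<beta> by (simp flip: ennreal_mult)
    next
      case False
      then have "y / \<beta> < 0" using \<beta> by (simp add: divide_neg_pos)
      then show ?thesis using False by simp
    qed
  qed
  also have "\<dots> = ennreal (3 / \<beta>\<^sup>2) * ennreal 2"
    by (subst nn_integral_cmult) (auto simp: nn_intergal_power_times_exp_Ici[of 2])
  also have "ennreal \<bar>1 / \<beta>\<bar> * (ennreal (3 / \<beta>\<^sup>2) * ennreal 2) = ennreal (6 / \<beta> ^ 3)"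
  proof -
    have "ennreal \<bar>1 / \<beta>\<bar> * (ennreal (3 / \<beta>\<^sup>2) * ennreal 2) = ennreal (\<bar>1 / \<beta>\<bar> * (3 / \<beta>\<^sup>2 * 2))"
    proof -
      have "ennreal x * (ennreal y * ennreal z) = ennreal (x * (y * z))" if "0 \<le> x" "0 \<le> y" "0 \<le> z" for x y z
        using that by (simp add: ennreal_mult)
      from this[of "\<bar>1 / \<beta>\<bar>" "3 / \<beta>\<^sup>2" 2] show ?thesis by (simp only: abs_ge_zero) auto
    qed
    also have "\<bar>1 / \<beta>\<bar> * (3 / \<beta>\<^sup>2 * 2) = 6 / \<beta> ^ 3"
      using \<beta> by (simp add: power2_eq_square power3_eq_cube)
    finally show ?thesis .
  qed
  finally show ?thesis .
qed

text \<open>Chord slopes to the left of \<open>x\<close> dominate those to its right; the infimum of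
  the left slopes therefore works. Points of \<open>A\<close> on both sides make this infimum
  finite.\<close>

lemma concave_on_supergradient:
  fixes L :: "real \<Rightarrow> real"
  assumes conc: "concave_on A L" and x: "x \<in> A" and left: "a \<in> A" "a < x" and right: "b \<in> A" "x < b"
  obtains c where "\<And>u. u \<in> A \<Longrightarrow> L u \<le> L x + c * (u - x)"
proof -
  have conv: "convex_on A (\<lambda>x. - L x)" using conc by (simp add: concave_on_def)
  define s where "s u = (L u - L x) / (u - x)" for u
  have slope: "s v \<le> s u" if "u \<in> A" "u < x" "v \<in> A" "x < v" for u v
  proof -
    have "(- L u - - L x) / (u - x) \<le> (- L u - - L v) / (u - v)"
      "(- L u - - L v) / (u - v) \<le> (- L x - - L v) / (x - v)"
      using convex_on_slope_le[OF conv that(1,3) that(2,4)] by auto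
    then have "(- L u - - L x) / (u - x) \<le> (- L x - - L v) / (x - v)" by linarith
    moreover have "(- L u - - L x) / (u - x) = - s u" "(- L x - - L v) / (x - v) = - s v"
      unfolding s_def using that by (auto simp: field_simps)
    ultimately show ?thesis by simp
  qed
  define c where "c = (INF u\<in>{u\<in>A. u < x}. s u)"
  have ne: "{u\<in>A. u < x} \<noteq> {}" using left by auto
  have bdd: "bdd_below (s ` {u\<in>A. u < x})" using slope right by (intro bdd_belowI2[of _ "s b"]) auto
  have "L u \<le> L x + c * (u - x)" if u: "u \<in> A" for u
  proof -
    consider "u < x" | "u = x" | "x < u" by linarith
    then show ?thesis
    proof cases
      case 1
      have "c \<le> s u" unfolding c_def using 1 u by (intro cINF_lower[OF bdd]) auto
      then have "c * (x - u) \<le> s u * (x - u)" using 1 by (intro mult_right_mono) auto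
      also have "s u * (x - u) = L x - L u" unfolding s_def using 1 by (simp add: field_simps)
      finally show ?thesis by (simp add: algebra_simps)
    next
      case 3
      have "s u \<le> c" unfolding c_def using 3 u slope by (intro cINF_greatest[OF ne]) auto
      then have "s u * (u - x) \<le> c * (u - x)" using 3 by (intro mult_right_mono) auto
      also have "s u * (u - x) = L u - L x" unfolding s_def using 3 by simp
      finally show ?thesis by simp
    qed simp
  qed
  then show ?thesis using that by blast
qed

lemma logconcave_fun_const: "0 \<le> c \<Longrightarrow> logconcave_fun (\<lambda>_. c)"
  by (simp add: logconcave_fun_iff flip: powr_add)

text \<open>The atom at the upper end \<open>b\<close> makes the tail, hence its log-concave
  majorant, positive on all of \<open>(-\<infinity>, b]\<close>. The logarithm of the majorant is
  then finite around any \<open>x < b\<close>, which is what a supporting line requires. The points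
  \<open>x = b\<close> and \<open>x > b\<close> are treated directly.\<close>

theorem tail_comparison:
  fixes S :: "'a \<Rightarrow> real" and T :: "'b \<Rightarrow> real"
  assumes M: "prob_space M" and N: "prob_space N" and T[measurable]: "T \<in> borel_measurable N"
    and bounds: "AE \<omega> in N. a \<le> T \<omega> \<and> T \<omega> \<le> b" and atom: "0 < measure N {\<omega> \<in> space N. b \<le> T \<omega>}"
    and le: "\<And>t. (\<integral>\<^sup>+\<omega>. ennreal ((max 0 (S \<omega> - t)) ^ 3) \<partial>M) \<le> (\<integral>\<^sup>+\<omega>. ennreal ((max 0 (T \<omega> - t)) ^ 3) \<partial>N)"
  defines "tail \<equiv> \<lambda>y. measure N {\<omega> \<in> space N. y \<le> T \<omega>}"
  shows "measure M {\<omega> \<in> space M. x \<le> S \<omega>} \<le> 2 * exp 3 / 9 * lc_majorant tail x"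
proof -
  interpret M: prob_space M by fact
  interpret N: prob_space N by fact
  define q where "q = lc_majorant tail"
  have tail1: "tail \<le> (\<lambda>_. 1)" by (auto simp: le_fun_def tail_def N.prob_le_1)
  note maj = lc_majorant[OF logconcave_fun_const[of 1] tail1, simplified, folded q_def]
  have q0: "0 \<le> q u" for u using maj(1) by (auto simp: logconcave_fun_def)
  have tq: "tail u \<le> q u" for u using maj(2) by (auto simp: le_fun_def)
  have "exp (3::real) \<ge> 1 + 3" by (rule exp_ge_add_one_self)
  moreover have "exp (3::real) = (exp 1) ^ 3" by (simp flip: exp_of_nat_mult)
  moreover have "(2::real) ^ 3 \<le> (exp 1) ^ 3" using exp_ge_add_one_self[of 1] by (intro power_mono) auto
  ultimately have C: "1 \<le> 2 * exp 3 / (9::real)" by simp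
  define P where "P = measure M {\<omega> \<in> space M. x \<le> S \<omega>}"
  show ?thesis
  proof (cases "{\<omega> \<in> space M. x \<le> S \<omega>} \<in> sets M")
    \<comment> \<open>If the event is not measurable, its \<open>measure\<close> is 0 by convention,
      and the bound holds because the majorant is nonnegative.\<close>
    case False
    then have "P = 0" unfolding P_def by (simp add: measure_notin_sets)
    then show ?thesis using q0[of x] C unfolding P_def q_def by simp
  next
    case meas: True
    have markov: "ennreal (P * (x - t) ^ 3) \<le> (\<integral>\<^sup>+\<omega>. ennreal ((max 0 (T \<omega> - t)) ^ 3) \<partial>N)" if t: "t < x" for t
    proof -
      have "ennreal (P * (x - t) ^ 3) = ennreal ((x - t) ^ 3) * emeasure M {\<omega> \<in> space M. x \<le> S \<omega>}"
        unfolding P_def M.emeasure_eq_measure using t by (subst ennreal_mult[symmetric]) (auto simp: mult.commute)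
      also have "\<dots> = (\<integral>\<^sup>+\<omega>. ennreal ((x - t) ^ 3) * indicator {\<omega> \<in> space M. x \<le> S \<omega>} \<omega> \<partial>M)"
        using meas by (simp add: nn_integral_cmult_indicator)
      also have "\<dots> \<le> (\<integral>\<^sup>+\<omega>. ennreal ((max 0 (S \<omega> - t)) ^ 3) \<partial>M)"
        using t by (intro nn_integral_mono) (auto simp: indicator_def intro!: ennreal_leI power_mono)
      also have "\<dots> \<le> (\<integral>\<^sup>+\<omega>. ennreal ((max 0 (T \<omega> - t)) ^ 3) \<partial>N)" by (rule le)
      finally show ?thesis .
    qed
    \<comment> \<open>A crude Markov bound, with the truncated cube replaced by its maximum
      \<open>(b - t)^3\<close> on the event \<open>T >= t\<close>. It replaces the exponential bound
      where no supporting line is available.\<close>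
    have near: "P * (x - t) ^ 3 \<le> (b - t) ^ 3 * tail t" if t: "t < x" "t \<le> b" for t
    proof -
      have "ennreal (P * (x - t) ^ 3) \<le> (\<integral>\<^sup>+\<omega>. ennreal ((max 0 (T \<omega> - t)) ^ 3) \<partial>N)" by (rule markov[OF t(1)])
      also have "\<dots> \<le> (\<integral>\<^sup>+\<omega>. ennreal ((b - t) ^ 3) * indicator {\<omega> \<in> space N. t \<le> T \<omega>} \<omega> \<partial>N)"
      proof (rule nn_integral_mono_AE)
        show "AE \<omega> in N. ennreal ((max 0 (T \<omega> - t)) ^ 3) \<le> ennreal ((b - t) ^ 3) * indicator {\<omega> \<in> space N. t \<le> T \<omega>} \<omega>"
          using bounds AE_space by eventually_elim (auto simp: indicator_def intro!: ennreal_leI power_mono)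
      qed
      also have "\<dots> = ennreal ((b - t) ^ 3 * tail t)"
        unfolding tail_def using t
        by (simp add: nn_integral_cmult_indicator N.emeasure_eq_measure ennreal_mult)
      finally show ?thesis using t by (subst (asm) ennreal_le_iff) (auto simp: tail_def)
    qed
    consider "b < x" | "x = b" | "x < b" by linarith
    then have "P \<le> 2 * exp 3 / 9 * q x"
    proof cases
      case 1
      have "P * (x - b) ^ 3 \<le> (b - b) ^ 3 * tail b" by (rule near) (use 1 in auto)
      then have "P \<le> 0" using 1 by (simp add: mult_le_0_iff)
      moreover have "0 \<le> 2 * exp 3 / 9 * q x" using q0[of x] by simp
      ultimately show ?thesis by linarith
    next
      case 2
      \<comment> \<open>With \<open>x = b\<close> the cubes on both sides of \<open>near\<close>
        cancel. Letting \<open>t\<close> increase to \<open>b\<close> then gives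
        \<open>P <= tail b\<close>, by continuity of measure from above.\<close>
      have tail_le: "P \<le> tail (b - 1 / real (Suc k))" for k
      proof -
        have "P * (x - (b - 1 / real (Suc k))) ^ 3 \<le> (b - (b - 1 / real (Suc k))) ^ 3 * tail (b - 1 / real (Suc k))"
          by (rule near) (use 2 in auto)
        then show ?thesis using 2 by (simp add: mult.commute)
      qed
      have "(\<lambda>k. measure N {\<omega> \<in> space N. b - 1 / real (Suc k) \<le> T \<omega>}) \<longlonglongrightarrow> measure N (\<Inter>k. {\<omega> \<in> space N. b - 1 / real (Suc k) \<le> T \<omega>})"
      proof (rule N.finite_Lim_measure_decseq)
        show "decseq (\<lambda>k. {\<omega> \<in> space N. b - 1 / real (Suc k) \<le> T \<omega>})"
        proof (rule decseq_SucI, safe)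
          fix k \<omega> assume "b - 1 / real (Suc (Suc k)) \<le> T \<omega>"
          moreover have "1 / real (Suc (Suc k)) \<le> 1 / real (Suc k)" by (intro divide_left_mono) auto
          ultimately show "b - 1 / real (Suc k) \<le> T \<omega>" by linarith
        qed
      qed auto
      moreover have "(\<Inter>k. {\<omega> \<in> space N. b - 1 / real (Suc k) \<le> T \<omega>}) = {\<omega> \<in> space N. b \<le> T \<omega>}"
      proof safe
        fix \<omega> assume h: "\<omega> \<in> (\<Inter>k. {\<omega> \<in> space N. b - 1 / real (Suc k) \<le> T \<omega>})"
        show "b \<le> T \<omega>"
        proof (rule ccontr)
          assume "\<not> b \<le> T \<omega>"
          then obtain k where "inverse (real (Suc k)) < b - T \<omega>" using reals_Archimedean[of "b - T \<omega>"] by auto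
          moreover have "b - 1 / real (Suc k) \<le> T \<omega>" using h by auto
          ultimately show False by (simp add: inverse_eq_divide)
        qed
      next
        fix \<omega> k assume "b \<le> T \<omega>"
        moreover have "0 \<le> 1 / real (Suc k)" by simp
        ultimately show "b - 1 / real (Suc k) \<le> T \<omega>" by linarith
      qed auto
      ultimately have "(\<lambda>k. tail (b - 1 / real (Suc k))) \<longlonglongrightarrow> tail b" unfolding tail_def by simp
      then have "P \<le> tail b" using tail_le by (intro LIMSEQ_le_const) auto
      also have "\<dots> \<le> 1 * q x" using tq[of b] 2 by simp
      also have "\<dots> \<le> 2 * exp 3 / 9 * q x" using C q0 by (intro mult_right_mono) auto
      finally show ?thesis .
    next
      case 3
      have tail_pos: "0 < tail u" if "u \<le> b" for u
      proof -
        have "tail b \<le> tail u" unfolding tail_def using that by (intro N.finite_measure_mono) auto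
        then show ?thesis using atom unfolding tail_def by linarith
      qed
      define A where "A = {u. 0 < q u}"
      have A: "u \<in> A" if "u \<le> b" for u unfolding A_def using tail_pos[OF that] tq[of u] by simp
      have conc: "concave_on A (\<lambda>u. ln (q u))" using maj(1) unfolding logconcave_fun_def A_def by simp
      obtain c where c: "\<And>u. u \<in> A \<Longrightarrow> ln (q u) \<le> ln (q x) + c * (u - x)"
        using concave_on_supergradient[OF conc, of x "x - 1" b] A 3 by auto
      have qx: "0 < q x" using A[of x] 3 by (simp add: A_def)
      show ?thesis
      proof (cases "0 \<le> c")
        case True
        \<comment> \<open>To the left of \<open>a\<close> the tail is 1. A nondecreasing supporting
          line then forces \<open>q x >= 1\<close>, and nothing else is needed.\<close>
        define u where "u = min a x"
        have "tail u = measure N (space N)"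
          unfolding tail_def
          by (rule N.finite_measure_eq_AE) (use bounds in \<open>auto elim!: eventually_mono simp: u_def\<close>)
        then have "1 \<le> q u" using tq[of u] N.prob_space by simp
        then have "0 \<le> ln (q u)" by simp
        also have "\<dots> \<le> ln (q x) + c * (u - x)" using c A 3 by (auto simp: u_def)
        also have "\<dots> \<le> ln (q x)" using True by (simp add: u_def mult_le_0_iff)
        finally have "1 \<le> q x" using qx by (simp add: ln_ge_zero_iff)
        moreover have "P \<le> 1" unfolding P_def by (rule M.prob_le_1)
        ultimately have "P \<le> 1 * q x" by simp
        also have "\<dots> \<le> 2 * exp 3 / 9 * q x" using C q0 by (intro mult_right_mono) auto
        finally show ?thesis .
      next
        case False
        define \<beta> where "\<beta> = - c"
        have \<beta>: "0 < \<beta>" using False by (simp add: \<beta>_def)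
        have q_le: "q u \<le> q x * exp (- \<beta> * (u - x))" for u
        proof (cases "u \<in> A")
          case True
          then have "ln (q u) \<le> ln (q x) + - \<beta> * (u - x)" using c by (simp add: \<beta>_def)
          then have "exp (ln (q u)) \<le> exp (ln (q x) + - \<beta> * (u - x))" by (simp only: exp_le_cancel_iff)
          moreover have "exp (ln (q u)) = q u" using True by (simp add: A_def)
          moreover have "exp (ln (q x)) = q x" using qx by simp
          ultimately show ?thesis by (simp only: exp_add)
        next
          case False
          then have "q u = 0" using q0[of u] by (simp add: A_def)
          then show ?thesis using qx by simp
        qed
        \<comment> \<open>With \<open>s = \<beta> (x - t)\<close> the argument bounds
          \<open>P\<close> by \<open>q x * 6 * exp s / s^3\<close>. This is smallest at
          \<open>s = 3\<close>, where the factor is \<open>6 exp 3 / 27 = 2 exp 3 / 9\<close>, the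
          constant of the theorem.\<close>
        define t where "t = x - 3 / \<beta>"
        have t: "t < x" "x - t = 3 / \<beta>" using \<beta> by (auto simp: t_def)
        have "ennreal (P * (x - t) ^ 3)
           \<le> (\<integral>\<^sup>+u. ennreal (3 * (u - t)\<^sup>2) * indicator {t..} u * emeasure N {\<omega> \<in> space N. u \<le> T \<omega>} \<partial>lborel)"
          using markov[OF t(1)] unfolding nn_integral_cube_layer_cake[OF N T] .
        also have "\<dots> \<le> (\<integral>\<^sup>+u. ennreal (q x * exp 3) * (ennreal (3 * (u - t)\<^sup>2) * indicator {t..} u * ennreal (exp (- \<beta> * (u - t)))) \<partial>lborel)"
        proof (rule nn_integral_mono)
          fix u
          have "- \<beta> * (u - x) = 3 + - \<beta> * (u - t)" using t(2) \<beta> by (simp add: t_def field_simps)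
          then have "tail u \<le> q x * exp 3 * exp (- \<beta> * (u - t))"
            using tq[of u] q_le[of u] by (simp only: exp_add mult.assoc)
          then have "emeasure N {\<omega> \<in> space N. u \<le> T \<omega>} \<le> ennreal (q x * exp 3) * ennreal (exp (- \<beta> * (u - t)))"
            unfolding N.emeasure_eq_measure tail_def using qx by (subst ennreal_mult[symmetric]) (auto intro: ennreal_leI)
          then have "ennreal (3 * (u - t)\<^sup>2) * indicator {t..} u * emeasure N {\<omega> \<in> space N. u \<le> T \<omega>}
            \<le> ennreal (3 * (u - t)\<^sup>2) * indicator {t..} u * (ennreal (q x * exp 3) * ennreal (exp (- \<beta> * (u - t))))"
            by (rule mult_left_mono) simp
          then show "ennreal (3 * (u - t)\<^sup>2) * indicator {t..} u * emeasure N {\<omega> \<in> space N. u \<le> T \<omega>}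
            \<le> ennreal (q x * exp 3) * (ennreal (3 * (u - t)\<^sup>2) * indicator {t..} u * ennreal (exp (- \<beta> * (u - t))))"
            by (simp only: mult_ac)
        qed
        also have "\<dots> = ennreal (q x * exp 3) * ennreal (6 / \<beta> ^ 3)"
          by (subst nn_integral_cmult, measurable, subst nn_integral_square_exp[OF \<beta>], rule refl)
        also have "\<dots> = ennreal (q x * exp 3 * (6 / \<beta> ^ 3))"
          by (rule ennreal_mult[symmetric]) (use qx \<beta> in auto)
        finally have "P * (3 / \<beta>) ^ 3 \<le> q x * exp 3 * (6 / \<beta> ^ 3)"
          unfolding t(2) using qx \<beta> by (subst (asm) ennreal_le_iff) auto
        then show ?thesis using \<beta> by (simp add: field_simps power3_eq_cube)
      qed
    qed
    then show ?thesis unfolding P_def q_def .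
  qed
qed

subsection \<open>Optimality of the exponent\<close>

text \<open>The averaging inequality divided by \<open>d\<close> and taken to the limit
  \<open>d = 0\<close> reads \<open>2c <= (2l - 1) * E\<close>, where \<open>E\<close> is the
  bracket in the claim; a \<open>c\<close> violating it is sought. For \<open>p < 1/2\<close> the
  choice \<open>c = \<rho>\<close> makes it an equality at \<open>l = lambda_star p\<close>, hence
  false below.\<close>

lemma below_lambda_star_witness:
  assumes p: "0 < p" "p < 1" and l: "1 / 2 < l" "l < lambda_star p"
  obtains c where "0 < c" "(2 * l - 1) * (p * (2 * c + 1) + (1 - p) * c\<^sup>2 - (1 - p) * (max 0 (c - 1))\<^sup>2) < 2 * c"
proof (cases "p < 1 / 2")
  case True
  define \<rho> where "\<rho> = sqrt (p / (1 - p))"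
  note L = lambda_star_small[OF p(1) True, folded \<rho>_def]
  have k: "0 < 1 + \<rho>\<^sup>2" using L(1) by (simp add: add_pos_nonneg)
  have E: "p * (2 * \<rho> + 1) + (1 - p) * \<rho>\<^sup>2 - (1 - p) * (max 0 (\<rho> - 1))\<^sup>2 = \<rho>\<^sup>2 / (1 + \<rho>\<^sup>2) * (2 * \<rho> + 2)"
  proof -
    have "max 0 (\<rho> - 1) = 0" using L(2) by simp
    moreover have "(1 - p) * \<rho>\<^sup>2 = p" using L(3,4) by (metis times_divide_eq_left mult_1)
    ultimately have "p * (2 * \<rho> + 1) + (1 - p) * \<rho>\<^sup>2 - (1 - p) * (max 0 (\<rho> - 1))\<^sup>2 = p * (2 * \<rho> + 2)"
      by (simp add: algebra_simps)
    then show ?thesis using L(3) by metis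
  qed
  have "(2 * l - 1) * (\<rho>\<^sup>2 / (1 + \<rho>\<^sup>2) * (2 * \<rho> + 2)) < (2 * lambda_star p - 1) * (\<rho>\<^sup>2 / (1 + \<rho>\<^sup>2) * (2 * \<rho> + 2))"
    using l L(1) k by (intro mult_strict_right_mono) auto
  also have "\<dots> = 2 * \<rho>"
  proof -
    have "(1 + \<rho>\<^sup>2) / (\<rho> * (1 + \<rho>)) * (\<rho>\<^sup>2 / (1 + \<rho>\<^sup>2) * (2 * (1 + \<rho>))) = 2 * \<rho>"
    proof -
      have "K / (\<rho> * s) * (\<rho>\<^sup>2 / K * (2 * s)) = 2 * \<rho>" if "0 < K" "0 < s" for K s :: real
        using that L(1) by (simp add: field_simps power2_eq_square)
      from this[OF k, of "1 + \<rho>"] show ?thesis using L(1) by simp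
    qed
    then show ?thesis unfolding L(5) by (simp add: algebra_simps power2_eq_square)
  qed
  finally have "(2 * l - 1) * (\<rho>\<^sup>2 / (1 + \<rho>\<^sup>2) * (2 * \<rho> + 2)) < 2 * \<rho>" .
  then show ?thesis using that[OF L(1)] unfolding E by blast
next
  case False
  have l1: "l < 1"
  proof (cases "p = 1 / 2")
    case True
    have "sqrt (1/2 - (1/2)\<^sup>2) = (1/2::real)" by (rule real_sqrt_unique) (auto simp: power2_eq_square)
    then have "lambda_star p = 1" unfolding lambda_star_def True by (simp add: power2_eq_square)
    then show ?thesis using l by simp
  next
    case p2: False
    then show ?thesis using l False by (simp add: lambda_star_def)
  qed
  define m where "m = 2 * l - 1"
  have m: "0 < m" "m < 1" unfolding m_def using l l1 by auto
  \<comment> \<open>For \<open>c >= 1\<close> the bracket equals \<open>2c + 2p - 1\<close>, so any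
    sufficiently large \<open>c\<close> serves when \<open>m < 1\<close>. This choice gives
    \<open>(1 - m) * c = 2 - m\<close>, which exceeds 1.\<close>
  define c where "c = 1 + 1 / (1 - m)"
  have c: "1 < c" unfolding c_def using m by simp
  have "p * (2 * c + 1) + (1 - p) * c\<^sup>2 - (1 - p) * (max 0 (c - 1))\<^sup>2 = 2 * c + (2 * p - 1)"
    using c by (simp add: max_def power2_eq_square algebra_simps)
  moreover have "m * (2 * c + (2 * p - 1)) < 2 * c"
  proof -
    have "(1 - m) * c = (1 - m) + 1" unfolding c_def using m by (simp add: field_simps)
    moreover have "m * (2 * p - 1) \<le> 1 * 1" using m p False by (intro mult_mono) auto
    ultimately show ?thesis using m by (simp add: algebra_simps)
  qed
  ultimately show ?thesis using that[of c] c unfolding m_def by simp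
qed

text \<open>Exact values, with no case split on the larger arguments, of the two brackets that
  appear in the derivative of \<open>pair_mean\<close>. Here \<open>c\<close> is the height of
  \<open>y + b\<close> above the truncation point in units of \<open>b\<close>, and
  \<open>1 + d\<close> is the ratio of the two increments.\<close>

lemma truncated_square_gap:
  fixes p c d b t y :: real
  assumes b: "0 < b" and d: "0 \<le> d" and c: "0 \<le> c" "c = 1 - (t - y) / b"
  defines "g \<equiv> \<lambda>z. 3 * (max 0 (z - t))\<^sup>2"
    and "B \<equiv> p * (2 * c + 1 + 2 * d) + (1 - p) * c\<^sup>2 - (1 - p) * (max 0 (c - 1))\<^sup>2"
  shows "p * g (y + b * (1 + d) + b) + (1 - p) * g (y + b) - p * g (y + b * (1 + d)) - (1 - p) * g y = 3 * b\<^sup>2 * B"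
    and "p * g (y + b * (1 + d) + b) + (1 - p) * g (y + b * (1 + d)) - p * g (y + b) - (1 - p) * g y
      = 3 * b\<^sup>2 * (B + d * (2 * c + d))"
proof -
  have scale: "g (y + b * z) = 3 * b\<^sup>2 * (max 0 (z + (c - 1)))\<^sup>2" for z
  proof -
    have "y + b * z - t = b * (z + (c - 1))" unfolding c(2) using b by (simp add: field_simps)
    then have "max 0 (y + b * z - t) = b * max 0 (z + (c - 1))"
      using b by (auto simp: max_def mult_le_0_iff zero_le_mult_iff)
    then show ?thesis unfolding g_def by (simp add: power_mult_distrib)
  qed
  have e: "y + b * (1 + d) + b = y + b * (2 + d)" by (simp add: algebra_simps)
  have "g (y + b * (1 + d) + b) = 3 * b\<^sup>2 * (c + d + 1)\<^sup>2" "g (y + b * (1 + d)) = 3 * b\<^sup>2 * (c + d)\<^sup>2"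
    "g (y + b) = 3 * b\<^sup>2 * c\<^sup>2" "g y = 3 * b\<^sup>2 * (max 0 (c - 1))\<^sup>2"
    unfolding e using scale[of "2 + d"] scale[of "1 + d"] scale[of 1] scale[of 0] c(1) d
    by (simp_all add: max_def algebra_simps)
  note gs = this
  show "p * g (y + b * (1 + d) + b) + (1 - p) * g (y + b) - p * g (y + b * (1 + d)) - (1 - p) * g y = 3 * b\<^sup>2 * B"
    "p * g (y + b * (1 + d) + b) + (1 - p) * g (y + b * (1 + d)) - p * g (y + b) - (1 - p) * g y
      = 3 * b\<^sup>2 * (B + d * (2 * c + d))"
    unfolding gs B_def by (simp_all add: power2_eq_square algebra_simps)
qed

text \<open>With a suitable truncation point the mean increases strictly as the weight
  \<open>u\<close> moves to the right of \<open>1/2\<close>. So an unequal split with the same total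
  weight beats the equal one, reversing the averaging step.\<close>

lemma equal_weights_not_optimal:
  fixes p l :: real
  assumes p: "0 < p" "p < 1" and l: "1 / 2 < l" "l < lambda_star p"
  obtains t u where "1 / 2 < u" "u < 1"
    "bernoulli_pair.pair_mean p (\<lambda>x. (max 0 (x - t)) ^ 3) 0 ((1 / 2) powr (1 / (2 * l))) ((1 / 2) powr (1 / (2 * l)))
     < bernoulli_pair.pair_mean p (\<lambda>x. (max 0 (x - t)) ^ 3) 0 (u powr (1 / (2 * l))) ((1 - u) powr (1 / (2 * l)))"
proof -
  obtain c0 where c0: "0 < c0"
    "(2 * l - 1) * (p * (2 * c0 + 1) + (1 - p) * c0\<^sup>2 - (1 - p) * (max 0 (c0 - 1))\<^sup>2) < 2 * c0"
    using below_lambda_star_witness[OF p l] .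
  define v where "v = sqrt ((1 - p) / p)"
  define k where "k = 1 / (2 * l)"
  define h where "h = (1 / 2 :: real) powr k"
  define w where "w = v + 1 / v"
  define m where "m = 2 * l - 1"
  \<comment> \<open>Chosen so that the normalized position \<open>c u\<close> of the truncation
    point equals the witness \<open>c0\<close> at \<open>u = 1/2\<close>.\<close>
  define t where "t = w * h * (1 - c0) - 2 * h / v"
  have v: "0 < v" unfolding v_def using p by simp
  have w: "0 < w" unfolding w_def using v by (simp add: add_pos_pos)
  have h: "0 < h" unfolding h_def by simp
  interpret bernoulli_pair p l "\<lambda>x. (max 0 (x - t)) ^ 3" "\<lambda>x. 3 * (max 0 (x - t))\<^sup>2"
    by unfold_locales (use p l pos_part_cube_deriv in auto)
  have V: "V = v" "\<kappa> = k" unfolding V_def v_def \<kappa>_def k_def by auto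
  define y where "y u = - (u powr k) / v - ((1 - u) powr k) / v" for u
  define c where "c u = 1 - (t - y u) / (w * (1 - u) powr k)" for u
  define d where "d u = u powr k / (1 - u) powr k - 1" for u
  define B where "B u = p * (2 * c u + 1 + 2 * d u) + (1 - p) * (c u)\<^sup>2 - (1 - p) * (max 0 (c u - 1))\<^sup>2" for u
  have y0: "y (1 / 2) = - 2 * h / v" unfolding y_def h_def by simp
  have cc0: "c (1 / 2) = c0"
    unfolding c_def y0 t_def using w h by (simp add: h_def[symmetric] field_simps)
  have d0: "d (1 / 2) = 0" unfolding d_def by simp
  have pk: "isCont (\<lambda>u. u powr k) (1 / 2)" "isCont (\<lambda>u. (1 - u) powr k) (1 / 2)"
    by (intro continuous_intros; simp)+
  have cy: "isCont y (1 / 2)" unfolding y_def using v by (intro continuous_intros pk) auto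
  have ccont: "isCont c (1 / 2)" unfolding c_def using w by (intro continuous_intros pk cy) auto
  have dcont: "isCont d (1 / 2)" unfolding d_def by (intro continuous_intros pk) auto
  have Bcont: "isCont B (1 / 2)" unfolding B_def by (intro continuous_intros ccont dcont)
  have lims: "(c \<longlongrightarrow> c0) (at_right (1 / 2))" "(d \<longlongrightarrow> 0) (at_right (1 / 2))" "(B \<longlongrightarrow> B (1 / 2)) (at_right (1 / 2))"
    using ccont dcont Bcont cc0 d0 by (auto simp: isCont_def intro: tendsto_within_subset)
  have u_near: "\<forall>\<^sub>F u in at_right (1 / 2). 1 / 2 < u \<and> u < (1::real)"
    unfolding eventually_at_right_field by (intro exI[of _ 1]) auto
  have dpos: "0 < d u" if "1 / 2 < u" "u < 1" for u
  proof -
    have "0 < k" unfolding k_def using l by simp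
    then have "(1 - u) powr k < u powr k" using that by (intro powr_less_mono2) auto
    then show ?thesis unfolding d_def using that by simp
  qed
  \<comment> \<open>By symmetry the derivative of the mean vanishes at \<open>u = 1/2\<close>, so
    its sign to the right of this point is found after division by \<open>d u\<close>. The limit of
    the divided power difference is \<open>m = 2l - 1\<close>, which leads back to the inequality
    for \<open>c0\<close>.\<close>
  have "((\<lambda>x. (1 + x) powr m) has_real_derivative m * (1 + 0) powr (m - 1) * 1) (at 0)"
    by (rule DERIV_chain2[where f = "\<lambda>z. z powr m"]) (auto intro!: derivative_eq_intros)
  then have "((\<lambda>x. ((1 + x) powr m - 1) / x) \<longlongrightarrow> m) (at 0)" by (simp add: DERIV_def)
  moreover have "filterlim d (at 0) (at_right (1 / 2))"
    using lims(2) u_near dpos by (intro filterlim_atI) (auto elim!: eventually_mono simp: less_imp_neq[symmetric])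
  ultimately have "((\<lambda>u. ((1 + d u) powr m - 1) / d u) \<longlongrightarrow> m) (at_right (1 / 2))"
    by (rule filterlim_compose)
  then have "((\<lambda>u. 2 * c u + d u - ((1 + d u) powr m - 1) / d u * B u) \<longlongrightarrow> 2 * c0 + 0 - m * B (1 / 2)) (at_right (1 / 2))"
    by (intro tendsto_intros lims)
  moreover have "0 < 2 * c0 + 0 - m * B (1 / 2)" using c0(2) unfolding B_def cc0 d0 m_def by simp
  ultimately have "\<forall>\<^sub>F u in at_right (1 / 2). 0 < 2 * c u + d u - ((1 + d u) powr m - 1) / d u * B u"
    by (rule order_tendstoD(1))
  moreover have "\<forall>\<^sub>F u in at_right (1 / 2). 0 < c u" using lims(1) c0(1) by (rule order_tendstoD(1))
  ultimately have "\<forall>\<^sub>F u in at_right (1 / 2). 0 < 2 * c u + d u - ((1 + d u) powr m - 1) / d u * B u \<and> 0 < c u \<and> u < 1"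
    using u_near by eventually_elim auto
  then obtain r where r: "1 / 2 < r"
    "\<And>u. 1 / 2 < u \<Longrightarrow> u < r \<Longrightarrow> 0 < 2 * c u + d u - ((1 + d u) powr m - 1) / d u * B u \<and> 0 < c u \<and> u < 1"
    unfolding eventually_at_right_field by auto
  define u1 where "u1 = (1 / 2 + r) / 2"
  have u1: "1 / 2 < u1" "u1 < r" unfolding u1_def using r(1) by auto
  have u11: "u1 < 1" using r(2)[OF u1] by simp
  define H where "H u = pair_mean 0 (u powr k) ((1 - u) powr k)" for u
  have "H (1 / 2) < H u1"
  proof (rule DERIV_pos_imp_increasing_open[OF u1(1)])
    fix u assume u: "1 / 2 < u" "u < u1"
    then have ur: "u < r" "0 < u" "u < 1" using u1 u11 by auto
    note rr = r(2)[OF u(1) ur(1)]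
    have du: "0 < d u" using dpos u ur by simp
    define b where "b = w * (1 - u) powr k"
    have b: "0 < b" unfolding b_def using w ur by simp
    have ab: "w * u powr k = b * (1 + d u)" unfolding b_def d_def using ur by simp
    note G = truncated_square_gap[OF b less_imp_le[OF du] less_imp_le[OF conjunct1[OF conjunct2[OF rr]]] c_def[of u, folded b_def], of p, folded B_def]
    have "((1 + d u) powr m - 1) * B u < d u * (2 * c u + d u)"
    proof -
      have "d u * (((1 + d u) powr m - 1) / d u * B u) < d u * (2 * c u + d u)"
        using rr du by (intro mult_strict_left_mono) auto
      then show ?thesis using du by simp
    qed
    then have "(1 + d u) powr m * B u < B u + d u * (2 * c u + d u)" by (simp add: algebra_simps)
    then have "u powr (k - 1) * ((1 + d u) powr m * (3 * b\<^sup>2 * B u)) < u powr (k - 1) * (3 * b\<^sup>2 * (B u + d u * (2 * c u + d u)))"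
      using ur b by (intro mult_strict_left_mono) (simp_all add: mult.left_commute)
    moreover have "u powr (k - 1) * ((1 + d u) powr m * (3 * b\<^sup>2 * B u)) = (1 - u) powr (k - 1) * (3 * b\<^sup>2 * B u)"
      using powr_weight[of u 1] ur unfolding V m_def d_def by (simp flip: mult.assoc)
    ultimately have "0 < u powr (k - 1) * (3 * b\<^sup>2 * (B u + d u * (2 * c u + d u))) - (1 - u) powr (k - 1) * (3 * b\<^sup>2 * B u)"
      by simp
    then have pos: "0 < k * (p * v) * (u powr (k - 1) * (3 * b\<^sup>2 * (B u + d u * (2 * c u + d u))) - (1 - u) powr (k - 1) * (3 * b\<^sup>2 * B u))"
      using p v kappa(1) unfolding V by (intro mult_pos_pos) auto
    have "(H has_real_derivative k * (p * v) * (u powr (k - 1) * (3 * b\<^sup>2 * (B u + d u * (2 * c u + d u))) - (1 - u) powr (k - 1) * (3 * b\<^sup>2 * B u))) (at u)"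
      using pair_mean_deriv[OF ur(2,3), of 0] unfolding V H_def[abs_def] w_def[symmetric] ab b_def[symmetric]
      unfolding add_0_right y_def[symmetric] G .
    with pos show "\<exists>D. (H has_real_derivative D) (at u) \<and> 0 < D" by blast
  next
    have "isCont H u" if "1 / 2 \<le> u" "u \<le> u1" for u
      using pair_mean_deriv[of u 1 0] that u11 unfolding V H_def[abs_def] by (auto intro!: DERIV_isCont)
    then show "continuous_on {1 / 2..u1} H" by (intro continuous_at_imp_continuous_on) auto
  qed
  then show ?thesis
    using that[OF u1(1) u11] unfolding H_def k_def by simp
qed

lemma two_point_expectation_flip_ge:
  assumes I: "finite I" and z: "\<And>i. i \<in> I \<Longrightarrow> z i = (x i, y i) \<or> z i = (y i, x i)"
    and xy: "\<And>i. i \<in> I \<Longrightarrow> 0 < x i \<and> y i < 0"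
  shows "two_point_expectation I (\<lambda>i. - y i / (x i - y i)) x y f
    \<le> two_point_expectation I (\<lambda>i. 1 - swap_weight (z i)) (\<lambda>i. fst (z i)) (\<lambda>i. snd (z i)) f"
proof (rule two_point_expectation_replace_all[OF I])
  fix i assume i: "i \<in> I"
  show "0 \<le> 1 - swap_weight (z i)" "1 - swap_weight (z i) \<le> 1" using swap_weight_bounds[of "z i"] by auto
  show "0 \<le> - y i / (x i - y i)" "- y i / (x i - y i) \<le> 1" using xy[OF i] by (auto simp: field_simps)
  fix s
  from z[OF i] show "- y i / (x i - y i) * f (x i + s) + (1 - - y i / (x i - y i)) * f (y i + s)
      \<le> (1 - swap_weight (z i)) * f (fst (z i) + s) + (1 - (1 - swap_weight (z i))) * f (snd (z i) + s)"
  proof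
    assume z: "z i = (x i, y i)"
    have "1 - swap_weight (z i) = - y i / (x i - y i)" using xy[OF i] by (simp add: swap_weight_def z field_simps)
    then show ?thesis by (simp add: z)
  next
    assume z: "z i = (y i, x i)"
    have "swap_weight (z i) = - y i / (x i - y i)" using xy[OF i] by (simp add: swap_weight_def z field_simps)
    then show ?thesis by (simp add: z)
  qed
qed

text \<open>The reciprocal of a variable with only two values is a.s. the other value: on \<open>X \<noteq> 0\<close> it takes
  values in the same support by exchangeability, and it has the opposite sign.\<close>

lemma (in reciprocal_family) AE_two_point_pair:
  assumes i: "i \<in> {1..n}" and xy: "0 < x" "y < 0" and two: "AE \<omega> in M. X i \<omega> = x \<or> X i \<omega> = y"
  shows "AE z in pair_law i. z = (x, y) \<or> z = (y, x)"
proof -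
  let ?P = "\<lambda>z. fst z = x \<or> fst z = y"
  have "{z \<in> space (borel \<Otimes>\<^sub>M borel). ?P z} \<in> sets (borel \<Otimes>\<^sub>M borel)" by measurable
  then have P: "{z. ?P z} \<in> sets (borel \<Otimes>\<^sub>M borel)" by (simp add: space_pair_measure)
  have ae: "AE z in pair_law i. ?P z" unfolding AE_pair_law_iff[OF i P] using two by simp
  show ?thesis
    using ae AE_pair_law_swap[OF i P ae] AE_pair_law_sign[OF i]
  proof eventually_elim
    case (elim z)
    then show ?case using xy by (cases z) (auto simp: mult_less_0_iff)
  qed
qed

section \<open>A family of two scaled Bernoulli variables with independent uniform variables\<close>

lemma integrable_std_bernoulli: "integrable (std_bernoulli p) (\<lambda>x. c * x)"
  unfolding std_bernoulli_def by (subst integrable_distr_eq) (auto intro!: integrable_measure_pmf_finite)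

lemma integral_std_bernoulli:
  assumes p: "0 < p" "p < 1" shows "(\<integral>x. c * x \<partial>std_bernoulli p) = 0"
  unfolding std_bernoulli_def using p by (subst integral_distr) (auto simp: field_simps)

lemma AE_std_bernoulli:
  assumes p: "0 < p" "p < 1"
  shows "AE x in std_bernoulli p. x = sqrt ((1 - p) / p) \<or> x = - 1 / sqrt ((1 - p) / p)"
proof -
  let ?A = "{x. \<not> (x = sqrt ((1 - p) / p) \<or> x = - 1 / sqrt ((1 - p) / p))}"
  have A: "?A \<in> sets borel" by measurable
  have "(\<integral>\<^sup>+x. indicator ?A x \<partial>std_bernoulli p) = 0"
    by (subst nn_integral_std_bernoulli[OF p]) (use A in auto)
  moreover have "(\<integral>\<^sup>+x. indicator ?A x \<partial>std_bernoulli p) = emeasure (std_bernoulli p) ?A"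
    using A by (intro nn_integral_indicator) (simp add: std_bernoulli_def)
  ultimately have "emeasure (std_bernoulli p) ?A = 0" by simp
  then show ?thesis by (intro AE_I[of _ _ ?A]) (auto simp: std_bernoulli_def A)
qed

lemma indep_vars_PiM_coordinates:
  assumes I: "I \<noteq> {}" and D: "\<And>i. i \<in> I \<Longrightarrow> prob_space (D i)" and S: "\<And>i. i \<in> I \<Longrightarrow> sets (D i) = sets S"
  shows "prob_space.indep_vars (Pi\<^sub>M I D) (\<lambda>_. S) (\<lambda>i \<omega>. \<omega> i) I"
    and "i \<in> I \<Longrightarrow> distr (Pi\<^sub>M I D) S (\<lambda>\<omega>. \<omega> i) = D i"
proof -
  interpret prob_space "Pi\<^sub>M I D" by (rule prob_space_PiM[OF D])
  have coord: "distr (Pi\<^sub>M I D) S (\<lambda>\<omega>. \<omega> i) = D i" if "i \<in> I" for i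
  proof -
    have "distr (Pi\<^sub>M I D) S (\<lambda>\<omega>. \<omega> i) = distr (Pi\<^sub>M I D) (D i) (\<lambda>\<omega>. \<omega> i)"
      by (rule distr_cong) (auto simp: S[OF that])
    also have "\<dots> = D i" using D that by (rule distr_PiM_component)
    finally show ?thesis .
  qed
  then show "i \<in> I \<Longrightarrow> distr (Pi\<^sub>M I D) S (\<lambda>\<omega>. \<omega> i) = D i" .
  have rv: "random_variable S (\<lambda>\<omega>. \<omega> i)" if "i \<in> I" for i
    using that measurable_component_singleton[OF that, of D] by (simp cong: measurable_cong_sets add: S)
  show "indep_vars (\<lambda>_. S) (\<lambda>i \<omega>. \<omega> i) I"
  proof (subst indep_vars_iff_distr_eq_PiM'[OF I])
    have "distr (Pi\<^sub>M I D) (Pi\<^sub>M I (\<lambda>_. S)) (\<lambda>\<omega>. \<lambda>i\<in>I. \<omega> i) = distr (Pi\<^sub>M I D) (Pi\<^sub>M I D) (\<lambda>\<omega>. \<omega>)"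
      by (rule distr_cong) (auto simp: S space_PiM PiE_def extensional_restrict intro!: sets_PiM_cong)
    also have "\<dots> = Pi\<^sub>M I D" by (rule distr_id)
    also have "\<dots> = Pi\<^sub>M I (\<lambda>i. distr (Pi\<^sub>M I D) S (\<lambda>\<omega>. \<omega> i))"
      by (intro PiM_cong refl) (simp add: coord)
    finally show "distr (Pi\<^sub>M I D) (Pi\<^sub>M I (\<lambda>_. S)) (\<lambda>\<omega>. \<lambda>i\<in>I. \<omega> i) = Pi\<^sub>M I (\<lambda>i. distr (Pi\<^sub>M I D) S (\<lambda>\<omega>. \<omega> i))" .
  qed (use rv in auto)
qed

lemma std_bernoulli_family_exists:
  assumes n: "1 \<le> n"
  shows "std_bernoulli_family (Pi\<^sub>M {1..n} (\<lambda>_. std_bernoulli p)) n p (\<lambda>i \<omega>. \<omega> i)"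
  unfolding std_bernoulli_family_def
proof (intro conjI ballI)
  show "prob_space (Pi\<^sub>M {1..n} (\<lambda>_. std_bernoulli p))" by (rule prob_space_PiM) (rule prob_space_std_bernoulli)
  show "prob_space.indep_vars (Pi\<^sub>M {1..n} (\<lambda>_. std_bernoulli p)) (\<lambda>_. borel) (\<lambda>i \<omega>. \<omega> i) {1..n}"
    by (rule indep_vars_PiM_coordinates(1)) (use n prob_space_std_bernoulli in \<open>auto simp: std_bernoulli_def\<close>)
  show "distr (Pi\<^sub>M {1..n} (\<lambda>_. std_bernoulli p)) borel (\<lambda>\<omega>. \<omega> i) = std_bernoulli p" if "i \<in> {1..n}" for i
    by (rule indep_vars_PiM_coordinates(2)) (use that prob_space_std_bernoulli in \<open>auto simp: std_bernoulli_def\<close>)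
qed

text \<open>Coordinates 1 and 2 carry the Bernoulli variables, 3 and 4 the uniform ones. Only first
  components are random; the second component 0 adapts the space to the type
  \<open>nat \<Rightarrow> real \<times> real\<close> over which the optimality claim
  ranges.\<close>

definition example_space :: "real \<Rightarrow> (nat \<Rightarrow> real \<times> real) measure" where
  "example_space p = Pi\<^sub>M {1..4} (\<lambda>i. distr (if i \<le> 2 then std_bernoulli p else unit_uniform) (borel \<Otimes>\<^sub>M borel) (\<lambda>x. (x, 0)))"

lemma example_family:
  fixes a :: "nat \<Rightarrow> real"
  assumes p: "0 < p" "p < 1"
  defines "M \<equiv> example_space p" and "X \<equiv> \<lambda>i \<omega>. a i * fst (\<omega> i)" and "U \<equiv> \<lambda>i \<omega>. fst (\<omega> (i + 2))"
  shows "zero_mean_unif_family M 2 X U"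
    and "i \<in> {1..2} \<Longrightarrow> AE \<omega> in M. fst (\<omega> i) = sqrt ((1 - p) / p) \<or> fst (\<omega> i) = - 1 / sqrt ((1 - p) / p)"
proof -
  define D0 where "D0 i = (if i \<le> 2 then std_bernoulli p else unit_uniform)" for i :: nat
  define D where "D i = distr (D0 i) (borel \<Otimes>\<^sub>M borel) (\<lambda>x. (x, 0 :: real))" for i :: nat
  have M: "M = Pi\<^sub>M {1..4} D" unfolding M_def example_space_def D_def D0_def by simp
  have sD0: "sets (D0 i) = sets borel" for i by (simp add: D0_def std_bernoulli_def)
  have pD0: "prob_space (D0 i)" for i by (simp add: D0_def prob_space_std_bernoulli prob_space_unit_uniform)
  have mD: "(\<lambda>x. (x, 0)) \<in> D0 i \<rightarrow>\<^sub>M borel \<Otimes>\<^sub>M borel" for i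
    using sD0[of i] by (simp cong: measurable_cong_sets)
  have pD: "prob_space (D i)" for i unfolding D_def by (rule prob_space.prob_space_distr[OF pD0 mD])
  have sD: "sets (D i) = sets (borel \<Otimes>\<^sub>M borel)" for i by (simp add: D_def)
  interpret M: prob_space M unfolding M by (rule prob_space_PiM[OF pD])
  have coord: "M.indep_vars (\<lambda>_. borel \<Otimes>\<^sub>M borel) (\<lambda>i \<omega>. \<omega> i) {1..4}"
    unfolding M by (rule indep_vars_PiM_coordinates(1)) (use pD sD in auto)
  have cd: "distr M (borel \<Otimes>\<^sub>M borel) (\<lambda>\<omega>. \<omega> i) = D i" if "i \<in> {1..4}" for i
    unfolding M by (rule indep_vars_PiM_coordinates(2)) (use pD sD that in auto)
  have rv: "(\<lambda>\<omega>. \<omega> i) \<in> M \<rightarrow>\<^sub>M borel \<Otimes>\<^sub>M borel" if "i \<in> {1..4}" for i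
    using coord that by (auto simp: M.indep_vars_def)
  have fd: "distr M borel (\<lambda>\<omega>. fst (\<omega> i)) = D0 i" if i: "i \<in> {1..4}" for i
  proof -
    have "distr M borel (\<lambda>\<omega>. fst (\<omega> i)) = distr (distr M (borel \<Otimes>\<^sub>M borel) (\<lambda>\<omega>. \<omega> i)) borel fst"
      using rv[OF i] by (subst distr_distr) (auto simp: o_def)
    also have "\<dots> = distr (D0 i) borel (\<lambda>x. x)"
      unfolding cd[OF i] D_def using mD by (subst distr_distr) (auto simp: o_def)
    also have "\<dots> = D0 i" by (rule distr_id2) (simp add: sD0)
    finally show ?thesis .
  qed
  have rvf: "(\<lambda>\<omega>. fst (\<omega> i)) \<in> borel_measurable M" if "i \<in> {1..4}" for i
    using rv[OF that] by measurable
  define W where "W i \<omega> = (if i \<le> 2 then a i else 1) * fst (\<omega> i)" for i :: nat and \<omega> :: "nat \<Rightarrow> real \<times> real"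
  have W: "M.indep_vars (\<lambda>_. borel) W {1..4}"
    unfolding W_def by (rule M.indep_vars_compose2[OF coord]) measurable
  have rvW: "W i \<in> borel_measurable M" if "i \<in> {1..4}" for i using W that by (auto simp: M.indep_vars_def)
  have XW: "X i = W i" if "i \<in> {1..2}" for i using that by (auto simp: X_def W_def)
  have UW: "U i = W (i + 2)" if "i \<in> {1..2}" for i using that by (auto simp: U_def W_def)
  have blocks: "M.indep_var (Pi\<^sub>M {1..2} (\<lambda>_. borel)) (\<lambda>\<omega>. \<lambda>i\<in>{1..2}. W i \<omega>) (Pi\<^sub>M {3..4} (\<lambda>_. borel)) (\<lambda>\<omega>. \<lambda>i\<in>{3..4}. W i \<omega>)"
    by (rule M.indep_var_restrict[OF W]) auto
  have shift: "(\<lambda>z. \<lambda>i\<in>{1..2}. z (i + 2)) \<in> Pi\<^sub>M {3..4} (\<lambda>_. borel) \<rightarrow>\<^sub>M Pi\<^sub>M {1..2::nat} (\<lambda>_. borel :: real measure)"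
    by (intro measurable_restrict measurable_component_singleton) auto
  have "M.indep_var (Pi\<^sub>M {1..2} (\<lambda>_. borel)) (id \<circ> (\<lambda>\<omega>. \<lambda>i\<in>{1..2}. W i \<omega>))
      (Pi\<^sub>M {1..2} (\<lambda>_. borel)) ((\<lambda>z. \<lambda>i\<in>{1..2}. z (i + 2)) \<circ> (\<lambda>\<omega>. \<lambda>i\<in>{3..4}. W i \<omega>))"
    by (rule M.indep_var_compose[OF blocks _ shift]) simp
  also have "id \<circ> (\<lambda>\<omega>. \<lambda>i\<in>{1..2}. W i \<omega>) = (\<lambda>\<omega>. \<lambda>i\<in>{1..2}. X i \<omega>)"
    by (auto simp: fun_eq_iff XW)
  also have "(\<lambda>z. \<lambda>i\<in>{1..2}. z (i + 2)) \<circ> (\<lambda>\<omega>. \<lambda>i\<in>{3..4}. W i \<omega>) = (\<lambda>\<omega>. \<lambda>i\<in>{1..2}. U i \<omega>)"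
    by (auto simp: fun_eq_iff UW)
  finally have XU: "M.indep_var (Pi\<^sub>M {1..2} (\<lambda>_. borel)) (\<lambda>\<omega>. \<lambda>i\<in>{1..2}. X i \<omega>) (Pi\<^sub>M {1..2} (\<lambda>_. borel)) (\<lambda>\<omega>. \<lambda>i\<in>{1..2}. U i \<omega>)" .
  have indX: "M.indep_vars (\<lambda>_. borel) X {1..2}"
    using M.indep_vars_subset[OF W, of "{1..2}"] by (subst M.indep_vars_cong[OF refl XW refl]) auto
  have indU: "M.indep_vars (\<lambda>_. borel) U {1..2}"
  proof -
    have "M.indep_vars (\<lambda>j. Pi\<^sub>M {j + 2} (\<lambda>_. borel)) (\<lambda>j \<omega>. restrict (\<lambda>i. W i \<omega>) {j + 2}) {1..2}"
      by (rule M.indep_vars_restrict[OF W]) (auto simp: disjoint_family_on_def)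
    then have "M.indep_vars (\<lambda>_. borel) (\<lambda>j \<omega>. (restrict (\<lambda>i. W i \<omega>) {j + 2}) (j + 2)) {1..2}"
      by (rule M.indep_vars_compose2) (rule measurable_component_singleton, simp)
    moreover have "U j = (\<lambda>\<omega>. (restrict (\<lambda>i. W i \<omega>) {j + 2}) (j + 2))" if "j \<in> {1..2}" for j
      using UW[OF that] by (auto simp: fun_eq_iff)
    ultimately show ?thesis by (subst M.indep_vars_cong[OF refl _ refl]) auto
  qed
  have mean: "integrable M (X i)" "integral\<^sup>L M (X i) = 0" if i: "i \<in> {1..2}" for i
  proof -
    have i4: "i \<in> {1..4}" using i by auto
    have d: "distr M borel (\<lambda>\<omega>. fst (\<omega> i)) = std_bernoulli p" using fd[OF i4] i by (simp add: D0_def)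
    have "integrable (distr M borel (\<lambda>\<omega>. fst (\<omega> i))) (\<lambda>x. a i * x)" unfolding d by (rule integrable_std_bernoulli)
    then show "integrable M (X i)" unfolding X_def using rvf[OF i4] by (subst (asm) integrable_distr_eq) auto
    have "(\<integral>x. a i * x \<partial>distr M borel (\<lambda>\<omega>. fst (\<omega> i))) = 0" unfolding d by (rule integral_std_bernoulli[OF p])
    then show "integral\<^sup>L M (X i) = 0" unfolding X_def using rvf[OF i4] by (subst (asm) integral_distr) auto
  qed
  have unif: "distr M borel (U i) = unit_uniform" if "i \<in> {1..2}" for i
    using fd[of "i + 2"] that by (auto simp: U_def D0_def)
  show "zero_mean_unif_family M 2 X U"
    unfolding zero_mean_unif_family_def using M.prob_space_axioms indX mean indU unif XU by blast
  show "AE \<omega> in M. fst (\<omega> i) = sqrt ((1 - p) / p) \<or> fst (\<omega> i) = - 1 / sqrt ((1 - p) / p)" if i: "i \<in> {1..2}"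
  proof (rule AE_distrD[of "\<lambda>\<omega>. fst (\<omega> i)" M borel])
    have "distr M borel (\<lambda>\<omega>. fst (\<omega> i)) = std_bernoulli p" using fd[of i] i by (simp add: D0_def)
    then show "AE x in distr M borel (\<lambda>\<omega>. fst (\<omega> i)). x = sqrt ((1 - p) / p) \<or> x = - 1 / sqrt ((1 - p) / p)"
      using AE_std_bernoulli[OF p] by (simp only:)
  qed (use rvf i in auto)
qed

text \<open>The bounded range and the atom at its top, of probability at least \<open>p ^ n\<close>,
  are what \<open>tail_comparison\<close> asks of \<open>T\<close>. Both are obtained by taking
  indicator functions as test functions in the formula for the mean.\<close>

lemma T_sum_range:
  fixes l :: real
  assumes p: "0 < p" "p < 1" and n: "1 \<le> n" and Z: "std_bernoulli_family N n p Z"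
  defines "w \<equiv> (1 / real n) powr (1 / (2 * l))" and "v \<equiv> sqrt ((1 - p) / p)"
  shows "T_sum n Z l \<in> borel_measurable N"
    and "AE \<omega> in N. - (real n * w / v) \<le> T_sum n Z l \<omega> \<and> T_sum n Z l \<omega> \<le> real n * w * v"
    and "0 < measure N {\<omega> \<in> space N. real n * w * v \<le> T_sum n Z l \<omega>}"
proof -
  interpret prob_space N using Z by (simp add: std_bernoulli_family_def)
  have rv: "Z i \<in> borel_measurable N" if "i \<in> {1..n}" for i
    using Z that by (auto simp: std_bernoulli_family_def indep_vars_def)
  show T[measurable]: "T_sum n Z l \<in> borel_measurable N"
    unfolding T_sum_def using rv by (intro borel_measurable_divide borel_measurable_sum) auto
  have v: "0 < v" unfolding v_def using p by simp
  have w: "0 < w" unfolding w_def using n by simp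
  let ?E = "two_point_expectation {1..n} (\<lambda>_. p) (\<lambda>_. w * v) (\<lambda>_. - w / v)"
  let ?a = "- (real n * w / v)" and ?b = "real n * w * v"
  define g where "g x = (if ?a \<le> x \<and> x \<le> ?b then 0 else 1 :: real)" for x
  have gm: "g \<in> borel_measurable borel" unfolding g_def by measurable
  have "?E g = 0"
    unfolding two_point_expectation_def
  proof (rule sum.neutral, rule ballI)
    fix A
    have "(\<Sum>i\<in>{1..n}. - w / v) \<le> (\<Sum>i\<in>{1..n}. if i \<in> A then w * v else - w / v)"
      "(\<Sum>i\<in>{1..n}. if i \<in> A then w * v else - w / v) \<le> (\<Sum>i\<in>{1..n}. w * v)"
      using v w by (intro sum_mono; auto intro: order_trans[of _ 0])+
    then have "g (\<Sum>i\<in>{1..n}. if i \<in> A then w * v else - w / v) = 0" by (simp add: g_def mult.assoc)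
    then show "(\<Prod>i\<in>{1..n}. if i \<in> A then p else 1 - p) * g (\<Sum>i\<in>{1..n}. if i \<in> A then w * v else - w / v) = 0" by simp
  qed
  then have "(\<integral>\<^sup>+\<omega>. ennreal (g (T_sum n Z l \<omega>)) \<partial>N) = 0"
    using nn_integral_T_sum[OF p n Z gm, of l] unfolding w_def v_def by (simp add: g_def)
  moreover have "(\<lambda>\<omega>. ennreal (g (T_sum n Z l \<omega>))) \<in> borel_measurable N" using gm by measurable
  ultimately have "AE \<omega> in N. ennreal (g (T_sum n Z l \<omega>)) = 0" by (simp add: nn_integral_0_iff_AE)
  then show "AE \<omega> in N. ?a \<le> T_sum n Z l \<omega> \<and> T_sum n Z l \<omega> \<le> ?b"
    by eventually_elim (auto simp: g_def split: if_splits)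
  define h where "h x = (if ?b \<le> x then 1 else 0 :: real)" for x
  have hm: "h \<in> borel_measurable borel" unfolding h_def by measurable
  have "p ^ n = (\<Prod>i\<in>{1..n}. if i \<in> {1..n} then p else 1 - p) * h (\<Sum>i\<in>{1..n}. if i \<in> {1..n} then w * v else - w / v)"
    by (simp add: h_def mult.assoc)
  also have "\<dots> \<le> ?E h"
    unfolding two_point_expectation_def
  proof (rule member_le_sum)
    show "0 \<le> (\<Prod>i\<in>{1..n}. if i \<in> A then p else 1 - p) * h (\<Sum>i\<in>{1..n}. if i \<in> A then w * v else - w / v)" for A
      by (intro mult_nonneg_nonneg prod_nonneg) (use p in \<open>simp_all add: h_def\<close>)
  qed auto
  finally have "0 < ?E h" using p by (meson less_le_trans zero_less_power)
  moreover have "(\<integral>\<^sup>+\<omega>. ennreal (h (T_sum n Z l \<omega>)) \<partial>N) = emeasure N {\<omega> \<in> space N. ?b \<le> T_sum n Z l \<omega>}"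
  proof -
    have "(\<integral>\<^sup>+\<omega>. ennreal (h (T_sum n Z l \<omega>)) \<partial>N) = (\<integral>\<^sup>+\<omega>. indicator {\<omega> \<in> space N. ?b \<le> T_sum n Z l \<omega>} \<omega> \<partial>N)"
      by (intro nn_integral_cong) (auto simp: h_def indicator_def)
    also have "\<dots> = emeasure N {\<omega> \<in> space N. ?b \<le> T_sum n Z l \<omega>}" by (rule nn_integral_indicator) measurable
    finally show ?thesis .
  qed
  moreover have "(\<integral>\<^sup>+\<omega>. ennreal (h (T_sum n Z l \<omega>)) \<partial>N) = ennreal (?E h)"
    unfolding w_def v_def by (rule nn_integral_T_sum[OF p n Z hm]) (simp add: h_def)
  ultimately show "0 < measure N {\<omega> \<in> space N. ?b \<le> T_sum n Z l \<omega>}"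
    by (simp add: emeasure_eq_measure)
qed

text \<open>Two scaled Bernoulli variables \<open>a i * Z i\<close>. The reciprocal of such a
  two-valued variable is its other value, so the ratio condition holds with equality and the
  conditional variance is \<open>(a i)^2\<close>. The self-normalized sum thus has the law of
  \<open>a 1 * Z 1 + a 2 * Z 2\<close>, to be compared with equal coefficients.\<close>

lemma lambda_star_optimal:
  assumes p: "0 < p" "p < 1" and l: "1 / 2 < l" "l < lambda_star p"
  obtains f X U where "f \<in> H_plus 3" "zero_mean_unif_family (example_space p) 2 X U"
    "recip_ratio_bound (example_space p) 2 X U p"
    "\<And>(N :: 'b measure) Z. std_bernoulli_family N 2 p Z \<Longrightarrow>
       (\<integral>\<^sup>+\<omega>. ennreal (f (T_sum 2 Z l \<omega>)) \<partial>N) < (\<integral>\<^sup>+\<omega>. ennreal (f (S_Y (example_space p) 2 X U l \<omega>)) \<partial>example_space p)"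
proof -
  obtain t u where u: "1 / 2 < u" "u < 1"
    and less: "bernoulli_pair.pair_mean p (\<lambda>x. (max 0 (x - t)) ^ 3) 0 ((1 / 2) powr (1 / (2 * l))) ((1 / 2) powr (1 / (2 * l)))
     < bernoulli_pair.pair_mean p (\<lambda>x. (max 0 (x - t)) ^ 3) 0 (u powr (1 / (2 * l))) ((1 - u) powr (1 / (2 * l)))"
    using equal_weights_not_optimal[OF p l] by metis
  define f where "f = (\<lambda>x::real. (max 0 (x - t)) ^ 3)"
  interpret B: bernoulli_pair p l f "\<lambda>x. 3 * (max 0 (x - t))\<^sup>2"
    unfolding f_def by unfold_locales (use p l pos_part_cube_deriv in auto)
  define k where "k = 1 / (2 * l)"
  note less = less[folded f_def k_def]
  define v where "v = sqrt ((1 - p) / p)"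
  have v: "0 < v" "v\<^sup>2 = (1 - p) / p" unfolding v_def using p by auto
  have Vv: "B.V = v" unfolding B.V_def v_def ..
  have p_v: "p = (1 / v) / (v + 1 / v)"
  proof -
    have "(1 / v) / (v + 1 / v) = 1 / (v\<^sup>2 + 1)" using v(1) by (simp add: field_simps power2_eq_square)
    also have "\<dots> = p" unfolding v(2) using p by (simp add: field_simps)
    finally show ?thesis ..
  qed
  have f0: "0 \<le> f s" for s by (simp add: f_def)
  have fH: "f \<in> H_plus 3" unfolding f_def by (rule cube_H_plus_3)
  note fm = H_plus_3_measurable[OF fH]
  \<comment> \<open>The powers \<open>(a i)^(2l)\<close> are \<open>u\<close> and
    \<open>1 - u\<close>, so the denominator of the self-normalized sum is 1 and the coefficients
    are those of the unequal split.\<close>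
  define a where "a i = (if i = 1 then u else 1 - u) powr k" for i :: nat
  have a: "0 < a i" for i using u by (auto simp: a_def)
  define X where "X = (\<lambda>i (\<omega> :: nat \<Rightarrow> real \<times> real). a i * fst (\<omega> i))"
  define U where "U = (\<lambda>i (\<omega> :: nat \<Rightarrow> real \<times> real). fst (\<omega> (i + 2)))"
  define M where "M = example_space p"
  have fam: "zero_mean_unif_family M 2 X U" unfolding M_def X_def U_def by (rule example_family(1)[OF p])
  then have "prob_space M" by (simp add: zero_mean_unif_family_def)
  then interpret reciprocal_family M 2 X U
    using fam by (simp add: reciprocal_family_def reciprocal_family_axioms_def)
  define x where "x i = a i * v" for i
  define y where "y i = - (a i / v)" for i
  have xy: "0 < x i" "y i < 0" for i using a[of i] v by (auto simp: x_def y_def)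
  have two: "AE \<omega> in M. X i \<omega> = x i \<or> X i \<omega> = y i" if i: "i \<in> {1..2}" for i
    using example_family(2)[OF p i, folded M_def v_def] by eventually_elim (auto simp: X_def x_def y_def)
  have pl: "AE z in pair_law i. z = (x i, y i) \<or> z = (y i, x i)" if i: "i \<in> {1..2}" for i
    by (rule AE_two_point_pair[OF i xy two[OF i]])
  have bound: "recip_ratio_bound M 2 X U p"
    unfolding recip_ratio_bound_def
  proof
    fix i :: nat assume i: "i \<in> {1..2}"
    let ?P = "\<lambda>z. z = (x i, y i) \<or> z = (y i, x i)"
    have "{z \<in> space (borel \<Otimes>\<^sub>M borel). (fst z = x i \<and> snd z = y i) \<or> (fst z = y i \<and> snd z = x i)} \<in> sets (borel \<Otimes>\<^sub>M borel)" by measurable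
    then have P: "{z. ?P z} \<in> sets (borel \<Otimes>\<^sub>M borel)" by (simp add: space_pair_measure prod_eq_iff)
    have "AE \<omega> in M. ?P (X i \<omega>, R i \<omega>)" using pl[OF i] unfolding AE_pair_law_iff[OF i P] .
    then show "AE \<omega> in M. (if 0 < X i \<omega> then ereal (X i \<omega>) / \<bar>recip_rv M X U i \<omega>\<bar> else 0) \<le> ereal ((1 - p) / p)"
      using AE_recip_rv[OF i]
    proof eventually_elim
      case (elim \<omega>)
      show ?case
      proof (cases "0 < X i \<omega>")
        case True
        then have e: "X i \<omega> = x i" "R i \<omega> = y i" "recip_rv M X U i \<omega> = ereal (R i \<omega>)"
          using elim xy[of i] by auto
        have "x i / \<bar>y i\<bar> = v\<^sup>2" unfolding x_def y_def using a[of i] v(1) by (simp add: power2_eq_square)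
        then show ?thesis using True xy[of i] v(2) by (simp add: e)
      next
        case False
        then show ?thesis using p by simp
      qed
    qed
  qed
  have set2: "{1..2} = {1, 2 :: nat}" by auto
  have ET: "two_point_expectation {1..2::nat} (\<lambda>_. p) (\<lambda>_. w * v) (\<lambda>_. - w / v) f = B.pair_mean 0 w w" for w
    unfolding set2 B.pair_mean_def Vv by (simp add: two_point_expectation_pair)
  have ES: "two_point_expectation {1..2::nat} (\<lambda>i. - y i / (x i - y i)) x y f = B.pair_mean 0 (u powr k) ((1 - u) powr k)"
  proof -
    have "- y i / (x i - y i) = p" for i
    proof -
      have "- y i / (x i - y i) = (a i * (1 / v)) / (a i * (v + 1 / v))" by (simp add: x_def y_def algebra_simps)
      also have "\<dots> = p" using a[of i] p_v by simp
      finally show ?thesis .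
    qed
    then show ?thesis
      unfolding set2 B.pair_mean_def Vv by (simp add: two_point_expectation_pair x_def y_def a_def)
  qed
  have "ennreal (B.pair_mean 0 (u powr k) ((1 - u) powr k)) \<le> (\<integral>\<^sup>+\<omega>. ennreal (f (S_Y M 2 X U l \<omega>)) \<partial>M)"
  proof -
    define D where "D z = (\<Sum>i\<in>{1..2}. \<bar>fst (z i) * snd (z i)\<bar> powr l) powr (1 / (2 * l))" for z :: "nat \<Rightarrow> real \<times> real"
    let ?E = "\<lambda>z. two_point_expectation {1..2} (\<lambda>i. 1 - swap_weight (z i)) (\<lambda>i. fst (z i) / D z) (\<lambda>i. snd (z i) / D z) f"
    have prob: "prob_space (pair_law i)" for i
      unfolding pair_law_def using centered_distribution.prob_space_recip_law[OF centered_law] .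
    interpret PM: prob_space "Pi\<^sub>M {1..2} pair_law" by (rule prob_space_PiM) (rule prob)
    have "AE z in Pi\<^sub>M {1..2} pair_law. \<forall>i\<in>{1..2}. z i = (x i, y i) \<or> z i = (y i, x i)"
    proof (rule AE_finite_allI)
      fix i :: nat assume i: "i \<in> {1..2}"
      show "AE z in Pi\<^sub>M {1..2} pair_law. z i = (x i, y i) \<or> z i = (y i, x i)"
        by (rule AE_PiM_component[where M = pair_law and P = "\<lambda>q. q = (x i, y i) \<or> q = (y i, x i)", OF prob i pl[OF i]])
    qed simp
    then have "AE z in Pi\<^sub>M {1..2} pair_law. ennreal (B.pair_mean 0 (u powr k) ((1 - u) powr k)) \<le> ennreal (?E z)"
    proof eventually_elim
      case (elim z)
      have "\<bar>fst (z i) * snd (z i)\<bar> powr l = (if i = 1 then u else 1 - u)" if i: "i \<in> {1..2}" for i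
      proof -
        have "z i = (x i, y i) \<or> z i = (y i, x i)" using elim i by blast
        then have "\<bar>fst (z i) * snd (z i)\<bar> = \<bar>x i * y i\<bar>" by (auto simp: mult.commute)
        also have "\<dots> = a i powr 2" using a[of i] v(1) by (simp add: x_def y_def power2_eq_square abs_mult)
        finally have "\<bar>fst (z i) * snd (z i)\<bar> powr l = (a i powr 2) powr l" by simp
        also have "\<dots> = (if i = 1 then u else 1 - u)" using u l by (simp add: a_def powr_powr k_def)
        finally show ?thesis .
      qed
      then have "(\<Sum>i\<in>{1..2}. \<bar>fst (z i) * snd (z i)\<bar> powr l) = (\<Sum>i\<in>{1..2::nat}. if i = 1 then u else 1 - u)"
        by (intro sum.cong refl)
      also have "\<dots> = 1" unfolding set2 by simp
      finally have "D z = 1" unfolding D_def by simp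
      then have "two_point_expectation {1..2} (\<lambda>i. - y i / (x i - y i)) x y f \<le> ?E z"
        using two_point_expectation_flip_ge[of "{1..2}" z x y f] elim xy by simp
      then show ?case unfolding ES by (rule ennreal_leI)
    qed
    from nn_integral_mono_AE[OF this]
    have "ennreal (B.pair_mean 0 (u powr k) ((1 - u) powr k)) \<le> (\<integral>\<^sup>+z. ennreal (?E z) \<partial>Pi\<^sub>M {1..2} pair_law)"
      using PM.emeasure_space_1 by simp
    also have "\<dots> = (\<integral>\<^sup>+\<omega>. ennreal (f (S_Y M 2 X U l \<omega>)) \<partial>M)"
      unfolding D_def by (rule nn_integral_S_Y_two_point[OF fm f0, symmetric])
    finally show ?thesis .
  qed
  note lower = this
  have "(\<integral>\<^sup>+\<omega>. ennreal (f (T_sum 2 Z l \<omega>)) \<partial>N) < (\<integral>\<^sup>+\<omega>. ennreal (f (S_Y M 2 X U l \<omega>)) \<partial>M)"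
    if Z: "std_bernoulli_family N 2 p Z" for N :: "'b measure" and Z
  proof -
    have "(\<integral>\<^sup>+\<omega>. ennreal (f (T_sum 2 Z l \<omega>)) \<partial>N) = ennreal (B.pair_mean 0 ((1 / 2) powr k) ((1 / 2) powr k))"
      using nn_integral_T_sum[OF p _ Z fm f0, of l] unfolding ET v_def[symmetric] k_def[symmetric] by simp
    also have "\<dots> < ennreal (B.pair_mean 0 (u powr k) ((1 - u) powr k))"
    proof (rule ennreal_lessI[OF _ less])
      have "0 \<le> B.pair_mean 0 ((1 / 2) powr k) ((1 / 2) powr k)"
        unfolding ET[symmetric] using p f0 by (intro two_point_expectation_nonneg) auto
      then show "0 < B.pair_mean 0 (u powr k) ((1 - u) powr k)" using less by simp
    qed
    also note lower
    finally show ?thesis .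
  qed
  then show ?thesis using that[OF fH] fam bound unfolding M_def by blast
qed

theorem corollary2p6:
  fixes p :: real
  assumes "0 < p" and "p < 1"
  shows
    "(\<forall>(M :: 'a measure) (N :: 'b measure) n X U Z l.
        1 \<le> n \<and> zero_mean_unif_family M n X U \<and> recip_ratio_bound M n X U p \<and>
        std_bernoulli_family N n p Z \<and> lambda_star p \<le> l \<longrightarrow>
          (\<forall>f\<in>H_plus 3.
             (\<integral>\<^sup>+\<omega>. ennreal (f (S_Y M n X U l \<omega>)) \<partial>M)
               \<le> (\<integral>\<^sup>+\<omega>. ennreal (f (T_sum n Z l \<omega>)) \<partial>N)) \<and>
          (\<forall>x. measure M {\<omega> \<in> space M. x \<le> S_Y M n X U l \<omega>}
             \<le> 2 * exp 3 / 9 *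
                 lc_majorant (\<lambda>y. measure N {\<omega> \<in> space N. y \<le> T_sum n Z l \<omega>}) x)) \<and>
     (\<forall>l0. 0 < l0 \<and> l0 < lambda_star p \<longrightarrow>
        \<not> (\<forall>l n. \<forall>f\<in>H_plus 3.
             \<forall>(M :: (nat \<Rightarrow> real \<times> real) measure) (N :: (nat \<Rightarrow> real) measure) X U Z.
               l0 \<le> l \<and> 1 \<le> n \<and> zero_mean_unif_family M n X U \<and>
               recip_ratio_bound M n X U p \<and> std_bernoulli_family N n p Z \<longrightarrow>
                 (\<integral>\<^sup>+\<omega>. ennreal (f (S_Y M n X U l \<omega>)) \<partial>M)
                   \<le> (\<integral>\<^sup>+\<omega>. ennreal (f (T_sum n Z l \<omega>)) \<partial>N)))"
proof (intro conjI allI impI)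
  note p = assms
  fix M :: "'a measure" and N :: "'b measure" and n :: nat and X U Z and l :: real
  assume *: "1 \<le> n \<and> zero_mean_unif_family M n X U \<and> recip_ratio_bound M n X U p \<and>
        std_bernoulli_family N n p Z \<and> lambda_star p \<le> l"
  then have n: "1 \<le> n" and fam: "zero_mean_unif_family M n X U" and bound: "recip_ratio_bound M n X U p"
    and Z: "std_bernoulli_family N n p Z" and l: "lambda_star p \<le> l" by auto
  have M: "prob_space M" using fam by (simp add: zero_mean_unif_family_def)
  have N: "prob_space N" using Z by (simp add: std_bernoulli_family_def)
  interpret reciprocal_family M n X U
    using M fam n by (simp add: reciprocal_family_def reciprocal_family_axioms_def)
  have main: "(\<integral>\<^sup>+\<omega>. ennreal (f (S_Y M n X U l \<omega>)) \<partial>M) \<le> (\<integral>\<^sup>+\<omega>. ennreal (f (T_sum n Z l \<omega>)) \<partial>N)"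
    if f: "f \<in> H_plus 3" for f
    using nn_integral_S_Y_le[OF p bound l f] H_plus_nonneg[OF f]
    by (subst nn_integral_T_sum[OF p n Z H_plus_3_measurable[OF f]]) auto
  then show "\<forall>f\<in>H_plus 3. (\<integral>\<^sup>+\<omega>. ennreal (f (S_Y M n X U l \<omega>)) \<partial>M) \<le> (\<integral>\<^sup>+\<omega>. ennreal (f (T_sum n Z l \<omega>)) \<partial>N)" by blast
  fix x
  show "measure M {\<omega> \<in> space M. x \<le> S_Y M n X U l \<omega>}
      \<le> 2 * exp 3 / 9 * lc_majorant (\<lambda>y. measure N {\<omega> \<in> space N. y \<le> T_sum n Z l \<omega>}) x"
    by (rule tail_comparison[OF M N T_sum_range[OF p n Z] main[OF cube_H_plus_3]])
next
  fix l0 :: real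
  assume l0: "0 < l0 \<and> l0 < lambda_star p"
  \<comment> \<open>The counterexample requires \<open>l > 1/2\<close>, while \<open>l0\<close> may
    be smaller. The claim to be refuted concerns every \<open>l >= l0\<close>, so raising
    \<open>l0\<close> to \<open>3/4\<close> is allowed, and it stays below
    \<open>lambda_star p\<close>, which is at least 1.\<close>
  define l where "l = max l0 (3 / 4)"
  have l: "1 / 2 < l" "l < lambda_star p" "l0 \<le> l"
    using l0 lambda_star_ge_1[OF assms] by (auto simp: l_def)
  obtain f X U where f: "f \<in> H_plus 3" and ex: "zero_mean_unif_family (example_space p) 2 X U"
    "recip_ratio_bound (example_space p) 2 X U p"
    and less: "\<And>(N :: (nat \<Rightarrow> real) measure) Z. std_bernoulli_family N 2 p Z \<Longrightarrow>
       (\<integral>\<^sup>+\<omega>. ennreal (f (T_sum 2 Z l \<omega>)) \<partial>N) < (\<integral>\<^sup>+\<omega>. ennreal (f (S_Y (example_space p) 2 X U l \<omega>)) \<partial>example_space p)"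
    using lambda_star_optimal[OF assms l(1,2)] by metis
  have Z: "std_bernoulli_family (Pi\<^sub>M {1..2} (\<lambda>_. std_bernoulli p)) 2 p (\<lambda>i \<omega>. \<omega> i)"
    by (rule std_bernoulli_family_exists) simp
  show "\<not> (\<forall>l n. \<forall>f\<in>H_plus 3.
             \<forall>(M :: (nat \<Rightarrow> real \<times> real) measure) (N :: (nat \<Rightarrow> real) measure) X U Z.
               l0 \<le> l \<and> 1 \<le> n \<and> zero_mean_unif_family M n X U \<and>
               recip_ratio_bound M n X U p \<and> std_bernoulli_family N n p Z \<longrightarrow>
                 (\<integral>\<^sup>+\<omega>. ennreal (f (S_Y M n X U l \<omega>)) \<partial>M)
                   \<le> (\<integral>\<^sup>+\<omega>. ennreal (f (T_sum n Z l \<omega>)) \<partial>N))"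
  proof
    assume H: "\<forall>l n. \<forall>f\<in>H_plus 3.
             \<forall>(M :: (nat \<Rightarrow> real \<times> real) measure) (N :: (nat \<Rightarrow> real) measure) X U Z.
               l0 \<le> l \<and> 1 \<le> n \<and> zero_mean_unif_family M n X U \<and>
               recip_ratio_bound M n X U p \<and> std_bernoulli_family N n p Z \<longrightarrow>
                 (\<integral>\<^sup>+\<omega>. ennreal (f (S_Y M n X U l \<omega>)) \<partial>M)
                   \<le> (\<integral>\<^sup>+\<omega>. ennreal (f (T_sum n Z l \<omega>)) \<partial>N)"
    have "(\<integral>\<^sup>+\<omega>. ennreal (f (S_Y (example_space p) 2 X U l \<omega>)) \<partial>example_space p)
        \<le> (\<integral>\<^sup>+\<omega>. ennreal (f (T_sum 2 (\<lambda>i \<omega>. \<omega> i) l \<omega>)) \<partial>Pi\<^sub>M {1..2} (\<lambda>_. std_bernoulli p))"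
      by (rule H[rule_format, OF f]) (use l(3) ex Z in auto)
    then show False using less[OF Z] by (simp add: not_le[symmetric])
  qed
qed

end
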